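(* Let $X(w)\subset \mathrm{IG}(k,2n+1)$ be a Schubert variety such that $X(w)\cap X^\circ\neq\emptyset$ and let $d$ be an effective degree. Then the curve neighborhood $\Gamma_d(X(w))$ is irreducible.
   Context: For $1\le i\le 2n+2$ put $\bar i=2n+3-i$. Let $\widetilde E=\mathbb{C}^{2n+2}$ with basis $e_1,\dots,e_{2n+2}$ and symplectic form with $\widetilde\omega(e_i,e_j)=\delta_{i,\bar j}$ for $i\le j$; $E=\langle e_1,\dots,e_{2n+1}\rangle$, $\omega=\widetilde\omega|_E$ (kernel spanned by $e_1$). $X=\mathrm{IG}(k,2n+1)$ ($1\le k\le n+1$) is the smooth projective variety of $k$-dimensional $\omega$-isotropic subspaces of $E$; $H_2(X,\mathbb{Z})\cong\mathbb{Z}$, so effective degrees are nonnegative integers. $\mathrm{Sp}_{2n+1}\subset\mathrm{GL}(E)$ is the group preserving $\omega$, $B$ its subgroup of upper triangular matrices, and $X^\circ=\{V\in X:e_1\notin V\}$ (the open $\mathrm{Sp}_{2n+1}$-orbit when $k\le n$, empty when $k=n+1$). The Schubert varieties of $X$ are the closures $X(w)$ of the $B$-orbits of $\langle e_{w(1)},\dots,e_{w(k)}\rangle$, where $w=(w(1)<\dots<w(k))$ is a sequence in $\{1,\dots,2n+1\}$ with no pair $i,\bar i$. For a closed subvariety $\Omega\subset X$, $\Gamma_d(\Omega)=\mathrm{ev}_2(\mathrm{ev}_1^{-1}(\Omega))$ with reduced structure, where $\mathrm{ev}_1,\mathrm{ev}_2:\overline{\mathcal M}_{0,2}(X,d)\to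 X$ are the evaluation maps on the moduli space of genus 0 degree $d$ two-pointed stable maps. *)

theory Defs
  imports
    Complex_Main
    "HOL-Library.Function_Algebras"
    "HOL-Library.Poly_Mapping"
    "HOL-Analysis.Abstract_Topology"
    "Jordan_Normal_Form.Determinant"
begin

text \<open>
  Vectors are functions from nat to the complex numbers; \<open>E\<close> below is the finite-dimensional
  subspace of those supported on \<open>{1..2n+1}\<close>, so that basis vectors keep their 1-based indices.
\<close>

definition cscale :: "complex \<Rightarrow> (nat \<Rightarrow> complex) \<Rightarrow> (nat \<Rightarrow> complex)" where
  "cscale c v = (\<lambda>i. c * v i)"

interpretation cvs: vector_space cscale
  by unfold_locales (auto simp: cscale_def fun_eq_iff algebra_simps)

definition basis_vec :: "nat \<Rightarrow> nat \<Rightarrow> complex" where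
  "basis_vec i = (\<lambda>j. if j = i then 1 else 0)"

definition idx_bar :: "nat \<Rightarrow> nat \<Rightarrow> nat" where
  "idx_bar n i = 2 * n + 3 - i"

definition E :: "nat \<Rightarrow> (nat \<Rightarrow> complex) set" where
  "E n = cvs.span (basis_vec ` {1..2 * n + 1})"

text \<open>
  The alternating bilinear form on the span of \<open>e\<^sub>1, \<dots>, e\<^bsub>2n+2\<^esub>\<close> whose value on
  \<open>(e\<^sub>i, e\<^sub>j)\<close>, \<open>i \<le> j\<close>, is 1 if \<open>i\<close> is the bar of \<open>j\<close> and 0 otherwise.  On \<open>E n\<close>,
  where the last coordinate vanishes, it is the odd symplectic form.
\<close>

definition omega :: "nat \<Rightarrow> (nat \<Rightarrow> complex) \<Rightarrow> (nat \<Rightarrow> complex) \<Rightarrow> complex" where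
  "omega n x y = (\<Sum>i=1..n+1. x i * y (idx_bar n i) - x (idx_bar n i) * y i)"

definition IG :: "nat \<Rightarrow> nat \<Rightarrow> (nat \<Rightarrow> complex) set set" where
  "IG n k = {V. cvs.subspace V \<and> V \<subseteq> E n \<and> cvs.dim V = k \<and>
                (\<forall>x\<in>V. \<forall>y\<in>V. omega n x y = 0)}"

definition IG_open :: "nat \<Rightarrow> nat \<Rightarrow> (nat \<Rightarrow> complex) set set" where
  "IG_open n k = {V \<in> IG n k. basis_vec 1 \<notin> V}"


text \<open>Matrices of the library are indexed from 0, hence the shift.\<close>

definition mat_act :: "nat \<Rightarrow> complex mat \<Rightarrow> (nat \<Rightarrow> complex) \<Rightarrow> (nat \<Rightarrow> complex)" where
  "mat_act n A v =
     (\<lambda>i. if i \<in> {1..2 * n + 1} then \<Sum>j=1..2*n+1. A $$ (i - 1, j - 1) * v j else 0)"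

definition odd_Sp :: "nat \<Rightarrow> complex mat set" where
  "odd_Sp n = {A \<in> carrier_mat (2 * n + 1) (2 * n + 1). invertible_mat A \<and>
                 (\<forall>x\<in>E n. \<forall>y\<in>E n. omega n (mat_act n A x) (mat_act n A y) = omega n x y)}"

definition borel_Sp :: "nat \<Rightarrow> complex mat set" where
  "borel_Sp n = {A \<in> odd_Sp n. upper_triangular A}"


text \<open>
  Pluecker coordinates with respect to an ordered basis \<open>u 0, \<dots>, u (k - 1)\<close> of a subspace;
  they are indexed by the \<open>k\<close>-element subsets of \<open>{1..2n+1}\<close>.  Changing the ordered basis
  rescales them by a common nonzero factor.
\<close>

definition ordered_bases :: "nat \<Rightarrow> (nat \<Rightarrow> complex) set \<Rightarrow> (nat \<Rightarrow> nat \<Rightarrow> complex) set" where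
  "ordered_bases k V = {u. inj_on u {..<k} \<and> cvs.independent (u ` {..<k}) \<and>
                           cvs.span (u ` {..<k}) = V}"

definition pluecker :: "nat \<Rightarrow> nat \<Rightarrow> (nat \<Rightarrow> nat \<Rightarrow> complex) \<Rightarrow> nat set \<Rightarrow> complex" where
  "pluecker n k u I =
     (if I \<subseteq> {1..2 * n + 1} \<and> card I = k
      then det (mat k k (\<lambda>(a, b). u a (sorted_list_of_set I ! b))) else 0)"


text \<open>Polynomials with variables in \<open>'v\<close> are finitely supported maps from monomials to
  coefficients.\<close>

definition mpoly_eval :: "(('v \<Rightarrow>\<^sub>0 nat) \<Rightarrow>\<^sub>0 complex) \<Rightarrow> ('v \<Rightarrow> complex) \<Rightarrow> complex" where
  "mpoly_eval p x =
     (\<Sum>m\<in>Poly_Mapping.keys p. Poly_Mapping.lookup p m *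
        (\<Prod>v\<in>Poly_Mapping.keys m. x v ^ Poly_Mapping.lookup m v))"

definition mpoly_homogeneous :: "(('v \<Rightarrow>\<^sub>0 nat) \<Rightarrow>\<^sub>0 complex) \<Rightarrow> bool" where
  "mpoly_homogeneous p \<longleftrightarrow>
     (\<exists>e. \<forall>m\<in>Poly_Mapping.keys p. (\<Sum>v\<in>Poly_Mapping.keys m. Poly_Mapping.lookup m v) = e)"

text \<open>
  The Zariski topology of \<open>IG n k\<close> as a projective variety in its Pluecker embedding: it is
  generated by the nonvanishing loci of homogeneous polynomials in the Pluecker coordinates.
\<close>

definition basic_open ::
    "nat \<Rightarrow> nat \<Rightarrow> ((nat set \<Rightarrow>\<^sub>0 nat) \<Rightarrow>\<^sub>0 complex) \<Rightarrow> (nat \<Rightarrow> complex) set set" where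
  "basic_open n k p =
     {V \<in> IG n k. \<exists>u\<in>ordered_bases k V. mpoly_eval p (pluecker n k u) \<noteq> 0}"

definition zariski :: "nat \<Rightarrow> nat \<Rightarrow> (nat \<Rightarrow> complex) set topology" where
  "zariski n k = topology_generated_by (basic_open n k ` Collect mpoly_homogeneous)"

definition irreducible_in :: "'a topology \<Rightarrow> 'a set \<Rightarrow> bool" where
  "irreducible_in T S \<longleftrightarrow> S \<subseteq> topspace T \<and> S \<noteq> {} \<and>
     (\<forall>A B. closedin T A \<longrightarrow> closedin T B \<longrightarrow> S \<subseteq> A \<union> B \<longrightarrow> S \<subseteq> A \<or> S \<subseteq> B)"


definition schubert_index :: "nat \<Rightarrow> nat \<Rightarrow> (nat \<Rightarrow> nat) \<Rightarrow> bool" where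
  "schubert_index n k w \<longleftrightarrow> strict_mono_on {1..k} w \<and> w ` {1..k} \<subseteq> {1..2 * n + 1} \<and>
     (\<forall>i\<in>{1..k}. \<forall>j\<in>{1..k}. w j \<noteq> idx_bar n (w i))"

definition schubert_variety ::
    "nat \<Rightarrow> nat \<Rightarrow> (nat \<Rightarrow> nat) \<Rightarrow> (nat \<Rightarrow> complex) set set" where
  "schubert_variety n k w =
     zariski n k closure_of
       ((\<lambda>A. mat_act n A ` cvs.span (basis_vec ` w ` {1..k})) ` borel_Sp n)"


text \<open>The projective line: \<open>Some z\<close> is the point \<open>[z : 1]\<close> and \<open>None\<close> is \<open>[1 : 0]\<close>.\<close>

type_synonym P1 = "complex option"

primrec hom_coords :: "P1 \<Rightarrow> complex \<times> complex" where
  "hom_coords None = (1, 0)"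
| "hom_coords (Some z) = (z, 1)"

text \<open>The binary form of degree \<open>d\<close> in \<open>(s, t)\<close> whose coefficient at \<open>s\<^sup>i t\<^bsup>d-i\<^esup>\<close> is that of
  \<open>p\<close> at \<open>i\<close>.\<close>

definition binary_form :: "nat \<Rightarrow> complex poly \<Rightarrow> complex \<times> complex \<Rightarrow> complex" where
  "binary_form d p = (\<lambda>(s, t). \<Sum>i\<le>d. coeff p i * s ^ i * t ^ (d - i))"

text \<open>
  Morphisms from the projective line to \<open>IG n k\<close> of degree \<open>d\<close>: in Pluecker coordinates they are
  given by binary forms of degree \<open>d\<close>.  These have no common zero, because Pluecker coordinates of a
  subspace are never all 0.  The degree in the second homology of \<open>IG n k\<close> is the degree of the
  pullback of the hyperplane class of the Pluecker embedding, since lines generate the homology.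
\<close>

definition P1_morphism :: "nat \<Rightarrow> nat \<Rightarrow> nat \<Rightarrow> (P1 \<Rightarrow> (nat \<Rightarrow> complex) set) \<Rightarrow> bool" where
  "P1_morphism n k d f \<longleftrightarrow>
     (\<exists>p. \<forall>x. f x \<in> IG n k \<and>
        (\<exists>u\<in>ordered_bases k (f x). \<forall>I. pluecker n k u I = binary_form d (p I) (hom_coords x)))"


text \<open>
  A connected nodal curve of arithmetic genus 0 is a tree of projective lines.  Components are
  labelled by natural numbers; \<open>sm_adj\<close> is the adjacency relation of the dual graph,
  \<open>sm_node v v'\<close> is the point of component \<open>v\<close> glued to the point \<open>sm_node v' v\<close> of component
  \<open>v'\<close>, and a marked point is a component together with a point on it.
\<close>

record pointed_map =
  sm_comps :: "nat set"
  sm_adj :: "(nat \<times> nat) set"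
  sm_node :: "nat \<Rightarrow> nat \<Rightarrow> P1"
  sm_map :: "nat \<Rightarrow> P1 \<Rightarrow> (nat \<Rightarrow> complex) set"
  sm_deg :: "nat \<Rightarrow> nat"
  sm_mark1 :: "nat \<times> P1"
  sm_mark2 :: "nat \<times> P1"

definition sm_nodes :: "pointed_map \<Rightarrow> nat \<Rightarrow> P1 set" where
  "sm_nodes m v = sm_node m v ` (sm_adj m `` {v})"

definition sm_specials :: "pointed_map \<Rightarrow> nat \<Rightarrow> P1 set" where
  "sm_specials m v = sm_nodes m v \<union> {x. (v, x) = sm_mark1 m \<or> (v, x) = sm_mark2 m}"

text \<open>A connected graph is a tree iff it has one edge less than vertices; \<open>sm_adj\<close> contains each
  edge in both directions.\<close>

definition prestable_curve :: "pointed_map \<Rightarrow> bool" where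
  "prestable_curve m \<longleftrightarrow>
     finite (sm_comps m) \<and> sm_comps m \<noteq> {} \<and>
     sm_adj m \<subseteq> sm_comps m \<times> sm_comps m \<and> sym (sm_adj m) \<and> irrefl (sm_adj m) \<and>
     (\<forall>v\<in>sm_comps m. \<forall>v'\<in>sm_comps m. (v, v') \<in> (sm_adj m)\<^sup>*) \<and>
     card (sm_adj m) = 2 * (card (sm_comps m) - 1) \<and>
     (\<forall>v\<in>sm_comps m. inj_on (sm_node m v) (sm_adj m `` {v})) \<and>
     (\<forall>a\<in>{sm_mark1 m, sm_mark2 m}. fst a \<in> sm_comps m \<and> snd a \<notin> sm_nodes m (fst a)) \<and>
     sm_mark1 m \<noteq> sm_mark2 m"

text \<open>
  Representatives of the points of the moduli space of 2-pointed stable maps of genus 0 and degree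
  \<open>d\<close> to \<open>IG n k\<close>.  The evaluation maps do not depend on the representative of an isomorphism class.
\<close>

definition stable_maps :: "nat \<Rightarrow> nat \<Rightarrow> nat \<Rightarrow> pointed_map set" where
  "stable_maps n k d = {m. prestable_curve m \<and>
     (\<forall>v\<in>sm_comps m. P1_morphism n k (sm_deg m v) (sm_map m v)) \<and>
     (\<forall>(v, v')\<in>sm_adj m. sm_map m v (sm_node m v v') = sm_map m v' (sm_node m v' v)) \<and>
     (\<Sum>v\<in>sm_comps m. sm_deg m v) = d \<and>
     (\<forall>v\<in>sm_comps m. sm_deg m v = 0 \<longrightarrow> card (sm_specials m v) \<ge> 3)}"

definition ev1 :: "pointed_map \<Rightarrow> (nat \<Rightarrow> complex) set" where
  "ev1 m = sm_map m (fst (sm_mark1 m)) (snd (sm_mark1 m))"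

definition ev2 :: "pointed_map \<Rightarrow> (nat \<Rightarrow> complex) set" where
  "ev2 m = sm_map m (fst (sm_mark2 m)) (snd (sm_mark2 m))"

text \<open>
  There are no 2-pointed stable maps of degree 0, so the usual convention that the degree 0
  neighborhood of a subvariety is the subvariety itself has to be imposed separately.
\<close>

definition curve_nbhd ::
    "nat \<Rightarrow> nat \<Rightarrow> nat \<Rightarrow> (nat \<Rightarrow> complex) set set \<Rightarrow> (nat \<Rightarrow> complex) set set" where
  "curve_nbhd n k d \<Omega> =
     (if d = 0 then \<Omega> else ev2 ` {m \<in> stable_maps n k d. ev1 m \<in> \<Omega>})"

end

theory Submission
  imports Defs
begin

text \<open>
  A rational curve of degree \<open>d\<close> through \<open>V\<close> and \<open>V'\<close> forces \<open>dim (V \<inter> V') \<ge> k - d\<close>.  Hence every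
  point of the curve neighborhood of \<open>X(w)\<close> lies in a Schubert cell whose index \<open>v\<close> satisfies
  \<open>v(j - d) \<le> w(j)\<close> for \<open>j > d\<close>.  If \<open>X(w)\<close> meets the open orbit, then \<open>1\<close> is not in \<open>w\<close>, and this
  makes the set of such indices have a greatest element \<open>w'\<close> in the Bruhat order: keep the elements
  of \<open>w\<close> apart from its \<open>d\<close> smallest ones, and add the \<open>d\<close> largest indices \<open>u\<close> compatible with
  them.  So the neighborhood is contained in \<open>X(w')\<close>.  Conversely, the curve spanned by the common
  basis vectors and the vectors \<open>s e\<^bsub>bar u\<^esub> + t e\<^sub>u\<close> joins a point of \<open>X(w)\<close> to the torus fixed point
  of index \<open>w'\<close>, and by translation the neighborhood contains the whole cell of \<open>w'\<close>.  A set between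
  an irreducible set and its closure is irreducible.

  Closures are computed with polynomial curves: the preimage of a Zariski open set under such a
  curve is empty or cofinite.
\<close>

subsection \<open>The Bruhat order on admissible index sets\<close>

text \<open>A morphism is given only by its Pluecker coordinates, so no polynomial frame along a
  rational curve is at hand from which a common subspace could be read off. The incidence estimate
  is therefore proved for coordinates: the vanishing conditions that hold on Schubert varieties
  survive along a curve of degree e with a loss of e, by an exchange identity and a count of zeros.
  The loss is additive, so for a tree of curves only the total degree matters.

  Orbits are handled through words in Siegel transformations. Every factor lies in a polynomial
  one-parameter family, so two points of a cell are joined by a polynomial curve inside it, and
  reflections of index sets arise as limits of such curves.

  The condition that 1 is not in w provides room: each of the d discarded elements c occupies a pair
  {c, bar c}, and these pairs must supply d upper members inside E. The partner of 1 is 2n+2, which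
  lies outside. If d > k, only k elements can be discarded, and the surplus degree goes into one
  exponent of the connecting curve.\<close>

definition count_above :: "nat set \<Rightarrow> nat \<Rightarrow> nat" where
  "count_above v i = card (v \<inter> {i<..})"

text \<open>For sets of equal size this is the comparison of the sorted elements position by
  position. In terms of counts, exchanging \<open>a\<close> for a larger \<open>b\<close> adds one
  exactly for \<open>a \<le> i < b\<close>.\<close>

definition bruhat_le :: "nat set \<Rightarrow> nat set \<Rightarrow> bool" where
  "bruhat_le v w \<longleftrightarrow> (\<forall>i. count_above v i \<le> count_above w i)"

definition admissible :: "nat \<Rightarrow> nat \<Rightarrow> nat set \<Rightarrow> bool" where
  "admissible n k v \<longleftrightarrow> v \<subseteq> {1..2 * n + 1} \<and> card v = k \<and> (\<forall>i\<in>v. idx_bar n i \<notin> v)"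

text \<open>On an admissible set that contains \<open>b\<close> but not \<open>a\<close>, this acts as the reflection exchanging
  \<open>a\<close> with \<open>b\<close> and bar \<open>a\<close> with bar \<open>b\<close>.\<close>

definition reflect :: "nat \<Rightarrow> nat \<Rightarrow> nat \<Rightarrow> nat \<Rightarrow> nat" where
  "reflect n a b m = (if m = b then a else if m = idx_bar n a then idx_bar n b else m)"

lemma admissible_finite: "admissible n k v \<Longrightarrow> finite v"
  by (auto simp: admissible_def intro: finite_subset)

lemma idx_bar_bar: "i \<le> 2 * n + 3 \<Longrightarrow> idx_bar n (idx_bar n i) = i"
  by (simp add: idx_bar_def)

lemma idx_bar_neq: "i \<le> 2 * n + 3 \<Longrightarrow> idx_bar n i \<noteq> i"
  unfolding idx_bar_def by presburger

lemma count_above_split: "finite v \<Longrightarrow> i \<le> j \<Longrightarrow> count_above v i = count_above v j + card (v \<inter> {i<..j})"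
proof -
  assume "finite v" "i \<le> j"
  then have "v \<inter> {i<..} = (v \<inter> {j<..}) \<union> (v \<inter> {i<..j})" by auto
  with \<open>finite v\<close> show ?thesis unfolding count_above_def
    by (metis (no_types, lifting) card_Un_disjoint finite_Int disjoint_iff Int_iff
        greaterThanAtMost_iff greaterThan_iff leD)
qed

lemma count_above_le_card: "finite v \<Longrightarrow> count_above v i \<le> card v"
  unfolding count_above_def by (auto intro: card_mono)

lemma count_above_Un_disjoint:
  "finite v \<Longrightarrow> finite w \<Longrightarrow> v \<inter> w = {} \<Longrightarrow> count_above (v \<union> w) i = count_above v i + count_above w i"
  unfolding count_above_def Int_Un_distrib2 by (rule card_Un_disjoint) auto

lemma count_above_exchange:
  assumes "finite v" "a \<in> v" "b \<notin> v" "a < b"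
  shows "count_above (insert b (v - {a})) i = count_above v i + (if a \<le> i \<and> i < b then 1 else 0)"
proof -
  consider "i < a" | "a \<le> i" "i < b" | "b \<le> i" by linarith
  then show ?thesis
  proof cases
    case 1
    then have "insert b (v - {a}) \<inter> {i<..} = insert b (v \<inter> {i<..} - {a})" using assms by auto
    moreover have "card (insert b (v \<inter> {i<..} - {a})) = card (v \<inter> {i<..})"
      using assms 1 card.remove[of "v \<inter> {i<..}" a] by simp
    ultimately show ?thesis using 1 by (simp add: count_above_def)
  next
    case 2
    then have "insert b (v - {a}) \<inter> {i<..} = insert b (v \<inter> {i<..})" using assms by auto
    then show ?thesis using 2 assms by (simp add: count_above_def)
  next
    case 3
    then have "insert b (v - {a}) \<inter> {i<..} = v \<inter> {i<..}" using assms by auto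
    then show ?thesis using 3 assms by (simp add: count_above_def)
  qed
qed

lemma sum_exchange:
  assumes "finite v" "a \<in> v" "b \<notin> v" "(a::nat) < b"
  shows "\<Sum>v < \<Sum>(insert b (v - {a}))"
  using assms by (simp add: sum.remove[of v a])

lemma card_exchange:
  assumes "finite v" "a \<in> v" "b \<notin> v"
  shows "card (insert b (v - {a})) = card v"
  using assms card.remove[of v a] by simp

lemma count_above_inject:
  assumes "finite v" "finite w" "v \<subseteq> {1..N}" "w \<subseteq> {1..N}" "\<And>i. count_above v i = count_above w i"
  shows "v = w"
proof -
  have "x \<in> u \<longleftrightarrow> count_above u (x - 1) = Suc (count_above u x)" if "finite u" "x \<ge> 1" for u x
  proof -
    have "{x - 1<..x} = {x}" using that by auto
    then show ?thesis using count_above_split[of u "x - 1" x] that by (cases "x \<in> u") auto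
  qed
  then show ?thesis using assms by (metis (no_types, lifting) atLeastAtMost_iff subset_iff subset_antisym)
qed

text \<open>
  Let \<open>c\<close> be the largest index at which \<open>v\<close> and \<open>w\<close> differ and \<open>a\<close> the next smaller element of \<open>v\<close>.
  One can raise \<open>a\<close> to any \<open>b\<close> with \<open>a < b \<le> c\<close> unless bar \<open>b\<close> obstructs it.  If all of them are
  obstructed, then raise \<open>a\<close> to \<open>a + 1\<close> and bar \<open>(a + 1)\<close> to bar \<open>a\<close> simultaneously.
\<close>

theorem bruhat_step:
  assumes v: "admissible n k v" and w: "admissible n k w" and le: "bruhat_le v w" and ne: "v \<noteq> w"
  obtains a b v' where "admissible n k v'" "1 \<le> a" "a < b" "b \<in> v'" "a \<notin> v'"
    "v = reflect n a b ` v'" "bruhat_le v' w" "\<Sum>v < \<Sum>v'"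
proof -
  have fin [simp]: "finite v" "finite w" using v w by (auto dest: admissible_finite)
  have vN: "v \<subseteq> {1..2*n+1}" "card v = k" "\<And>i. i \<in> v \<Longrightarrow> idx_bar n i \<notin> v"
    and wN: "w \<subseteq> {1..2*n+1}" "card w = k" "\<And>i. i \<in> w \<Longrightarrow> idx_bar n i \<notin> w"
    using v w by (auto simp: admissible_def)
  define S where "S = (v - w) \<union> (w - v)"
  define c where "c = Max S"
  have S: "finite S" "S \<noteq> {}" using ne by (auto simp: S_def)
  have cS: "c \<in> S" unfolding c_def using S by (rule Max_in)
  have agree: "x \<in> v \<longleftrightarrow> x \<in> w" if "x > c" for x
    using that S Max_ge[of S x] unfolding c_def S_def by fastforce
  have cnteq: "count_above v c = count_above w c"
    unfolding count_above_def using agree by (intro arg_cong[where f = card]) auto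
  have c1: "c \<ge> 1" "c \<le> 2*n+1" using cS vN(1) wN(1) unfolding S_def by fastforce+
  have cw: "c \<in> w" "c \<notin> v"
  proof -
    have iv: "{c - 1<..c} = {c}" using c1 by auto
    have "c \<notin> v"
    proof
      assume "c \<in> v"
      then have "c \<notin> w" using cS by (auto simp: S_def)
      with \<open>c \<in> v\<close> have "count_above v (c - 1) > count_above w (c - 1)"
        using count_above_split[of v "c - 1" c] count_above_split[of w "c - 1" c] iv cnteq by simp
      with le show False by (auto simp: bruhat_le_def not_le[symmetric])
    qed
    then show "c \<in> w" "c \<notin> v" using cS by (auto simp: S_def)
  qed
  have nonemp: "v \<inter> {..<c} \<noteq> {}"
  proof
    assume "v \<inter> {..<c} = {}"
    then have "x > c" if "x \<in> v" for x
      using that cw linorder_neqE_nat[of x c] by auto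
    then have "v \<subseteq> w - {c}" using agree by auto
    then have "card v \<le> card (w - {c})" by (intro card_mono) auto
    also have "\<dots> < card w" using cw by (intro card_Diff1_less) auto
    finally have "card v < card w" .
    with vN wN show False by simp
  qed
  define a where "a = Max (v \<inter> {..<c})"
  have "a \<in> v \<inter> {..<c}" unfolding a_def by (rule Max_in) (use nonemp in auto)
  then have a: "a \<in> v" "a < c" by auto
  have a1: "1 \<le> a" "a \<le> 2*n+1" using a vN(1) by auto
  have gap: "x \<notin> v" if "a < x" "x \<le> c" for x
  proof
    assume "x \<in> v"
    with that cw have "x \<in> v \<inter> {..<c}" by (metis IntI le_neq_implies_less lessThan_iff)
    then have "x \<le> a" unfolding a_def by (intro Max_ge) auto
    with that show False by simp
  qed
  \<comment> \<open>This is the reserve for raising \<open>a\<close> to any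
    \<open>b \<le> c\<close>: the exchange adds one to the counts only where the inequality is
    strict.\<close>
  have strict: "count_above v i < count_above w i" if "a \<le> i" "i < c" for i
  proof -
    have "v \<inter> {i<..c} = {}" using gap that by auto
    moreover have "card (w \<inter> {i<..c}) > 0" using cw that by (auto simp: card_gt_0_iff)
    ultimately show ?thesis using count_above_split[of v i c] count_above_split[of w i c] that cnteq by simp
  qed
  have bara: "idx_bar n a \<notin> v" using vN a by auto
  show thesis
  proof (cases "\<exists>b. a < b \<and> b \<le> c \<and> (b = idx_bar n a \<or> idx_bar n b \<notin> v)")
    case True
    then obtain b where b: "a < b" "b \<le> c" "b = idx_bar n a \<or> idx_bar n b \<notin> v" by auto
    have bv: "b \<notin> v" using gap b by auto
    have bN: "b \<le> 2*n+1" using b c1 by auto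
    define v' where "v' = insert b (v - {a})"
    have "admissible n k v'" unfolding admissible_def
    proof (intro conjI ballI)
      show "v' \<subseteq> {1..2*n+1}" using vN bN a1 b by (auto simp: v'_def)
      show "card v' = k" unfolding v'_def using card_exchange[of v a b] a bv vN by simp
      fix i assume i: "i \<in> v'"
      then have iN: "i \<le> 2*n+1" using vN bN by (auto simp: v'_def)
      show "idx_bar n i \<notin> v'"
      proof (cases "i = b")
        case True
        then show ?thesis using b idx_bar_bar[of a n] a1 idx_bar_neq[of b n] bN by (auto simp: v'_def)
      next
        case False
        then have iv: "i \<in> v" "i \<noteq> a" using i by (auto simp: v'_def)
        have "idx_bar n i \<noteq> b" using b iv idx_bar_bar[of i n] idx_bar_bar[of a n] iN a1 by auto
        then show ?thesis using vN(3)[OF iv(1)] by (auto simp: v'_def)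
      qed
    qed
    moreover have "v = reflect n a b ` v'"
    proof -
      have "reflect n a b ` (v - {a}) = id ` (v - {a})"
        by (rule image_cong) (use bv bara in \<open>auto simp: reflect_def\<close>)
      then show ?thesis using a by (auto simp: v'_def reflect_def)
    qed
    moreover have "bruhat_le v' w" unfolding bruhat_le_def v'_def
      using count_above_exchange[of v a b] a bv b strict le by (auto simp: bruhat_le_def Suc_le_eq)
    moreover have "\<Sum>v < \<Sum>v'" unfolding v'_def by (rule sum_exchange) (use a bv b in auto)
    moreover have "b \<in> v'" "a \<notin> v'" using b by (auto simp: v'_def)
    ultimately show thesis using that b a1 by blast
  next
    case False
    then have F: "b \<noteq> idx_bar n a" "idx_bar n b \<in> v" if "a < b" "b \<le> c" for b using that by auto
    \<comment> \<open>Above \<open>c\<close> the two sets agree, so bar \<open>c\<close>, being in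
      \<open>v\<close> but not in \<open>w\<close>, lies below \<open>c\<close>, and by the gap even
      below \<open>a\<close>. Then bar \<open>a\<close> lies below \<open>c\<close>; obstruction
      keeps it out of the gap, so bar \<open>a\<close> is below \<open>a\<close>.\<close>
    have cbar: "idx_bar n c \<in> v" "c \<noteq> idx_bar n a" using F a by auto
    have "\<not> idx_bar n c > c"
      using agree cbar wN(3)[OF cw(1)] by auto
    moreover have "idx_bar n c \<noteq> c" using c1 by (intro idx_bar_neq) auto
    ultimately have "idx_bar n c < c" by auto
    then have "idx_bar n c \<le> a" using gap cbar by (metis less_imp_le not_le)
    moreover have "idx_bar n c \<noteq> a" using cbar idx_bar_bar[of c n] c1 by auto
    ultimately have "idx_bar n c < a" by auto
    then have "idx_bar n a < c" using c1 a1 by (auto simp: idx_bar_def)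
    then have "idx_bar n a \<le> a" using F(1)[of "idx_bar n a"] by (metis less_imp_le not_le)
    moreover have "idx_bar n a \<noteq> a" using a1 by (intro idx_bar_neq) auto
    ultimately have baa: "idx_bar n a < a" by auto
    define a' where "a' = idx_bar n (a + 1)"
    have a': "a' \<in> v" unfolding a'_def by (rule F) (use a in auto)
    have a'b: "idx_bar n a = Suc a'" using a1 by (auto simp: a'_def idx_bar_def)
    have a1v: "a + 1 \<notin> v" using gap a by auto
    define u where "u = insert (a + 1) (v - {a})"
    define v' where "v' = insert (Suc a') (u - {a'})"
    have u: "finite u" "a' \<in> u" "Suc a' \<notin> u" using a' baa a'b bara by (auto simp: u_def)
    \<comment> \<open>By obstruction \<open>v\<close> contains the whole interval from bar
      \<open>c\<close> to \<open>a'\<close>. If the counts at \<open>a'\<close> were equal, the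
      bound just below bar \<open>c\<close> would force this interval into \<open>w\<close>, which
      already contains \<open>c\<close>.\<close>
    have cntw: "count_above v a' < count_above w a'"
    proof (rule ccontr)
      assume "\<not> ?thesis"
      then have eq: "count_above v a' = count_above w a'" using le by (auto simp: bruhat_le_def intro: le_antisym)
      define e where "e = idx_bar n c - 1"
      have c0: "idx_bar n c \<ge> 1" using c1 by (auto simp: idx_bar_def)
      have ea: "e \<le> a'" using a c1 by (auto simp: e_def a'_def idx_bar_def)
      have "{e<..a'} \<subseteq> v"
      proof
        fix x assume "x \<in> {e<..a'}"
        then have x: "idx_bar n c \<le> x" "x \<le> a'" unfolding e_def using c0 by auto
        have xb: "idx_bar n (idx_bar n x) = x" using x a1 by (intro idx_bar_bar) (auto simp: a'_def idx_bar_def)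
        have "a < idx_bar n x" "idx_bar n x \<le> c" using x a c1 a1 by (auto simp: a'_def idx_bar_def)
        from F(2)[OF this] show "x \<in> v" by (simp add: xb)
      qed
      then have "v \<inter> {e<..a'} = {e<..a'}" by auto
      then have "count_above v e = count_above v a' + card {e<..a'}" using count_above_split[of v e a'] ea by simp
      moreover have "count_above w e = count_above w a' + card (w \<inter> {e<..a'})" using count_above_split[of w e a'] ea by simp
      moreover have "count_above v e \<le> count_above w e" using le by (auto simp: bruhat_le_def)
      ultimately have "card {e<..a'} \<le> card (w \<inter> {e<..a'})" using eq by simp
      then have "w \<inter> {e<..a'} = {e<..a'}" by (intro card_seteq) auto
      moreover have "idx_bar n c \<in> {e<..a'}" using a c1 c0 unfolding e_def a'_def by (auto simp: idx_bar_def)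
      ultimately have "idx_bar n c \<in> w" by blast
      then show False using wN(3) cw by auto
    qed
    have ba1: "idx_bar n (Suc a') = a" using a1 idx_bar_bar[of a n] a'b by simp
    have "admissible n k v'" unfolding admissible_def
    proof (intro conjI ballI)
      show sub: "v' \<subseteq> {1..2*n+1}" using vN a1 a c1 baa a'b by (auto simp: v'_def u_def)
      have "card u = k" unfolding u_def using card_exchange[of v a "a + 1"] a a1v vN by simp
      then show "card v' = k" unfolding v'_def using card_exchange[OF u] by simp
      fix i assume i: "i \<in> v'"
      then have iN: "i \<le> 2*n+1" using sub by auto
      have "idx_bar n (a + 1) = a'" by (simp add: a'_def)
      moreover have "idx_bar n i \<noteq> Suc a'" if "i \<noteq> a"
        using that ba1 idx_bar_bar[of i n] iN by auto
      moreover have "idx_bar n i \<noteq> a + 1" if "i \<noteq> a'"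
        using that idx_bar_bar[of i n] iN by (auto simp: a'_def)
      ultimately show "idx_bar n i \<notin> v'"
        using i vN(3)[of i] ba1 baa a'b by (auto simp: v'_def u_def)
    qed
    moreover have "v = reflect n a (a + 1) ` v'"
    proof -
      have "reflect n a (a + 1) ` (v - {a, a'}) = id ` (v - {a, a'})"
        by (rule image_cong) (use a1v bara in \<open>auto simp: reflect_def\<close>)
      moreover have "v' = insert (Suc a') (insert (a + 1) (v - {a, a'}))"
        using baa a'b by (auto simp: v'_def u_def)
      moreover have "reflect n a (a + 1) (Suc a') = a'" "reflect n a (a + 1) (a + 1) = a"
        using baa a'b by (auto simp: reflect_def a'_def)
      ultimately show ?thesis using a a' by auto
    qed
    moreover have "bruhat_le v' w" unfolding bruhat_le_def
    proof
      fix i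
      have "count_above u i = count_above v i + (if i = a then 1 else 0)"
        unfolding u_def using count_above_exchange[of v a "a + 1" i] a a1v by auto
      moreover have "count_above v' i = count_above u i + (if i = a' then 1 else 0)"
        unfolding v'_def using count_above_exchange[OF u, of i] by auto
      ultimately show "count_above v' i \<le> count_above w i"
        using le strict[of a] a cntw baa a'b by (auto simp: bruhat_le_def Suc_le_eq)
    qed
    moreover have "\<Sum>v < \<Sum>v'"
      using sum_exchange[of v a "a + 1"] sum_exchange[OF u] a a1v unfolding u_def v'_def by auto
    moreover have "a + 1 \<in> v'" "a \<notin> v'" using baa a'b by (auto simp: v'_def u_def a'_def)
    ultimately show thesis using that[of v' a "a + 1"] a1 by auto
  qed
qed

section \<open>The index of the curve neighborhood\<close>

lemma largest_subset:
  fixes X :: "nat set"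
  assumes "finite X" "d \<le> card X"
  obtains D where "D \<subseteq> X" "card D = d" "\<And>x y. x \<in> X - D \<Longrightarrow> y \<in> D \<Longrightarrow> x < y"
proof -
  have "\<exists>D \<subseteq> X. card D = d \<and> (\<forall>x\<in>X - D. \<forall>y\<in>D. x < y)"
    using assms(2)
  proof (induction d)
    case 0
    then show ?case by (intro exI[of _ "{}"]) auto
  next
    case (Suc d)
    then obtain D where D: "D \<subseteq> X" "card D = d" "\<forall>x\<in>X - D. \<forall>y\<in>D. x < y" by auto
    have fD: "finite D" using D(1) assms(1) by (rule finite_subset)
    have fin: "finite (X - D)" using assms(1) by auto
    have "X - D \<noteq> {}" using D Suc.prems by auto
    then have M: "Max (X - D) \<in> X - D" using fin by (intro Max_in) auto
    have "x < Max (X - D)" if "x \<in> X - D" "x \<noteq> Max (X - D)" for x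
      using Max_ge[OF fin that(1)] that(2) by auto
    then show ?case using D M fD by (intro exI[of _ "insert (Max (X - D)) D"]) auto
  qed
  then show thesis using that by blast
qed

lemma smallest_subset:
  fixes X :: "nat set"
  assumes "finite X" "d \<le> card X"
  obtains C where "C \<subseteq> X" "card C = d" "\<And>x y. x \<in> C \<Longrightarrow> y \<in> X - C \<Longrightarrow> x < y"
proof -
  obtain D where D: "D \<subseteq> X" "card D = card X - d" "\<And>x y. x \<in> X - D \<Longrightarrow> y \<in> D \<Longrightarrow> x < y"
    using largest_subset[OF assms(1), of "card X - d"] by auto
  have "card (X - D) = d"
    using D assms by (simp add: card_Diff_subset finite_subset[OF D(1)])
  then show thesis using D by (intro that[of "X - D"]) auto
qed

text \<open>\<open>W \<union> D\<close> is the index of the curve neighborhood, and \<open>W \<union> bar D\<close> that of a cell in the Schubert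
  variety of \<open>w\<close> which the connecting curve starts from.\<close>

theorem neighbourhood_index:
  assumes w: "admissible n k w" and one: "1 \<notin> w" and dk: "d \<le> k"
  obtains W D where "W \<inter> D = {}" "card D = d" "D \<subseteq> {n+2..2*n+1}"
    "admissible n k (W \<union> D)" "admissible n k (W \<union> idx_bar n ` D)" "W \<inter> idx_bar n ` D = {}"
    "bruhat_le (W \<union> idx_bar n ` D) w"
    "\<And>v. finite v \<Longrightarrow> v \<subseteq> {1..2*n+1} \<Longrightarrow> card v = k \<Longrightarrow> (\<And>i. count_above v i \<le> count_above w i + d) \<Longrightarrow> bruhat_le v (W \<union> D)"
proof -
  have fin: "finite w" using w by (rule admissible_finite)
  have wN: "w \<subseteq> {1..2*n+1}" "card w = k" "\<And>i. i \<in> w \<Longrightarrow> idx_bar n i \<notin> w"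
    using w by (auto simp: admissible_def)
  have w2: "2 \<le> i" "i \<le> 2*n+1" if "i \<in> w" for i
    using wN(1) one that by (auto simp: subset_iff intro: Suc_leI le_neq_implies_less) (metis One_nat_def Suc_1 Suc_leI le_neq_implies_less one)
  have bb: "idx_bar n (idx_bar n i) = i" if "i \<le> 2*n+3" for i using that by (rule idx_bar_bar)
  obtain C where C: "C \<subseteq> w" "card C = d" "\<And>x y. x \<in> C \<Longrightarrow> y \<in> w - C \<Longrightarrow> x < y"
    using smallest_subset[OF fin, of d] dk wN by auto
  define W where "W = w - C"
  have finC: "finite C" "finite W" using C fin by (auto simp: W_def intro: finite_subset)
  have wCW: "w = W \<union> C" "W \<inter> C = {}" using C by (auto simp: W_def)
  have cW: "card W = k - d" unfolding W_def using C finC wN by (simp add: card_Diff_subset)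
  \<comment> \<open>Pairs {u, bar u} that avoid \<open>W\<close>, represented by their upper member.
    The range leaves out the pair of 1 and 2n+2.\<close>
  define U where "U = {u \<in> {n+2..2*n+1}. u \<notin> W \<and> idx_bar n u \<notin> W}"
  have finU: "finite U" by (auto simp: U_def)
  define up where "up c = max c (idx_bar n c)" for c
  \<comment> \<open>This is where \<open>1 \<notin> w\<close> enters: for \<open>c = 1\<close> the
    upper member would be 2n+2. The elements of \<open>C\<close> thus supply \<open>d\<close>
    different members of \<open>U\<close>.\<close>
  have upU: "up c \<in> U" if "c \<in> C" for c
  proof -
    have c: "c \<in> w" "c \<notin> W" using that C by (auto simp: W_def)
    have "idx_bar n c \<notin> W" using wN(3)[OF c(1)] by (auto simp: W_def)
    moreover have "idx_bar n (idx_bar n c) = c" using w2[OF c(1)] by (intro bb) auto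
    moreover have "up c \<in> {n+2..2*n+1}" using w2[OF c(1)] by (auto simp: up_def idx_bar_def)
    ultimately show ?thesis using c by (auto simp: U_def up_def max_def)
  qed
  have up_inj: "inj_on up C"
  proof (rule inj_onI)
    fix x y assume xy: "x \<in> C" "y \<in> C" "up x = up y"
    have m: "x \<in> w" "y \<in> w" using xy C by auto
    from xy(3) consider "x = y" | "idx_bar n x = y" | "x = idx_bar n y" | "idx_bar n x = idx_bar n y"
      by (auto simp: up_def max_def split: if_splits)
    then show "x = y"
    proof cases
      case 4
      then show ?thesis using w2[OF m(1)] w2[OF m(2)] by (auto simp: idx_bar_def)
    qed (use m wN(3) in auto)
  qed
  have dU: "d \<le> card U"
    using card_inj_on_le[OF up_inj _ finU] upU C(2) by auto
  obtain D where D: "D \<subseteq> U" "card D = d" "\<And>x y. x \<in> U - D \<Longrightarrow> y \<in> D \<Longrightarrow> x < y"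
    using largest_subset[OF finU dU] by auto
  have finD: "finite D" using D(1) finU by (rule finite_subset)
  have DN: "n + 2 \<le> u" "u \<le> 2*n+1" "u \<notin> W" "idx_bar n u \<notin> W" if "u \<in> D" for u
    using that D(1) by (auto simp: U_def)
  have WN: "2 \<le> u" "u \<le> 2*n+1" "idx_bar n u \<notin> W" if "u \<in> W" for u
    using that w2[of u] wN(3)[of u] by (auto simp: W_def)
  define L where "L = idx_bar n ` D"
  have LE: "2 \<le> u" "u \<le> n + 1" "u \<notin> W" "idx_bar n u \<notin> W" "idx_bar n u \<in> D" if "u \<in> L" for u
  proof -
    obtain x where x: "x \<in> D" "u = idx_bar n x" using \<open>u \<in> L\<close> by (auto simp: L_def)
    have "idx_bar n u = x" using DN(2)[OF x(1)] bb[of x] x by simp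
    then show "2 \<le> u" "u \<le> n + 1" "u \<notin> W" "idx_bar n u \<notin> W" "idx_bar n u \<in> D"
      using DN[OF x(1)] x by (auto simp: idx_bar_def)
  qed
  have inj_bar: "inj_on (idx_bar n) {..2*n+3}" by (auto simp: inj_on_def idx_bar_def)
  have cL: "card L = d" unfolding L_def
  proof (subst card_image)
    show "inj_on (idx_bar n) D" by (rule inj_on_subset[OF inj_bar]) (use DN(2) in force)
  qed (rule D(2))
  have "D \<subseteq> {n+2..2*n+1}" using DN by auto
  moreover have WD: "W \<inter> D = {}" using DN by auto
  moreover have adm: "admissible n k (W \<union> D)" unfolding admissible_def
  proof (intro conjI ballI)
    show "W \<union> D \<subseteq> {1..2*n+1}" using WN DN by force
    show "card (W \<union> D) = k" using card_Un_disjoint[OF finC(2) finD WD] cW D(2) dk by simp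
    fix i assume i: "i \<in> W \<union> D"
    then consider "i \<in> W" | "i \<in> D" by auto
    then show "idx_bar n i \<notin> W \<union> D"
    proof cases
      case 1
      then have "idx_bar n i \<notin> D" using DN(4)[of "idx_bar n i"] WN[of i] bb[of i] by auto
      then show ?thesis using WN 1 by auto
    next
      case 2
      then have "idx_bar n i \<notin> D" using DN(1)[of "idx_bar n i"] DN(1)[of i] by (auto simp: idx_bar_def)
      then show ?thesis using DN 2 by auto
    qed
  qed
  moreover have WL: "W \<inter> L = {}" using LE by auto
  moreover have finL: "finite L" using finD by (simp add: L_def)
  moreover have "admissible n k (W \<union> L)" unfolding admissible_def
  proof (intro conjI ballI)
    show "W \<union> L \<subseteq> {1..2*n+1}" using WN LE by force
    show "card (W \<union> L) = k" using card_Un_disjoint[OF finC(2) finL WL] cW cL dk by simp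
    fix i assume i: "i \<in> W \<union> L"
    then consider "i \<in> W" | "i \<in> L" by auto
    then show "idx_bar n i \<notin> W \<union> L"
    proof cases
      case 1
      then have "idx_bar n i \<notin> L" using LE(4)[of "idx_bar n i"] WN[of i] bb[of i] by auto
      then show ?thesis using WN 1 by auto
    next
      case 2
      then have "idx_bar n i \<notin> L" using LE(2)[of "idx_bar n i"] LE(2)[of i] by (auto simp: idx_bar_def)
      then show ?thesis using LE 2 by auto
    qed
  qed
  moreover have "bruhat_le (W \<union> L) w" unfolding bruhat_le_def
  proof
    fix i
    \<comment> \<open>Otherwise fewer elements of \<open>L\<close> than of \<open>C\<close> are at
      most \<open>i\<close>, so some \<open>c \<le> i\<close> in \<open>C\<close> belongs to a pair
      whose lower member is not in \<open>L\<close>. As \<open>D\<close> holds the largest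
      candidates, all of \<open>L\<close> lies below that lower member, and nothing of
      \<open>L\<close> is above \<open>i\<close>.\<close>
    have "count_above L i \<le> count_above C i"
    proof (rule ccontr)
      assume "\<not> ?thesis"
      then have less: "card (C \<inter> {i<..}) < card (L \<inter> {i<..})" by (simp add: count_above_def)
      have split: "card (X \<inter> {..i}) + card (X \<inter> {i<..}) = card X" if "finite X" for X :: "nat set"
      proof -
        have "X = (X \<inter> {..i}) \<union> (X \<inter> {i<..})" by auto
        then show ?thesis using card_Un_disjoint[of "X \<inter> {..i}" "X \<inter> {i<..}"] that by force
      qed
      have less': "card (L \<inter> {..i}) < card (C \<inter> {..i})"
        using split[OF finL] split[OF finC(1)] less cL C(2) by linarith
      have low_inj: "inj_on (\<lambda>c. idx_bar n (up c)) (C \<inter> {..i})"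
      proof (rule inj_onI)
        fix x y assume xy: "x \<in> C \<inter> {..i}" "y \<in> C \<inter> {..i}" "idx_bar n (up x) = idx_bar n (up y)"
        then have "up x \<in> U" "up y \<in> U" using upU by auto
        then have "up x \<le> 2*n+3" "up y \<le> 2*n+3" by (auto simp: U_def)
        then have "up x = up y" using xy(3) bb by metis
        then show "x = y" using up_inj xy by (auto simp: inj_on_def)
      qed
      have "\<not> (\<lambda>c. idx_bar n (up c)) ` (C \<inter> {..i}) \<subseteq> L \<inter> {..i}"
        using card_image[OF low_inj] less' card_mono[of "L \<inter> {..i}" "(\<lambda>c. idx_bar n (up c)) ` (C \<inter> {..i})"] finL
        by auto
      then obtain c where c: "c \<in> C" "c \<le> i" "idx_bar n (up c) \<notin> L \<inter> {..i}" by auto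
      have cw: "c \<in> w" using c C by auto
      have "idx_bar n (up c) \<le> i" using c(2) w2[OF cw] by (auto simp: up_def idx_bar_def max_def)
      then have nL: "idx_bar n (up c) \<notin> L" using c by auto
      then have "up c \<in> U - D" using upU[OF c(1)] by (auto simp: L_def)
      then have "up c < u" if "u \<in> D" for u using D(3) that by auto
      then have "u \<le> i" if "u \<in> L" for u
        using that \<open>idx_bar n (up c) \<le> i\<close> unfolding L_def
        by (auto simp: idx_bar_def) (meson diff_le_mono2 le_trans less_imp_le)
      then have "L \<inter> {i<..} = {}" by fastforce
      then show False using less by simp
    qed
    then show "count_above (W \<union> L) i \<le> count_above w i"
      unfolding wCW(1) count_above_Un_disjoint[OF finC(2) finL WL] count_above_Un_disjoint[OF finC(2) finC(1) wCW(2)] by simp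
  qed
  moreover have "bruhat_le v (W \<union> D)"
    if v: "finite v" "v \<subseteq> {1..2*n+1}" "card v = k" "\<And>i. count_above v i \<le> count_above w i + d" for v
    unfolding bruhat_le_def
  proof
    fix i
    \<comment> \<open>Discarding the smallest elements of \<open>w\<close> costs nothing: either
      none of them is above \<open>i\<close>, or all of \<open>W\<close> is, and then the right side
      equals \<open>k\<close>.\<close>
    have 1: "count_above v i \<le> count_above W i + d"
    proof (cases "C \<inter> {i<..} = {}")
      case True
      then have "count_above C i = 0" by (simp add: count_above_def)
      then show ?thesis using v(4)[of i] unfolding wCW(1) count_above_Un_disjoint[OF finC(2) finC(1) wCW(2)] by simp
    next
      case False
      then have "W \<inter> {i<..} = W" using C(3) unfolding W_def by fastforce
      then show ?thesis using count_above_le_card[OF v(1), of i] v(3) cW dk by (simp add: count_above_def)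
    qed
    show "count_above v i \<le> count_above (W \<union> D) i"
    proof (cases "D \<subseteq> {i<..}")
      case True
      then have "count_above D i = d" using D(2) by (simp add: count_above_def Int_absorb2)
      then show ?thesis using 1 unfolding count_above_Un_disjoint[OF finC(2) finD WD] by simp
    next
      case False
      then obtain y where y: "y \<in> D" "y \<le> i" by fastforce
      \<comment> \<open>If \<open>j\<close> is missing although some \<open>y \<le> i\<close> was
        chosen, then bar \<open>j\<close> must be in \<open>W\<close>, as otherwise \<open>j\<close>
        would have been preferred to \<open>y\<close>. Every \<open>c\<close> in \<open>C\<close> is
        below bar \<open>j\<close>, so \<open>up c\<close> exceeds \<open>j\<close> and was chosen
        as well; these \<open>d\<close> elements and \<open>y\<close> are too many for
        \<open>D\<close>.\<close>
      have "j \<in> W \<union> D" if j: "i < j" "j \<le> 2*n+1" for j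
      proof (rule ccontr)
        assume nj: "j \<notin> W \<union> D"
        have jn: "n + 2 < j" using y j DN(1)[OF y(1)] by auto
        have bW: "idx_bar n j \<in> W"
        proof (rule ccontr)
          assume "idx_bar n j \<notin> W"
          then have "j \<in> U - D" using nj jn j by (auto simp: U_def)
          then show False using D(3) y j by fastforce
        qed
        have big: "up c > j" if "c \<in> C" for c
        proof -
          have "c < idx_bar n j" using C(3)[OF that] bW by (auto simp: W_def)
          moreover have "c \<in> w" using C that by auto
          ultimately show ?thesis using w2[of c] by (auto simp: up_def idx_bar_def)
        qed
        have "up c \<in> D" if "c \<in> C" for c
        proof (rule ccontr)
          assume "up c \<notin> D"
          then have "up c < y" using D(3)[of "up c" y] upU[OF that] y by auto
          then show False using big[OF that] y j by auto
        qed
        moreover have "y \<notin> up ` C" using big y j by force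
        ultimately have "up ` C \<subseteq> D - {y}" by auto
        then have "card (up ` C) \<le> card (D - {y})" using finD by (intro card_mono) auto
        then show False using card_image[OF up_inj] C(2) D(2) y finD card_Diff1_less[OF finD y(1)] by linarith
      qed
      then have "v \<inter> {i<..} \<subseteq> (W \<union> D) \<inter> {i<..}" using v(2) by fastforce
      then show ?thesis unfolding count_above_def using finC finD by (intro card_mono) auto
    qed
  qed
  ultimately show thesis using that D(2) unfolding L_def by metis
qed

subsection \<open>The form and Siegel transformations\<close>

interpretation cvp: vector_space_pair cscale cscale
  by unfold_locales

lemma cscale_apply [simp]: "cscale c v i = c * v i"
  by (simp add: cscale_def)

lemma plus_apply [simp]: "(x + y) i = x i + y (i :: nat)" for x y :: "nat \<Rightarrow> complex"
  by (simp add: plus_fun_def)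

lemma zero_apply [simp]: "(0 :: nat \<Rightarrow> complex) i = 0"
  by (simp add: zero_fun_def)

lemma sum_apply: "(\<Sum>a\<in>S. f a) i = (\<Sum>a\<in>S. f a (i :: nat))" for f :: "'a \<Rightarrow> nat \<Rightarrow> complex"
  by (induction S rule: infinite_finite_induct) auto

lemma expand_basis:
  assumes "finite R" "\<And>i. i \<notin> R \<Longrightarrow> x i = 0"
  shows "x = (\<Sum>i\<in>R. cscale (x i) (basis_vec i))"
proof
  fix j
  have "(\<Sum>i\<in>R. x i * (if j = i then 1 else 0)) = (if j \<in> R then x j else 0)"
    using assms(1) by (simp add: if_distrib[of "\<lambda>y. _ * y"] cong: if_cong)
  then show "x j = (\<Sum>i\<in>R. cscale (x i) (basis_vec i)) j"
    using assms(2) by (simp add: sum_apply basis_vec_def)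
qed

lemma subspace_support: "cvs.subspace {x. \<forall>i. i \<notin> R \<longrightarrow> x i = 0}"
  by (auto simp: cvs.subspace_def)

lemma span_basis_iff:
  assumes "finite R"
  shows "x \<in> cvs.span (basis_vec ` R) \<longleftrightarrow> (\<forall>i. i \<notin> R \<longrightarrow> x i = 0)"
proof
  have "cvs.span (basis_vec ` R) \<subseteq> {x. \<forall>i. i \<notin> R \<longrightarrow> x i = 0}"
    by (rule cvs.span_minimal) (auto simp: subspace_support basis_vec_def)
  then show "x \<in> cvs.span (basis_vec ` R) \<Longrightarrow> \<forall>i. i \<notin> R \<longrightarrow> x i = 0" by auto
next
  assume x: "\<forall>i. i \<notin> R \<longrightarrow> x i = 0"
  have "x = (\<Sum>i\<in>R. cscale (x i) (basis_vec i))"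
    using x by (intro expand_basis[OF assms]) auto
  also have "\<dots> \<in> cvs.span (basis_vec ` R)"
    by (intro cvs.span_sum cvs.span_scale cvs.span_base) auto
  finally show "x \<in> cvs.span (basis_vec ` R)" .
qed

lemma E_iff: "x \<in> E n \<longleftrightarrow> (\<forall>i. i \<notin> {1..2*n+1} \<longrightarrow> x i = 0)"
  unfolding E_def by (rule span_basis_iff) simp

lemma E_D: "x \<in> E n \<Longrightarrow> x i \<noteq> 0 \<Longrightarrow> 1 \<le> i \<and> i \<le> 2*n+1"
  by (auto simp: E_iff)

lemma subspace_E: "cvs.subspace (E n)"
  by (simp add: E_def)

lemma basis_vec_E: "1 \<le> i \<Longrightarrow> i \<le> 2*n+1 \<Longrightarrow> basis_vec i \<in> E n"
  by (auto simp: E_iff basis_vec_def)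

lemma basis_vec_same [simp]: "basis_vec i i = 1"
  by (simp add: basis_vec_def)

lemma omega_add_left: "omega n (x + y) z = omega n x z + omega n y z"
  by (simp add: omega_def sum.distrib[symmetric] algebra_simps)

lemma omega_add_right: "omega n z (x + y) = omega n z x + omega n z y"
  by (simp add: omega_def sum.distrib[symmetric] algebra_simps)

lemma omega_scale_left: "omega n (cscale c x) y = c * omega n x y"
  by (simp add: omega_def sum_distrib_left algebra_simps)

lemma omega_scale_right: "omega n x (cscale c y) = c * omega n x y"
  by (simp add: omega_def sum_distrib_left algebra_simps)

lemma omega_skew: "omega n y x = - omega n x y"
  unfolding omega_def sum_negf[symmetric] by (intro sum.cong) (auto simp: algebra_simps)

lemma omega_self: "omega n x x = 0"
  by (simp add: omega_def)

lemmas omega_bilinear = omega_add_left omega_add_right omega_scale_left omega_scale_right omega_self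

text \<open>The value of the form on e_i and its bar partner; skewness puts the sign -1 in the upper
  half.\<close>

definition bar_sign :: "nat \<Rightarrow> nat \<Rightarrow> complex" where
  "bar_sign n i = (if i \<le> n + 1 then 1 else -1)"

lemma bar_sign_sq [simp]: "bar_sign n i * bar_sign n i = 1" "bar_sign n i * (bar_sign n i * z) = z"
  by (auto simp: bar_sign_def)

lemma bar_sign_neq_0 [simp]: "bar_sign n i \<noteq> 0"
  by (auto simp: bar_sign_def)

lemma omega_basis_left:
  assumes "1 \<le> i" "i \<le> 2*n+2"
  shows "omega n (basis_vec i) y = bar_sign n i * y (idx_bar n i)"
proof (cases "i \<le> n + 1")
  case True
  have "omega n (basis_vec i) y = (\<Sum>j=1..n+1. if j = i then y (idx_bar n j) else 0)"
    unfolding omega_def by (rule sum.cong) (use True in \<open>auto simp: basis_vec_def idx_bar_def\<close>)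
  then show ?thesis using True assms by (simp add: bar_sign_def)
next
  case False
  have "omega n (basis_vec i) y = (\<Sum>j=1..n+1. if j = idx_bar n i then - y j else 0)"
    unfolding omega_def by (rule sum.cong) (use False assms in \<open>auto simp: basis_vec_def idx_bar_def\<close>)
  also have "\<dots> = - y (idx_bar n i)"
    using False assms by (subst sum.delta) (auto simp: idx_bar_def)
  finally show ?thesis using False by (simp add: bar_sign_def)
qed

lemma bar_sign_bar: "1 \<le> i \<Longrightarrow> i \<le> 2*n+2 \<Longrightarrow> bar_sign n (idx_bar n i) = - bar_sign n i"
  by (auto simp: bar_sign_def idx_bar_def)

lemma omega_basis_bar:
  assumes "1 \<le> i" "i \<le> 2*n+2"
  shows "omega n x (basis_vec (idx_bar n i)) = bar_sign n i * x i"
proof -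
  have "1 \<le> idx_bar n i" "idx_bar n i \<le> 2*n+2" using assms by (auto simp: idx_bar_def)
  from omega_basis_left[OF this] show ?thesis
    using assms by (subst omega_skew) (simp add: bar_sign_bar idx_bar_bar)
qed

lemma omega_nonzeroD:
  assumes "omega n x y \<noteq> 0"
  obtains i where "1 \<le> i" "i \<le> 2*n+2" "x i \<noteq> 0" "y (idx_bar n i) \<noteq> 0"
proof -
  obtain j where j: "1 \<le> j" "j \<le> n+1" "x j * y (idx_bar n j) - x (idx_bar n j) * y j \<noteq> 0"
    using assms unfolding omega_def by (metis (no_types, lifting) atLeastAtMost_iff sum.neutral)
  then consider "x j \<noteq> 0" "y (idx_bar n j) \<noteq> 0" | "x (idx_bar n j) \<noteq> 0" "y j \<noteq> 0"
    by fastforce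
  then show thesis
  proof cases
    case 1
    then show ?thesis using that[of j] j by auto
  next
    case 2
    moreover have "idx_bar n (idx_bar n j) = j" "1 \<le> idx_bar n j" "idx_bar n j \<le> 2*n+2"
      using j by (auto simp: idx_bar_def)
    ultimately show ?thesis using that[of "idx_bar n j"] by auto
  qed
qed

section \<open>Siegel transformations\<close>

definition below :: "nat \<Rightarrow> (nat \<Rightarrow> complex) \<Rightarrow> bool" where
  "below p c \<longleftrightarrow> (\<forall>i. c i \<noteq> 0 \<longrightarrow> 1 \<le> i \<and> i < p)"

text \<open>This is \<open>exp N\<close> for \<open>N x = \<omega>(x, c) e\<^bsub>bar p\<^esub> + \<omega>(x, e\<^bsub>bar p\<^esub>) c\<close>, because \<open>N\<close> squares to 0 when
  \<open>c\<close> lies below \<open>p\<close>.\<close>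

definition siegel :: "nat \<Rightarrow> nat \<Rightarrow> (nat \<Rightarrow> complex) \<Rightarrow> (nat \<Rightarrow> complex) \<Rightarrow> (nat \<Rightarrow> complex)" where
  "siegel n p c x = x + cscale (omega n x c) (basis_vec (idx_bar n p))
                      + cscale (omega n x (basis_vec (idx_bar n p))) c"

lemma below_scale: "below p c \<Longrightarrow> below p (cscale s c)"
  by (auto simp: below_def)

context
  fixes n p :: nat and c :: "nat \<Rightarrow> complex"
  assumes p: "1 \<le> p" "p \<le> 2*n+1" and c: "below p c"
begin

text \<open>The two directions added by a Siegel transformation span an isotropic space. Invariance
  of the form and the one-parameter group law both rest on this.\<close>

lemma omega_below: "omega n c (basis_vec (idx_bar n p)) = 0" "omega n (basis_vec (idx_bar n p)) c = 0"
proof -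
  show "omega n c (basis_vec (idx_bar n p)) = 0"
    using c p by (subst omega_basis_bar) (auto simp: below_def)
  then show "omega n (basis_vec (idx_bar n p)) c = 0" by (subst omega_skew) simp
qed

lemma siegel_omega: "omega n (siegel n p c x) (siegel n p c y) = omega n x y"
  unfolding siegel_def omega_bilinear omega_below
  by (simp add: omega_skew[of n _ "basis_vec (idx_bar n p)"] omega_skew[of n c] algebra_simps)

lemma siegel_siegel: "siegel n p (cscale s c) (siegel n p (cscale t c) x) = siegel n p (cscale (s + t) c) x"
  unfolding siegel_def omega_bilinear omega_below
  by (auto simp: fun_eq_iff algebra_simps)

text \<open>Unitriangularity. A nonzero pairing of \<open>x\<close> with \<open>c\<close> needs an
  index of \<open>x\<close> above bar \<open>p\<close>, and a nonzero pairing with the partner of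
  e_p needs the index \<open>p\<close>, above all of \<open>c\<close>; so both added terms stay
  strictly below \<open>j\<close>.\<close>

lemma siegel_lead:
  assumes "x \<in> E n" "\<forall>i>j. x i = 0" "j \<le> i"
  shows "siegel n p c x i = x i"
proof -
  have "omega n x c * basis_vec (idx_bar n p) i = 0"
  proof (cases "omega n x c = 0")
    case False
    then obtain l where l: "x l \<noteq> 0" "c (idx_bar n l) \<noteq> 0" by (rule omega_nonzeroD)
    then have "l \<le> j" using assms(2) by (metis not_le)
    moreover have "l \<le> 2*n+1" using E_D[OF assms(1) l(1)] by auto
    moreover have "idx_bar n l < p" using l(2) c by (auto simp: below_def)
    ultimately have "i \<noteq> idx_bar n p" using p assms(3) by (auto simp: idx_bar_def)
    then show ?thesis by (simp add: basis_vec_def)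
  qed auto
  moreover have "omega n x (basis_vec (idx_bar n p)) * c i = 0"
  proof (rule ccontr)
    assume "\<not> ?thesis"
    then have "x p \<noteq> 0" "c i \<noteq> 0" using p by (auto simp: omega_basis_bar)
    then have "p \<le> j" "i < p" using assms(2) c by (auto simp: below_def not_le[symmetric])
    with assms(3) show False by simp
  qed
  ultimately show ?thesis unfolding siegel_def plus_apply cscale_apply by auto
qed

lemma siegel_E:
  assumes "x \<in> E n"
  shows "siegel n p c x \<in> E n"
  unfolding E_iff
proof (intro allI impI)
  fix i assume i: "i \<notin> {1..2*n+1}"
  show "siegel n p c x i = 0"
  proof (cases "i = 0")
    case False
    with i have "siegel n p c x i = x i" by (intro siegel_lead[OF assms, of "2*n+1"]) (use assms in \<open>auto simp: E_iff\<close>)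
    then show ?thesis using i assms by (auto simp: E_iff)
  next
    case True
    then show ?thesis using assms c p
      by (auto simp: siegel_def E_iff below_def basis_vec_def idx_bar_def)
  qed
qed

lemma siegel_linear: "Vector_Spaces.linear cscale cscale (siegel n p c)"
  unfolding Vector_Spaces.linear_iff
  by (intro conjI cvs.vector_space_axioms) (auto simp: siegel_def omega_bilinear fun_eq_iff algebra_simps)

end

lemma siegel_zero: "siegel n p (cscale 0 c) x = x"
proof -
  have "omega n x (cscale 0 c) = 0" unfolding omega_scale_right by simp
  then show ?thesis by (auto simp: siegel_def fun_eq_iff)
qed

text \<open>The elimination step. The last clause protects basis vectors already split off:
  \<open>y (idx_bar n r) = 0\<close> says that e_r is orthogonal to \<open>y\<close>.\<close>

lemma siegel_transitive:
  assumes p: "1 \<le> p" "p \<le> 2*n+1" and y: "y p = 1" "\<And>i. y i \<noteq> 0 \<Longrightarrow> 1 \<le> i \<and> i \<le> p"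
  obtains c where "below p c" "siegel n p c (basis_vec p) = y"
    "\<And>r. 1 \<le> r \<Longrightarrow> r \<le> 2*n+1 \<Longrightarrow> r \<noteq> p \<Longrightarrow> y (idx_bar n r) = 0 \<Longrightarrow> siegel n p c (basis_vec r) = basis_vec r"
proof -
  define q where "q = idx_bar n p"
  \<comment> \<open>The value of the form on e_p and e_q, which the factor \<open>e\<close> in
    \<open>c\<close> cancels.\<close>
  define e where "e = bar_sign n p"
  have e: "e * e = 1" "e * (e * z) = z" for z by (auto simp: e_def)
  have qp: "q \<noteq> p" unfolding q_def using p by (intro idx_bar_neq) auto
  \<comment> \<open>The component along \<open>e\<^sub>q\<close> enters the image of \<open>e\<^sub>p\<close> twice.\<close>
  define c where "c i = e * (if i = p then 0 else if i = q then y i / 2 else y i)" for i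
  have "below p c" unfolding below_def c_def using y(2) by (auto simp: le_less)
  moreover have "siegel n p c (basis_vec p) = y"
  proof -
    have 1: "omega n (basis_vec p) c = e * c q" using p by (simp add: omega_basis_left e_def q_def)
    have 2: "omega n (basis_vec p) (basis_vec q) = e" using p unfolding q_def by (simp add: omega_basis_bar e_def)
    show ?thesis unfolding siegel_def q_def[symmetric] 1 2
      using qp e y(1) by (auto simp: fun_eq_iff basis_vec_def c_def)
  qed
  moreover have "siegel n p c (basis_vec r) = basis_vec r"
    if r: "1 \<le> r" "r \<le> 2*n+1" "r \<noteq> p" "y (idx_bar n r) = 0" for r
  proof -
    have "c (idx_bar n r) = 0" using r(4) by (auto simp: c_def)
    then have "omega n (basis_vec r) c = 0" using r by (simp add: omega_basis_left)
    moreover have "omega n (basis_vec r) (basis_vec (idx_bar n p)) = 0"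
      using omega_basis_bar[of p n] p r by (simp add: basis_vec_def[of r])
    ultimately show ?thesis by (auto simp: siegel_def fun_eq_iff)
  qed
  ultimately show thesis using that by blast
qed

section \<open>Words in Siegel transformations and elimination\<close>

text \<open>The torus fixes every coordinate subspace, so these words reach the same subspaces from
  it as the Borel group; \<open>borel_orbit\<close> makes this precise.\<close>

inductive_set unipotent :: "nat \<Rightarrow> ((nat \<Rightarrow> complex) \<Rightarrow> (nat \<Rightarrow> complex)) set" for n where
  unipotent_id: "(\<lambda>x. x) \<in> unipotent n"
| unipotent_siegel: "g \<in> unipotent n \<Longrightarrow> 1 \<le> p \<Longrightarrow> p \<le> 2*n+1 \<Longrightarrow> below p c \<Longrightarrow> (\<lambda>x. siegel n p c (g x)) \<in> unipotent n"

lemma unipotent_linear: "g \<in> unipotent n \<Longrightarrow> Vector_Spaces.linear cscale cscale g"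
proof (induction rule: unipotent.induct)
  case unipotent_id
  show ?case unfolding Vector_Spaces.linear_iff by (intro conjI cvs.vector_space_axioms) auto
next
  case (unipotent_siegel g p c)
  then show ?case using Vector_Spaces.linear_compose[OF unipotent_siegel.IH siegel_linear[of p n c]]
    unfolding o_def by blast
qed

lemma unipotent_omega: "g \<in> unipotent n \<Longrightarrow> omega n (g x) (g y) = omega n x y"
  by (induction rule: unipotent.induct) (auto simp: siegel_omega)

lemma unipotent_E: "g \<in> unipotent n \<Longrightarrow> x \<in> E n \<Longrightarrow> g x \<in> E n"
  by (induction rule: unipotent.induct) (auto simp: siegel_E)

lemma unipotent_lead:
  "g \<in> unipotent n \<Longrightarrow> x \<in> E n \<Longrightarrow> \<forall>i>j. x i = 0 \<Longrightarrow> j \<le> i \<Longrightarrow> g x i = x i"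
proof (induction arbitrary: i rule: unipotent.induct)
  case (unipotent_siegel g p c)
  have "siegel n p c (g x) i = g x i"
    by (rule siegel_lead[of p n c "g x" j]) (use unipotent_siegel in \<open>auto simp: unipotent_E\<close>)
  then show ?case using unipotent_siegel by auto
qed auto

lemma unipotent_comp: "g \<in> unipotent n \<Longrightarrow> h \<in> unipotent n \<Longrightarrow> (\<lambda>x. g (h x)) \<in> unipotent n"
  by (induction rule: unipotent.induct) (auto intro: unipotent.intros)

lemma siegel_unipotent: "1 \<le> p \<Longrightarrow> p \<le> 2*n+1 \<Longrightarrow> below p c \<Longrightarrow> siegel n p c \<in> unipotent n"
  using unipotent_siegel[OF unipotent_id] by simp

lemma unipotent_inverse: "g \<in> unipotent n \<Longrightarrow> \<exists>h\<in>unipotent n. (\<forall>x. h (g x) = x) \<and> (\<forall>x. g (h x) = x)"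
proof (induction rule: unipotent.induct)
  case unipotent_id
  show ?case by (intro bexI[OF _ unipotent.unipotent_id]) simp
next
  case (unipotent_siegel g p c)
  obtain h where h: "h \<in> unipotent n" "\<And>x. h (g x) = x" "\<And>x. g (h x) = x"
    using unipotent_siegel.IH by blast
  have s: "siegel n p (cscale (-1) c) \<in> unipotent n" 
    by (intro siegel_unipotent below_scale unipotent_siegel.hyps)
  have "siegel n p (cscale (-1) c) (siegel n p c x) = x" for x
    using siegel_siegel[OF unipotent_siegel.hyps(2-4), of "-1" 1 x] unfolding cvs.scale_one add.left_inverse siegel_zero .
  moreover have "siegel n p c (siegel n p (cscale (-1) c) x) = x" for x
    using siegel_siegel[OF unipotent_siegel.hyps(2-4), of 1 "-1" x] unfolding cvs.scale_one add.right_inverse siegel_zero .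
  ultimately show ?case
    by (intro bexI[OF _ unipotent_comp[OF h(1) s]]) (simp only: h simp_thms)
qed

lemma unipotent_inj: "g \<in> unipotent n \<Longrightarrow> inj g"
  using unipotent_inverse by (metis injI)

text \<open>Gaussian elimination with a growing set \<open>R\<close> of basis vectors in
  \<open>V\<close>. A vector of \<open>V\<close> outside their span, cleared of its coordinates in
  \<open>R\<close>, has its leading index outside \<open>R\<close>, and undoing a Siegel
  transformation turns it into a basis vector. Isotropy of \<open>V\<close> keeps the basis vectors
  of \<open>R\<close> fixed.\<close>

theorem bruhat_decomposition:
  assumes "cvs.subspace V" "V \<subseteq> E n" "\<And>x y. x \<in> V \<Longrightarrow> y \<in> V \<Longrightarrow> omega n x y = 0"
  obtains g R where "g \<in> unipotent n" "R \<subseteq> {1..2*n+1}" "V = g ` cvs.span (basis_vec ` R)"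
proof -
  have "\<exists>g\<in>unipotent n. \<exists>R'\<subseteq>{1..2*n+1}. V = g ` cvs.span (basis_vec ` R')"
    if "R \<subseteq> {1..2*n+1}" "basis_vec ` R \<subseteq> V" for R
    using that assms
  proof (induction "card ({1..2*n+1} - R)" arbitrary: R V rule: less_induct)
    case less
    have sV: "cvs.subspace V" and VE: "V \<subseteq> E n"
      and iso: "\<And>x y. x \<in> V \<Longrightarrow> y \<in> V \<Longrightarrow> omega n x y = 0" by fact+
    have finR: "finite R" using less.prems(1) by (rule finite_subset) simp
    show ?case
    proof (cases "V = cvs.span (basis_vec ` R)")
      case True
      then show ?thesis using less.prems(1) by (intro bexI[OF _ unipotent_id] exI[of _ R]) auto
    next
      case False
      have "cvs.span (basis_vec ` R) \<subseteq> V" using less.prems(2) sV by (rule cvs.span_minimal)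
      with False obtain x where x: "x \<in> V" "x \<notin> cvs.span (basis_vec ` R)" by auto
      define z where "z = (\<lambda>i. if i \<in> R then 0 else x i)"
      have "x - z = (\<Sum>r\<in>R. cscale ((x - z) r) (basis_vec r))"
        by (rule expand_basis[OF finR]) (simp add: z_def)
      also have "\<dots> = (\<Sum>r\<in>R. cscale (x r) (basis_vec r))"
        by (rule sum.cong) (auto simp: z_def)
      finally have "z = x - (\<Sum>r\<in>R. cscale (x r) (basis_vec r))" by (simp add: algebra_simps)
      also have "\<dots> \<in> V"
        using sV x(1) less.prems(2) by (intro cvs.subspace_diff cvs.subspace_sum cvs.subspace_scale) auto
      finally have zV: "z \<in> V" .
      have "\<exists>i. z i \<noteq> 0" using x(2) unfolding span_basis_iff[OF finR] by (auto simp: z_def)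
      moreover have supp: "{i. z i \<noteq> 0} \<subseteq> {1..2*n+1}" using zV VE E_D by fastforce
      then have fs: "finite {i. z i \<noteq> 0}" by (rule finite_subset) simp
      define p where "p = Max {i. z i \<noteq> 0}"
      ultimately have zp: "z p \<noteq> 0" using Max_in[OF fs] by auto
      have le_p: "i \<le> p" if "z i \<noteq> 0" for i unfolding p_def using fs that by (intro Max_ge) auto
      have p: "1 \<le> p" "p \<le> 2*n+1" "p \<notin> R" using zp supp by (auto simp: z_def split: if_splits)
      define y where "y = cscale (inverse (z p)) z"
      have yV: "y \<in> V" unfolding y_def using sV zV by (rule cvs.subspace_scale)
      have yp: "y p = 1" using zp by (simp add: y_def)
      have ysupp: "1 \<le> i \<and> i \<le> p" if "y i \<noteq> 0" for i using that le_p supp by (auto simp: y_def)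
      have ybar: "y (idx_bar n r) = 0" if "r \<in> R" for r
        using iso[of "basis_vec r" y] less.prems that yV by (subst (asm) omega_basis_left) auto
      obtain c where c: "below p c" "siegel n p c (basis_vec p) = y"
        "\<And>r. 1 \<le> r \<Longrightarrow> r \<le> 2*n+1 \<Longrightarrow> r \<noteq> p \<Longrightarrow> y (idx_bar n r) = 0 \<Longrightarrow> siegel n p c (basis_vec r) = basis_vec r"
        using siegel_transitive[where y=y, OF p(1,2) yp ysupp] by metis
      define T where "T = siegel n p c"
      have T: "T \<in> unipotent n" unfolding T_def using p c(1) by (intro siegel_unipotent) auto
      then obtain T' where T': "T' \<in> unipotent n" "\<And>x. T' (T x) = x" "\<And>x. T (T' x) = x"
        using unipotent_inverse by blast
      define V' where "V' = T' ` V"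
      have VT: "V = T ` V'" by (auto simp: V'_def image_image T')
      have Tr: "T' (basis_vec r) = basis_vec r" if "r \<in> R" for r
      proof -
        have "T (basis_vec r) = basis_vec r" unfolding T_def
          using that less.prems(1) p(3) ybar by (intro c(3)) auto
        then show ?thesis using T'(2)[of "basis_vec r"] by simp
      qed
      have Tp: "T' y = basis_vec p" using c(2) T'(2)[of "basis_vec p"] by (simp add: T_def)
      have "\<exists>g\<in>unipotent n. \<exists>R'\<subseteq>{1..2*n+1}. V' = g ` cvs.span (basis_vec ` R')"
      proof (rule less.hyps[of "insert p R"])
        show "card ({1..2*n+1} - insert p R) < card ({1..2*n+1} - R)"
          by (subst Diff_insert, rule card_Diff1_less) (use p in auto)
        show "insert p R \<subseteq> {1..2*n+1}" using p less.prems by auto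
        show "basis_vec ` insert p R \<subseteq> V'"
        proof -
          have "basis_vec r \<in> V'" if "r \<in> R" for r
            using imageI[of "basis_vec r" V T'] less.prems(2) that unfolding V'_def Tr[OF that] by blast
          moreover have "basis_vec p \<in> V'" using imageI[OF yV, of T'] unfolding V'_def Tp .
          ultimately show ?thesis by auto
        qed
        show "cvs.subspace V'" unfolding V'_def using unipotent_linear[OF T'(1)] sV
          by (rule cvp.linear_subspace_image)
        show "V' \<subseteq> E n" using VE unipotent_E[OF T'(1)] by (auto simp: V'_def)
        show "omega n x y = 0" if "x \<in> V'" "y \<in> V'" for x y
          using that iso unipotent_omega[OF T'(1)] by (auto simp: V'_def)
      qed
      then obtain g R' where g: "g \<in> unipotent n" "R' \<subseteq> {1..2*n+1}" "V' = g ` cvs.span (basis_vec ` R')" by auto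
      have "V = (\<lambda>x. T (g x)) ` cvs.span (basis_vec ` R')" using VT g(3) by (auto simp: image_image)
      then show ?thesis using unipotent_comp[OF T g(1)] g(2) by blast
    qed
  qed
  from this[of "{}"] show thesis using that by auto
qed

subsection \<open>Schubert cells\<close>

definition coord_space :: "nat set \<Rightarrow> (nat \<Rightarrow> complex) set" where
  "coord_space v = cvs.span (basis_vec ` v)"

definition schubert_cell :: "nat \<Rightarrow> nat set \<Rightarrow> (nat \<Rightarrow> complex) set set" where
  "schubert_cell n v = (\<lambda>g. g ` coord_space v) ` unipotent n"

abbreviation nth_elem :: "nat set \<Rightarrow> nat \<Rightarrow> nat" where
  "nth_elem v a \<equiv> sorted_list_of_set v ! a"

lemma nth_elem_in: "finite v \<Longrightarrow> a < card v \<Longrightarrow> nth_elem v a \<in> v"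
  by (metis length_sorted_list_of_set nth_mem set_sorted_list_of_set)

lemma nth_elem_less: "a < b \<Longrightarrow> b < card v \<Longrightarrow> nth_elem v a < nth_elem v b"
  using sorted_wrt_nth_less[OF strict_sorted_list_of_set[of v]] by simp

lemma nth_elem_inj: "inj_on (nth_elem v) {..<card v}"
  by (rule linorder_inj_onI) (auto dest: nth_elem_less)

lemma nth_elem_image: "finite v \<Longrightarrow> nth_elem v ` {..<card v} = v"
  by (metis atLeast0LessThan length_sorted_list_of_set list.set_map map_nth set_sorted_list_of_set set_upt)

lemma count_above_nth_elem:
  assumes "finite v"
  shows "card {a. a < card v \<and> i < nth_elem v a} = count_above v i"
proof -
  have "nth_elem v ` {a. a < card v \<and> i < nth_elem v a} = v \<inter> {i<..}"
    using nth_elem_image[OF assms] by auto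
  moreover have "inj_on (nth_elem v) {a. a < card v \<and> i < nth_elem v a}"
    by (rule inj_on_subset[OF nth_elem_inj]) auto
  ultimately show ?thesis unfolding count_above_def by (metis card_image)
qed

lemma card_nth_elem_le:
  assumes "finite v" "card v = k"
  shows "card {a \<in> {0..<k}. nth_elem v a \<le> i} = k - count_above v i"
proof -
  have "{a \<in> {0..<k}. nth_elem v a \<le> i} = {0..<k} - {a. a < card v \<and> i < nth_elem v a}" using assms(2) by auto
  moreover have "card ({0..<k} - {a. a < card v \<and> i < nth_elem v a}) = k - card {a. a < card v \<and> i < nth_elem v a}"
    using assms(2) by (subst card_Diff_subset) auto
  ultimately show ?thesis using count_above_nth_elem[OF assms(1)] by simp
qed

subsection \<open>Determinants and Pluecker coordinates\<close>

text \<open>Pigeonhole for the image of \<open>R\<close> and the set \<open>S\<close> inside a set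
  of size \<open>k\<close>.\<close>

lemma permutes_card_image_Int:
  assumes "\<pi> permutes {0..<k}" "R \<subseteq> {0..<k}" "S \<subseteq> {0..<k}"
  shows "card R + card S - k \<le> card {a \<in> R. \<pi> a \<in> S}"
proof -
  have fin: "finite R" "finite S" using assms by (auto intro: finite_subset)
  have inj: "inj_on \<pi> R" using assms(1) by (meson inj_on_subset permutes_inj subset_UNIV)
  have "card {a \<in> R. \<pi> a \<in> S} = card (\<pi> ` R \<inter> S)"
  proof -
    have "\<pi> ` {a \<in> R. \<pi> a \<in> S} = \<pi> ` R \<inter> S" by auto
    moreover have "inj_on \<pi> {a \<in> R. \<pi> a \<in> S}" using inj by (rule inj_on_subset) auto
    ultimately show ?thesis by (metis card_image)
  qed
  moreover have "card (\<pi> ` R \<union> S) \<le> k"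
  proof -
    have "\<pi> ` R \<union> S \<subseteq> {0..<k}" using assms permutes_in_image[OF assms(1)] by auto
    then show ?thesis using card_mono[of "{0..<k}"] by fastforce
  qed
  moreover have "card (\<pi> ` R) + card S = card (\<pi> ` R \<union> S) + card (\<pi> ` R \<inter> S)"
    using fin by (intro card_Un_Int) auto
  ultimately show ?thesis using card_image[OF inj] by linarith
qed

lemma det_leibniz:
  "det (mat k k (\<lambda>(a, b). F a b)) = (\<Sum>p\<in>{p. p permutes {0..<k}}. signof p * (\<Prod>i = 0..<k. F i (p i)))"
  by (subst det_def'[of _ k]) (auto intro!: sum.cong prod.cong)

text \<open>Every Leibniz term takes at least \<open>card R + card S - k\<close> factors from the
  block. With \<open>q = 0\<close> this treats large zero blocks, with \<open>q\<close> the variable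
  it bounds an order of vanishing.\<close>

lemma det_dvd_block:
  fixes q :: "'a :: comm_ring_1"
  assumes "R \<subseteq> {0..<k}" "S \<subseteq> {0..<k}" "\<And>a b. a \<in> R \<Longrightarrow> b \<in> S \<Longrightarrow> q dvd F a b"
  shows "q ^ (card R + card S - k) dvd det (mat k k (\<lambda>(a, b). F a b))"
proof -
  have "q ^ (card R + card S - k) dvd (\<Prod>i = 0..<k. F i (p i))" if p: "p permutes {0..<k}" for p
  proof -
    define T where "T = {a \<in> R. p a \<in> S}"
    have "q ^ (card R + card S - k) dvd q ^ card T"
      unfolding T_def by (rule le_imp_power_dvd) (rule permutes_card_image_Int[OF p assms(1,2)])
    also have "\<dots> = (\<Prod>i\<in>T. q)" by simp
    also have "\<dots> dvd (\<Prod>i\<in>T. F i (p i))" by (rule prod_dvd_prod) (use assms(3) in \<open>auto simp: T_def\<close>)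
    also have "\<dots> dvd (\<Prod>i = 0..<k. F i (p i))"
      by (rule prod_dvd_prod_subset) (use assms(1) in \<open>auto simp: T_def\<close>)
    finally show ?thesis .
  qed
  then have "q ^ (card R + card S - k) dvd (\<Sum>p\<in>{p. p permutes {0..<k}}. signof p * (\<Prod>i = 0..<k. F i (p i)))"
    by (intro dvd_sum dvd_mult) auto
  then show ?thesis unfolding det_leibniz .
qed

lemma det_zero_block:
  fixes F :: "nat \<Rightarrow> nat \<Rightarrow> 'a :: comm_ring_1"
  assumes "R \<subseteq> {0..<k}" "S \<subseteq> {0..<k}" "card R + card S > k"
    "\<And>a b. a \<in> R \<Longrightarrow> b \<in> S \<Longrightarrow> F a b = 0"
  shows "det (mat k k (\<lambda>(a, b). F a b)) = 0"
  using det_dvd_block[OF assms(1,2), of 0 F] assms(3,4) by (simp add: power_0_left)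

lemma poly_det_eval:
  "poly (det (mat k k (\<lambda>(a, b). F a b))) t = det (mat k k (\<lambda>(a, b). poly (F a b) t))"
  unfolding det_leibniz by (simp add: poly_sum poly_prod)

definition triangular_frame :: "nat set \<Rightarrow> (nat \<Rightarrow> nat \<Rightarrow> complex) \<Rightarrow> bool" where
  "triangular_frame v u \<longleftrightarrow>
     (\<forall>a<card v. u a (nth_elem v a) \<noteq> 0 \<and> (\<forall>i>nth_elem v a. u a i = 0))"

lemma pluecker_triangular_nonzero:
  assumes "v \<subseteq> {1..2*n+1}" "card v = k" "triangular_frame v u"
  shows "pluecker n k u v \<noteq> 0"
proof -
  let ?M = "mat k k (\<lambda>(a, b). u a (nth_elem v b))"
  have "det ?M = prod_list (diag_mat ?M)"
    by (rule det_lower_triangular[of k]) (use assms in \<open>auto simp: triangular_frame_def nth_elem_less\<close>)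
  also have "\<dots> = (\<Prod>a = 0..<k. u a (nth_elem v a))" by (simp add: prod_list_diag_prod)
  also have "\<dots> \<noteq> 0" using assms by (auto simp: triangular_frame_def)
  finally show ?thesis using assms by (simp add: pluecker_def)
qed

text \<open>Rows with pivot at most \<open>i\<close> vanish in the columns above \<open>i\<close>.
  If \<open>I\<close> has more columns above \<open>i\<close> than there are pivots, this zero block
  is too large for a nonzero minor.\<close>

lemma pluecker_triangular_le:
  assumes "finite v" "card v = k" "triangular_frame v u" "pluecker n k u I \<noteq> 0"
  shows "bruhat_le I v"
  unfolding bruhat_le_def
proof (rule allI, rule ccontr)
  fix i
  assume less: "\<not> count_above I i \<le> count_above v i"
  have I: "I \<subseteq> {1..2*n+1}" "card I = k" using assms(4) by (auto simp: pluecker_def split: if_splits)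
  then have finI: "finite I" by (auto intro: finite_subset)
  define R where "R = {a \<in> {0..<k}. nth_elem v a \<le> i}"
  define S where "S = {b. b < k \<and> i < nth_elem I b}"
  have "card S = count_above I i" using count_above_nth_elem[OF finI] I(2) by (simp add: S_def)
  moreover have "card R = k - count_above v i" using card_nth_elem_le[OF assms(1,2)] by (simp add: R_def)
  moreover have "count_above v i \<le> k" using count_above_le_card[OF assms(1)] assms(2) by auto
  ultimately have "card R + card S > k" using less by linarith
  moreover have "u a (nth_elem I b) = 0" if "a \<in> R" "b \<in> S" for a b
    using that assms(2,3) by (auto simp: R_def S_def triangular_frame_def)
  moreover have "R \<subseteq> {0..<k}" "S \<subseteq> {0..<k}" by (auto simp: R_def S_def)
  ultimately have "det (mat k k (\<lambda>(a, b). u a (nth_elem I b))) = 0" by (intro det_zero_block[of R k S]) auto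
  then show False using assms(4) I by (simp add: pluecker_def)
qed

subsection \<open>Ordered bases\<close>

lemma ordered_basesI:
  assumes "\<And>c. (\<Sum>a<k. cscale (c a) (u a)) = 0 \<Longrightarrow> \<forall>a<k. c a = 0"
  shows "u \<in> ordered_bases k (cvs.span (u ` {..<k}))"
proof -
  have inj: "inj_on u {..<k}"
  proof (rule inj_onI, rule ccontr)
    fix a b assume ab: "a \<in> {..<k}" "b \<in> {..<k}" "u a = u b" "a \<noteq> b"
    define c :: "nat \<Rightarrow> complex" where "c i = (if i = a then 1 else if i = b then -1 else 0)" for i
    have "(\<Sum>i<k. cscale (c i) (u i)) = (\<Sum>i\<in>{a, b}. cscale (c i) (u i))"
      using ab by (intro sum.mono_neutral_right) (auto simp: c_def)
    also have "\<dots> = 0" using ab by (simp add: c_def)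
    finally have "c a = 0" using assms ab by blast
    then show False by (simp add: c_def)
  qed
  have "cvs.independent (u ` {..<k})"
  proof (rule cvs.independent_if_scalars_zero)
    fix f x assume f: "(\<Sum>x\<in>u ` {..<k}. cscale (f x) x) = 0" and x: "x \<in> u ` {..<k}"
    have "(\<Sum>a<k. cscale (f (u a)) (u a)) = 0" using f by (simp add: sum.reindex[OF inj])
    with assms[of "\<lambda>a. f (u a)"] x show "f x = 0" by auto
  qed auto
  with inj show ?thesis by (simp add: ordered_bases_def)
qed

text \<open>A linear relation among the vectors lies in the kernel of the transposed minor.\<close>

lemma ordered_bases_pluecker:
  assumes "pluecker n k u I \<noteq> 0"
  shows "u \<in> ordered_bases k (cvs.span (u ` {..<k}))"
proof (rule ordered_basesI)
  fix c assume c: "(\<Sum>a<k. cscale (c a) (u a)) = 0"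
  have I: "I \<subseteq> {1..2*n+1}" "card I = k" using assms by (auto simp: pluecker_def split: if_splits)
  define M where "M = mat k k (\<lambda>(a, b). u a (nth_elem I b))"
  have M: "M \<in> carrier_mat k k" by (simp add: M_def)
  have "det M \<noteq> 0" using assms I by (simp add: pluecker_def M_def)
  then have d: "det (transpose_mat M) \<noteq> 0" using det_transpose[OF M] by simp
  have T: "transpose_mat M \<in> carrier_mat k k" using M by simp
  have "transpose_mat M *\<^sub>v vec k c = 0\<^sub>v k"
  proof (rule eq_vecI)
    fix b assume "b < dim_vec (0\<^sub>v k :: complex vec)"
    then have b: "b < k" by simp
    have "(transpose_mat M *\<^sub>v vec k c) $ b = (\<Sum>a<k. c a * u a (nth_elem I b))"
      using b M by (simp add: M_def scalar_prod_def lessThan_atLeast0 mult.commute)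
    also have "\<dots> = (\<Sum>a<k. cscale (c a) (u a)) (nth_elem I b)" by (simp add: sum_apply)
    finally show "(transpose_mat M *\<^sub>v vec k c) $ b = 0\<^sub>v k $ b" using b c by simp
  qed (use M in auto)
  then have "vec k c = 0\<^sub>v k" using det_0_iff_vec_prod_zero_field[OF T] d by (metis vec_carrier)
  then show "\<forall>a<k. c a = 0" by (metis index_vec index_zero_vec(1))
qed

lemma span_frame:
  assumes "u \<in> ordered_bases k V" "x \<in> V"
  obtains c where "x = (\<Sum>b<k. cscale (c b) (u b))"
proof -
  have inj: "inj_on u {..<k}" using assms by (simp add: ordered_bases_def)
  have "x \<in> range (\<lambda>f. \<Sum>v\<in>u ` {..<k}. cscale (f v) v)"
    using assms cvs.span_finite[of "u ` {..<k}"] by (auto simp: ordered_bases_def)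
  then obtain f where "x = (\<Sum>v\<in>u ` {..<k}. cscale (f v) v)" by auto
  then show thesis using that[of "\<lambda>b. f (u b)"] by (simp add: sum.reindex[OF inj])
qed

lemma pluecker_change_basis:
  assumes "u \<in> ordered_bases k V" "u' \<in> ordered_bases k V"
  obtains c where "\<And>I. pluecker n k u' I = c * pluecker n k u I"
proof -
  have "\<exists>f. u' a = (\<Sum>b<k. cscale (f b) (u b))" if "a < k" for a
  proof -
    have "u' a \<in> V" using assms(2) that cvs.span_base[of "u' a" "u' ` {..<k}"] by (auto simp: ordered_bases_def)
    then show ?thesis using span_frame[OF assms(1)] by metis
  qed
  then obtain C where C: "\<And>a. a < k \<Longrightarrow> u' a = (\<Sum>b<k. cscale (C a b) (u b))" by metis
  define CM where "CM = mat k k (\<lambda>(a, b). C a b)"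
  have "det (mat k k (\<lambda>(a, b). u' a (\<sigma> b))) = det CM * det (mat k k (\<lambda>(a, b). u a (\<sigma> b)))" for \<sigma>
  proof -
    have "mat k k (\<lambda>(a, b). u' a (\<sigma> b)) = CM * mat k k (\<lambda>(a, b). u a (\<sigma> b))"
      by (rule eq_matI) (auto simp: CM_def C sum_apply scalar_prod_def lessThan_atLeast0)
    then show ?thesis by (simp add: det_mult[of _ k] CM_def)
  qed
  then show thesis by (intro that[of "det CM"]) (auto simp: pluecker_def)
qed

lemma pluecker_nonzero_iff:
  assumes "u \<in> ordered_bases k V" "u' \<in> ordered_bases k V"
  shows "pluecker n k u' I \<noteq> 0 \<longleftrightarrow> pluecker n k u I \<noteq> 0"
  using pluecker_change_basis[OF assms, of n] pluecker_change_basis[OF assms(2,1), of n]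
  by (metis mult_zero_right)

lemma triangular_frame_ordered_bases:
  assumes "v \<subseteq> {1..2*n+1}" "triangular_frame v u"
  shows "u \<in> ordered_bases (card v) (cvs.span (u ` {..<card v}))"
  using ordered_bases_pluecker pluecker_triangular_nonzero[OF assms(1) refl assms(2)] .

lemma ordered_bases_dim: "u \<in> ordered_bases k V \<Longrightarrow> cvs.dim V = k"
  unfolding ordered_bases_def using cvs.dim_span_eq_card_independent[of "u ` {..<k}"]
  by (auto simp: card_image)

lemma linear_coord_space:
  assumes "Vector_Spaces.linear cscale cscale h" "finite v"
  shows "cvs.span ((\<lambda>a. h (basis_vec (nth_elem v a))) ` {..<card v}) = h ` coord_space v"
proof -
  have "(\<lambda>a. h (basis_vec (nth_elem v a))) ` {..<card v} = h ` basis_vec ` v"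
    by (subst (2) nth_elem_image[OF assms(2), symmetric]) (simp only: image_image)
  then show ?thesis unfolding coord_space_def using cvp.linear_span_image[OF assms(1)] by simp
qed

lemma unipotent_triangular:
  assumes "g \<in> unipotent n" "v \<subseteq> {1..2*n+1}"
  shows "triangular_frame v (\<lambda>a. g (basis_vec (nth_elem v a)))"
proof -
  have fin: "finite v" using assms(2) by (rule finite_subset) simp
  have "g (basis_vec j) j = 1 \<and> (\<forall>i>j. g (basis_vec j) i = 0)" if "j \<in> v" for j
  proof -
    have j: "basis_vec j \<in> E n" using assms(2) that by (intro basis_vec_E) auto
    have "g (basis_vec j) i = basis_vec j i" if "j \<le> i" for i
      by (rule unipotent_lead[OF assms(1) j _ that]) (simp add: basis_vec_def)
    then show ?thesis by (auto simp: basis_vec_def)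
  qed
  then show ?thesis using nth_elem_in[OF fin] by (auto simp: triangular_frame_def)
qed

lemma unipotent_frame:
  assumes "g \<in> unipotent n" "v \<subseteq> {1..2*n+1}"
  shows "(\<lambda>a. g (basis_vec (nth_elem v a))) \<in> ordered_bases (card v) (g ` coord_space v)"
proof -
  have "finite v" using assms(2) by (rule finite_subset) simp
  then show ?thesis
    using triangular_frame_ordered_bases[OF assms(2) unipotent_triangular[OF assms]]
    by (simp add: linear_coord_space[OF unipotent_linear[OF assms(1)]])
qed

lemma basis_vec_coord_space: "i \<in> v \<Longrightarrow> basis_vec i \<in> coord_space v"
  unfolding coord_space_def by (intro cvs.span_base) auto

lemma coord_space_E: "v \<subseteq> {1..2*n+1} \<Longrightarrow> coord_space v \<subseteq> E n"
  unfolding coord_space_def E_def by (intro cvs.span_mono) auto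

lemma isotropic_span:
  assumes "\<And>x y. x \<in> S \<Longrightarrow> y \<in> S \<Longrightarrow> omega n x y = 0" "x \<in> cvs.span S" "y \<in> cvs.span S"
  shows "omega n x y = 0"
proof -
  have 0: "omega n 0 z = 0" "omega n z 0 = 0" for z
    using omega_scale_left[of n 0 0 z] omega_scale_right[of n z 0 0] unfolding cvs.scale_zero_left by simp_all
  have sub: "cvs.subspace {x. omega n x z = 0}" "cvs.subspace {x. omega n z x = 0}" for z
    unfolding cvs.subspace_def by (auto simp only: mem_Collect_eq 0 omega_bilinear mult_zero_right add_0_left)
  have 1: "omega n x z = 0" if "z \<in> S" for z
    using cvs.span_minimal[OF _ sub(1)[of z], of S] assms(1,2) that by (auto simp only: subset_eq mem_Collect_eq)
  show ?thesis
    using cvs.span_minimal[OF _ sub(2)[of x], of S] assms(3) 1 by (auto simp only: subset_eq mem_Collect_eq)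
qed

lemma coord_space_isotropic:
  assumes "admissible n k v" "x \<in> coord_space v" "y \<in> coord_space v"
  shows "omega n x y = 0"
proof (rule isotropic_span[OF _ assms(2,3)[unfolded coord_space_def]])
  fix x y assume "x \<in> basis_vec ` v" "y \<in> basis_vec ` v"
  then obtain i j where ij: "i \<in> v" "j \<in> v" "x = basis_vec i" "y = basis_vec j" by auto
  then have "idx_bar n i \<noteq> j" "1 \<le> i" "i \<le> 2*n+2" using assms(1) by (auto simp: admissible_def)
  then show "omega n x y = 0" using ij by (simp add: omega_basis_left) (simp add: basis_vec_def)
qed

lemma schubert_cell_subset_IG: "admissible n k v \<Longrightarrow> schubert_cell n v \<subseteq> IG n k"
proof
  fix V assume v: "admissible n k v" and "V \<in> schubert_cell n v"
  then obtain g where g: "g \<in> unipotent n" "V = g ` coord_space v" by (auto simp: schubert_cell_def)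
  have vN: "v \<subseteq> {1..2*n+1}" "card v = k" using v by (auto simp: admissible_def)
  have "cvs.subspace V" unfolding g(2) coord_space_def
    using unipotent_linear[OF g(1)] by (rule cvp.linear_subspace_image) simp
  moreover have "V \<subseteq> E n" using coord_space_E[OF vN(1)] unipotent_E[OF g(1)] g(2) by auto
  moreover have "cvs.dim V = k" using ordered_bases_dim[OF unipotent_frame[OF g(1) vN(1)]] vN g by simp
  ultimately show "V \<in> IG n k"
    using coord_space_isotropic[OF v] g by (auto simp: IG_def unipotent_omega)
qed

text \<open>Elimination reduces \<open>V\<close> to a coordinate subspace, and invariance of the
  form lets isotropy be read off from its indices.\<close>

theorem IG_schubert_cell:
  assumes "V \<in> IG n k"
  obtains v where "admissible n k v" "V \<in> schubert_cell n v"
proof -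
  have V: "cvs.subspace V" "V \<subseteq> E n" "cvs.dim V = k" "\<And>x y. x \<in> V \<Longrightarrow> y \<in> V \<Longrightarrow> omega n x y = 0"
    using assms by (auto simp: IG_def)
  obtain g R where g: "g \<in> unipotent n" "R \<subseteq> {1..2*n+1}" "V = g ` cvs.span (basis_vec ` R)"
    using bruhat_decomposition[OF V(1,2,4)] by metis
  have gV: "V = g ` coord_space R" using g by (simp add: coord_space_def)
  have "card R = k" using ordered_bases_dim[OF unipotent_frame[OF g(1,2)]] V(3) gV by simp
  moreover have "idx_bar n i \<notin> R" if "i \<in> R" for i
  proof
    assume b: "idx_bar n i \<in> R"
    have "omega n (g (basis_vec i)) (g (basis_vec (idx_bar n i))) = 0"
      unfolding gV by (intro V(4)[unfolded gV] imageI basis_vec_coord_space that b)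
    then have "omega n (basis_vec i) (basis_vec (idx_bar n i)) = 0" by (simp only: unipotent_omega[OF g(1)])
    moreover have "1 \<le> i" "i \<le> 2*n+2" using that g(2) by auto
    ultimately show False by (simp add: omega_basis_bar)
  qed
  ultimately have "admissible n k R" using g(2) by (auto simp: admissible_def)
  then show thesis using that gV g(1) by (auto simp: schubert_cell_def)
qed

text \<open>Equivalent to \<open>dim (V \<inter> \<langle>e\<^sub>1, \<dots>, e\<^sub>i\<rangle>) \<ge> k - m\<close>, but visibly closed.\<close>

definition minors_vanish :: "nat \<Rightarrow> nat \<Rightarrow> (nat \<Rightarrow> complex) set \<Rightarrow> nat \<Rightarrow> nat \<Rightarrow> bool" where
  "minors_vanish n k V i m \<longleftrightarrow> (\<forall>u\<in>ordered_bases k V. \<forall>I. m < count_above I i \<longrightarrow> pluecker n k u I = 0)"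

lemma minors_vanish_mono: "minors_vanish n k V i m \<Longrightarrow> m \<le> m' \<Longrightarrow> minors_vanish n k V i m'"
  by (auto simp: minors_vanish_def)

lemma schubert_cell_frame:
  assumes "admissible n k v" "V \<in> schubert_cell n v"
  obtains u where "u \<in> ordered_bases k V" "triangular_frame v u"
proof -
  obtain g where g: "g \<in> unipotent n" "V = g ` coord_space v" using assms(2) by (auto simp: schubert_cell_def)
  have v: "v \<subseteq> {1..2*n+1}" "card v = k" using assms(1) by (auto simp: admissible_def)
  show thesis using that unipotent_frame[OF g(1) v(1)] unipotent_triangular[OF g(1) v(1)] g(2) v(2) by simp
qed

lemma minors_vanish_cell:
  assumes "admissible n k v" "V \<in> schubert_cell n v"
  shows "minors_vanish n k V i (count_above v i)"
  unfolding minors_vanish_def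
proof (intro ballI allI impI)
  fix u' I assume u': "u' \<in> ordered_bases k V" and I: "count_above v i < count_above I i"
  obtain u where u: "u \<in> ordered_bases k V" "triangular_frame v u" using schubert_cell_frame[OF assms] .
  have v: "finite v" "card v = k" using assms(1) by (auto simp: admissible_finite admissible_def)
  have "pluecker n k u I = 0"
    using pluecker_triangular_le[OF v u(2), of n I] I by (auto simp: bruhat_le_def not_le[symmetric])
  then show "pluecker n k u' I = 0" using pluecker_nonzero_iff[OF u(1) u', of n I] by simp
qed

text \<open>The coordinate \<open>v\<close> itself does not vanish, so the bound of
  \<open>minors_vanish_cell\<close> is sharp and the conditions for all \<open>i\<close> recover the
  cell.\<close>

lemma minors_vanish_cellD:
  assumes "admissible n k v" "V \<in> schubert_cell n v" "minors_vanish n k V i m"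
  shows "count_above v i \<le> m"
proof -
  obtain u where u: "u \<in> ordered_bases k V" "triangular_frame v u" using schubert_cell_frame[OF assms(1,2)] .
  have "pluecker n k u v \<noteq> 0"
    using assms(1) u(2) by (intro pluecker_triangular_nonzero) (auto simp: admissible_def)
  then show ?thesis using assms(3) u(1) by (auto simp: minors_vanish_def not_le[symmetric])
qed

lemma IG_ordered_basis:
  assumes "V \<in> IG n k"
  obtains u I where "u \<in> ordered_bases k V" "pluecker n k u I \<noteq> 0"
proof -
  obtain v where v: "admissible n k v" "V \<in> schubert_cell n v" using IG_schubert_cell[OF assms] .
  obtain u where u: "u \<in> ordered_bases k V" "triangular_frame v u" using schubert_cell_frame[OF v] .
  then show thesis using that pluecker_triangular_nonzero[of v n k u] v(1) by (auto simp: admissible_def)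
qed

subsection \<open>The Zariski topology\<close>

lemma mpoly_eval_scale:
  assumes "mpoly_homogeneous p"
  obtains e where "\<And>c x. mpoly_eval p (\<lambda>v. c * x v) = c ^ e * mpoly_eval p x"
proof -
  obtain e where e: "\<And>m. m \<in> Poly_Mapping.keys p \<Longrightarrow> (\<Sum>v\<in>Poly_Mapping.keys m. Poly_Mapping.lookup m v) = e"
    using assms by (auto simp: mpoly_homogeneous_def)
  have "mpoly_eval p (\<lambda>v. c * x v) = c ^ e * mpoly_eval p x" for c x
    unfolding mpoly_eval_def sum_distrib_left
  proof (rule sum.cong[OF refl])
    fix m assume m: "m \<in> Poly_Mapping.keys p"
    have "(\<Prod>v\<in>Poly_Mapping.keys m. (c * x v) ^ Poly_Mapping.lookup m v)
        = c ^ e * (\<Prod>v\<in>Poly_Mapping.keys m. x v ^ Poly_Mapping.lookup m v)"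
      by (simp add: power_mult_distrib prod.distrib power_sum[symmetric] e[OF m])
    then show "Poly_Mapping.lookup p m * (\<Prod>v\<in>Poly_Mapping.keys m. (c * x v) ^ Poly_Mapping.lookup m v)
        = c ^ e * (Poly_Mapping.lookup p m * (\<Prod>v\<in>Poly_Mapping.keys m. x v ^ Poly_Mapping.lookup m v))"
      by simp
  qed
  then show thesis using that by blast
qed

text \<open>By homogeneity the choice of basis does not affect nonvanishing, so openness can be
  tested on a polynomial frame along a curve.\<close>

lemma basic_open_iff:
  assumes "mpoly_homogeneous p" "V \<in> IG n k" "u \<in> ordered_bases k V"
  shows "V \<in> basic_open n k p \<longleftrightarrow> mpoly_eval p (pluecker n k u) \<noteq> 0"
proof
  assume "V \<in> basic_open n k p"
  then obtain u' where u': "u' \<in> ordered_bases k V" "mpoly_eval p (pluecker n k u') \<noteq> 0"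
    by (auto simp: basic_open_def)
  obtain c where c: "\<And>I. pluecker n k u' I = c * pluecker n k u I"
    using pluecker_change_basis[OF assms(3) u'(1)] by metis
  obtain e where "\<And>c x. mpoly_eval p (\<lambda>v. c * x v) = c ^ e * mpoly_eval p x"
    using mpoly_eval_scale[OF assms(1)] by metis
  from this[of c "pluecker n k u"] u'(2) show "mpoly_eval p (pluecker n k u) \<noteq> 0"
    by (auto simp: c[symmetric])
qed (use assms in \<open>auto simp: basic_open_def\<close>)

lemma mpoly_eval_one: "mpoly_eval 1 x = 1"
  by (simp add: mpoly_eval_def)

lemma mpoly_eval_var: "mpoly_eval (Poly_Mapping.single (Poly_Mapping.single I (Suc 0)) 1) x = x I"
  by (simp add: mpoly_eval_def)

lemma openin_basic_open: "mpoly_homogeneous p \<Longrightarrow> openin (zariski n k) (basic_open n k p)"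
  unfolding zariski_def by (rule topology_generated_by_Basis) auto

lemma topspace_zariski: "topspace (zariski n k) = IG n k"
proof
  show "topspace (zariski n k) \<subseteq> IG n k"
    unfolding zariski_def topology_generated_by_topspace by (auto simp: basic_open_def)
  have h: "mpoly_homogeneous (1 :: (nat set \<Rightarrow>\<^sub>0 nat) \<Rightarrow>\<^sub>0 complex)"
    by (auto simp: mpoly_homogeneous_def)
  have "IG n k \<subseteq> basic_open n k 1"
  proof
    fix V assume V: "V \<in> IG n k"
    then obtain u I where "u \<in> ordered_bases k V" using IG_ordered_basis by metis
    with V show "V \<in> basic_open n k 1"
      by (auto simp: basic_open_def mpoly_eval_one)
  qed
  also have "\<dots> \<subseteq> topspace (zariski n k)"
    by (rule openin_subset[OF openin_basic_open[OF h]])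
  finally show "IG n k \<subseteq> topspace (zariski n k)" .
qed

lemma closedin_minors_vanish: "closedin (zariski n k) {V \<in> IG n k. minors_vanish n k V i m}"
proof -
  define var :: "nat set \<Rightarrow> (nat set \<Rightarrow>\<^sub>0 nat) \<Rightarrow>\<^sub>0 complex"
    where "var I = Poly_Mapping.single (Poly_Mapping.single I (Suc 0)) 1" for I
  have h: "mpoly_homogeneous (var I)" for I by (auto simp: mpoly_homogeneous_def var_def)
  have "IG n k - {V \<in> IG n k. minors_vanish n k V i m} = \<Union>((\<lambda>I. basic_open n k (var I)) ` {I. m < count_above I i})"
    by (auto simp: basic_open_def minors_vanish_def var_def mpoly_eval_var)
  then have "openin (zariski n k) (IG n k - {V \<in> IG n k. minors_vanish n k V i m})"
    using h by (auto intro!: openin_Union openin_basic_open)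
  then show ?thesis unfolding closedin_def topspace_zariski by auto
qed

lemma minors_vanish_closure:
  assumes "admissible n k v" "V \<in> zariski n k closure_of (schubert_cell n v)"
  shows "minors_vanish n k V i (count_above v i)"
proof -
  have "schubert_cell n v \<subseteq> {V \<in> IG n k. minors_vanish n k V i (count_above v i)}"
    using schubert_cell_subset_IG[OF assms(1)] minors_vanish_cell[OF assms(1)] by auto
  from closure_of_minimal[OF this closedin_minors_vanish] assms(2) show ?thesis by auto
qed

lemma irreducible_in_between:
  assumes "irreducible_in T S" "S \<subseteq> S'" "S' \<subseteq> T closure_of S"
  shows "irreducible_in T S'"
  unfolding irreducible_in_def
proof (intro conjI allI impI)
  show "S' \<subseteq> topspace T" using assms(3) closure_of_subset_topspace by (rule order_trans)
  show "S' \<noteq> {}" using assms(1,2) by (auto simp: irreducible_in_def)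
  fix A B assume AB: "closedin T A" "closedin T B" "S' \<subseteq> A \<union> B"
  then have "S \<subseteq> A \<or> S \<subseteq> B" using assms(1,2) unfolding irreducible_in_def by (meson order_trans)
  then show "S' \<subseteq> A \<or> S' \<subseteq> B"
    using closure_of_minimal AB(1,2) assms(3) by (meson order_trans)
qed

subsection \<open>Polynomial curves\<close>

text \<open>A predicate on functions: polynomiality of determinants and of evaluated polynomials
  then follows by composing closure rules.\<close>

definition polyfun :: "(complex \<Rightarrow> complex) \<Rightarrow> bool" where
  "polyfun f \<longleftrightarrow> (\<exists>p. \<forall>t. f t = poly p t)"

lemma polyfun_const [intro]: "polyfun (\<lambda>t. c)"
  unfolding polyfun_def by (rule exI[of _ "[:c:]"]) simp

lemma polyfun_id [intro]: "polyfun (\<lambda>t. t)"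
  unfolding polyfun_def by (rule exI[of _ "[:0, 1:]"]) simp

lemma polyfun_add [intro]: "polyfun f \<Longrightarrow> polyfun g \<Longrightarrow> polyfun (\<lambda>t. f t + g t)"
  unfolding polyfun_def by (metis poly_add)

lemma polyfun_diff [intro]: "polyfun f \<Longrightarrow> polyfun g \<Longrightarrow> polyfun (\<lambda>t. f t - g t)"
  unfolding polyfun_def by (metis poly_diff)

lemma polyfun_mult [intro]: "polyfun f \<Longrightarrow> polyfun g \<Longrightarrow> polyfun (\<lambda>t. f t * g t)"
  unfolding polyfun_def by (metis poly_mult)

lemma polyfun_power [intro]: "polyfun f \<Longrightarrow> polyfun (\<lambda>t. f t ^ m)"
  by (induction m) auto

lemma polyfun_sum [intro]: "(\<And>a. a \<in> S \<Longrightarrow> polyfun (\<lambda>t. f t a)) \<Longrightarrow> polyfun (\<lambda>t. \<Sum>a\<in>S. f t a)"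
  by (induction S rule: infinite_finite_induct) auto

lemma polyfun_prod [intro]: "(\<And>a. a \<in> S \<Longrightarrow> polyfun (\<lambda>t. f t a)) \<Longrightarrow> polyfun (\<lambda>t. \<Prod>a\<in>S. f t a)"
  by (induction S rule: infinite_finite_induct) auto

lemma polyfun_finite_zeros: "polyfun f \<Longrightarrow> f s \<noteq> 0 \<Longrightarrow> finite {t. f t = 0}"
  unfolding polyfun_def by (metis (mono_tags, lifting) Collect_cong poly_0 poly_roots_finite)

lemma polyfun_det:
  assumes "\<And>a b. polyfun (\<lambda>t. F t a b)"
  shows "polyfun (\<lambda>t. det (mat k k (\<lambda>(a, b). F t a b)))"
  unfolding det_leibniz
  by (intro polyfun_sum polyfun_mult polyfun_prod polyfun_const assms)

definition polycurve :: "(complex \<Rightarrow> nat \<Rightarrow> complex) \<Rightarrow> bool" where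
  "polycurve x \<longleftrightarrow> (\<forall>i. polyfun (\<lambda>t. x t i))"

text \<open>The frame has to be a basis at every parameter, limit points included; its minors then
  represent the point of the curve everywhere without a common factor to divide out.\<close>

definition algebraic_curve :: "nat \<Rightarrow> nat \<Rightarrow> (complex \<Rightarrow> (nat \<Rightarrow> complex) set) \<Rightarrow> bool" where
  "algebraic_curve n k \<gamma> \<longleftrightarrow>
     (\<exists>u. (\<forall>t. \<gamma> t \<in> IG n k \<and> u t \<in> ordered_bases k (\<gamma> t)) \<and> (\<forall>a. polycurve (\<lambda>t. u t a)))"

text \<open>On a basic open set the pulled back polynomial is zero or has finitely many roots. The
  dichotomy passes to finite intersections and arbitrary unions.\<close>

lemma algebraic_curve_preimage:
  assumes "algebraic_curve n k \<gamma>" "openin (zariski n k) Q"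
  shows "{t. \<gamma> t \<in> Q} = {} \<or> finite {t. \<gamma> t \<notin> Q}"
proof -
  obtain u where u: "\<And>t. \<gamma> t \<in> IG n k" "\<And>t. u t \<in> ordered_bases k (\<gamma> t)" "\<And>a. polycurve (\<lambda>t. u t a)"
    using assms(1) by (auto simp: algebraic_curve_def)
  have "generate_topology_on (basic_open n k ` Collect mpoly_homogeneous) Q"
    using assms(2) unfolding zariski_def openin_topology_generated_by_iff .
  then show ?thesis
  proof (induction rule: generate_topology_on.induct)
    case (Int a b)
    show ?case
    proof (cases "{t. \<gamma> t \<in> a} = {} \<or> {t. \<gamma> t \<in> b} = {}")
      case False
      then have "finite ({t. \<gamma> t \<notin> a} \<union> {t. \<gamma> t \<notin> b})" using Int by auto
      moreover have "{t. \<gamma> t \<notin> a \<inter> b} = {t. \<gamma> t \<notin> a} \<union> {t. \<gamma> t \<notin> b}" by auto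
      ultimately show ?thesis by simp
    qed auto
  next
    case (UN K)
    show ?case
    proof (cases "\<exists>Q\<in>K. {t. \<gamma> t \<in> Q} \<noteq> {}")
      case True
      then obtain Q where Q: "Q \<in> K" "{t. \<gamma> t \<in> Q} \<noteq> {}" by auto
      then have "finite {t. \<gamma> t \<notin> Q}" using UN by auto
      moreover have "{t. \<gamma> t \<notin> \<Union>K} \<subseteq> {t. \<gamma> t \<notin> Q}" using Q by auto
      ultimately show ?thesis by (auto intro: finite_subset)
    qed auto
  next
    case (Basis s)
    then obtain p where p: "mpoly_homogeneous p" "s = basic_open n k p" by auto
    have iff: "\<gamma> t \<in> s \<longleftrightarrow> mpoly_eval p (pluecker n k (u t)) \<noteq> 0" for t
      unfolding p(2) by (rule basic_open_iff[OF p(1) u(1,2)])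
    have pl: "polyfun (\<lambda>t. pluecker n k (u t) I)" for I
    proof (cases "I \<subseteq> {1..2*n+1} \<and> card I = k")
      case True
      then show ?thesis using u(3) unfolding pluecker_def if_P[OF True] polycurve_def
        by (intro polyfun_det) auto
    next
      case False
      show ?thesis unfolding pluecker_def if_not_P[OF False] by (rule polyfun_const)
    qed
    have pf: "polyfun (\<lambda>t. mpoly_eval p (pluecker n k (u t)))"
      unfolding mpoly_eval_def by (intro polyfun_sum polyfun_mult polyfun_const polyfun_prod polyfun_power pl)
    show ?case
    proof (cases "\<exists>t. \<gamma> t \<in> s")
      case True
      then obtain t where "mpoly_eval p (pluecker n k (u t)) \<noteq> 0" by (auto simp: iff)
      then show ?thesis using polyfun_finite_zeros[OF pf] by (simp add: iff)
    qed auto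
  qed simp
qed

text \<open>A neighborhood of the limit point has cofinite preimage, hence contains the point of
  some nonzero parameter.\<close>

lemma algebraic_curve_closure:
  assumes "algebraic_curve n k \<gamma>" "\<And>t. t \<noteq> 0 \<Longrightarrow> \<gamma> t \<in> S"
  shows "\<gamma> 0 \<in> zariski n k closure_of S"
  unfolding in_closure_of
proof (intro conjI allI impI)
  show "\<gamma> 0 \<in> topspace (zariski n k)"
    using assms(1) by (auto simp: algebraic_curve_def topspace_zariski)
  fix Q assume Q: "\<gamma> 0 \<in> Q \<and> openin (zariski n k) Q"
  then have "finite {t. \<gamma> t \<notin> Q}" using algebraic_curve_preimage[OF assms(1), of Q] by auto
  then have "finite (insert 0 {t. \<gamma> t \<notin> Q})" by simp
  then obtain t where "t \<notin> insert 0 {t. \<gamma> t \<notin> Q}"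
    using ex_new_if_finite[OF infinite_UNIV_char_0] by blast
  then show "\<exists>y. y \<in> S \<and> y \<in> Q" using assms(2) by auto
qed

text \<open>If \<open>x\<close> avoids \<open>A\<close> and \<open>y\<close> avoids
  \<open>B\<close>, the curve meets each of the two closed sets at finitely many parameters only, so
  they cannot cover it.\<close>

lemma irreducible_inI:
  assumes "S \<subseteq> IG n k" "S \<noteq> {}"
    "\<And>x y. x \<in> S \<Longrightarrow> y \<in> S \<Longrightarrow> \<exists>\<gamma>. algebraic_curve n k \<gamma> \<and> range \<gamma> \<subseteq> S \<and> \<gamma> 0 = x \<and> \<gamma> 1 = y"
  shows "irreducible_in (zariski n k) S"
  unfolding irreducible_in_def topspace_zariski
proof (intro conjI allI impI assms(1,2))
  fix A B assume AB: "closedin (zariski n k) A" "closedin (zariski n k) B" "S \<subseteq> A \<union> B"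
  show "S \<subseteq> A \<or> S \<subseteq> B"
  proof (rule ccontr)
    assume "\<not> ?thesis"
    then obtain x y where xy: "x \<in> S" "x \<notin> A" "y \<in> S" "y \<notin> B" by auto
    obtain \<gamma> where g: "algebraic_curve n k \<gamma>" "range \<gamma> \<subseteq> S" "\<gamma> 0 = x" "\<gamma> 1 = y"
      using assms(3)[OF xy(1,3)] by auto
    have fin: "finite {t. \<gamma> t \<in> C}" if "closedin (zariski n k) C" "\<gamma> s \<notin> C" for C s
    proof -
      have o: "openin (zariski n k) (IG n k - C)"
        using that(1) by (simp add: closedin_def topspace_zariski)
      have "\<gamma> s \<in> IG n k - C" using g(2) assms(1) that(2) by auto
      then have "finite {t. \<gamma> t \<notin> IG n k - C}" using algebraic_curve_preimage[OF g(1) o] by auto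
      then show ?thesis by (rule rev_finite_subset) auto
    qed
    have "finite {t. \<gamma> t \<in> A}" "finite {t. \<gamma> t \<in> B}"
      using fin[OF AB(1), of 0] fin[OF AB(2), of 1] g xy by auto
    then have "finite ({t. \<gamma> t \<in> A} \<union> {t. \<gamma> t \<in> B})" by simp
    moreover have "{t. \<gamma> t \<in> A} \<union> {t. \<gamma> t \<in> B} = UNIV" using g(2) AB(3) by auto
    ultimately show False using infinite_UNIV_char_0[where 'a = complex] by metis
  qed
qed

section \<open>Transport and rescaling of ordered bases\<close>

lemma ordered_bases_cong:
  assumes "w \<in> ordered_bases k X" "\<And>j. j < k \<Longrightarrow> w' j = w j"
  shows "w' \<in> ordered_bases k X"
proof -
  have "w' ` {..<k} = w ` {..<k}" "inj_on w' {..<k} = inj_on w {..<k}"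
    using assms(2) by (intro image_cong inj_on_cong; simp)+
  then show ?thesis using assms(1) by (simp add: ordered_bases_def)
qed

lemma ordered_bases_scalars:
  assumes "u \<in> ordered_bases k V" "(\<Sum>a<k. cscale (c a) (u a)) = 0" "a < k"
  shows "c a = 0"
proof -
  have inj: "inj_on u {..<k}" and ind: "cvs.independent (u ` {..<k})"
    using assms(1) by (auto simp: ordered_bases_def)
  have "(\<Sum>v\<in>u ` {..<k}. cscale (c (inv_into {..<k} u v)) v) = (\<Sum>a<k. cscale (c a) (u a))"
    unfolding sum.reindex[OF inj] o_def by (rule sum.cong) (auto simp: inv_into_f_f[OF inj])
  then have "c (inv_into {..<k} u (u a)) = 0"
    using assms(2,3) by (intro cvs.independentD[OF ind, of "u ` {..<k}"]) auto
  then show ?thesis using assms(3) by (simp add: inv_into_f_f[OF inj])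
qed

lemma ordered_bases_unipotent:
  assumes "u \<in> ordered_bases k V" "g \<in> unipotent n"
  shows "(\<lambda>a. g (u a)) \<in> ordered_bases k (g ` V)"
proof -
  have u: "inj_on u {..<k}" "cvs.independent (u ` {..<k})" "cvs.span (u ` {..<k}) = V"
    using assms(1) by (auto simp: ordered_bases_def)
  have im: "(\<lambda>a. g (u a)) ` {..<k} = g ` u ` {..<k}" by (simp only: image_image)
  have "inj_on (\<lambda>a. g (u a)) {..<k}"
    using u(1) unipotent_inj[OF assms(2)] by (auto simp: inj_on_def)
  moreover have "cvs.independent (g ` u ` {..<k})"
    using unipotent_linear[OF assms(2)] u(2) inj_on_subset[OF unipotent_inj[OF assms(2)] subset_UNIV]
    by (rule cvp.linear_independent_injective_image)
  moreover have "cvs.span (g ` u ` {..<k}) = g ` V"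
    using cvp.linear_span_image[OF unipotent_linear[OF assms(2)], of "u ` {..<k}"] u(3) by (simp only:)
  ultimately show ?thesis unfolding ordered_bases_def mem_Collect_eq im by (intro conjI)
qed

lemma ordered_bases_scale:
  assumes "u \<in> ordered_bases k V" "\<And>a. a < k \<Longrightarrow> s a \<noteq> 0"
  shows "(\<lambda>a. cscale (s a) (u a)) \<in> ordered_bases k V"
proof -
  have "cvs.span ((\<lambda>a. cscale (s a) (u a)) ` {..<k}) = V"
  proof
    have V: "V = cvs.span (u ` {..<k})" using assms(1) by (auto simp: ordered_bases_def)
    show "cvs.span ((\<lambda>a. cscale (s a) (u a)) ` {..<k}) \<subseteq> V" unfolding V
      by (rule cvs.span_minimal) (auto intro: cvs.span_scale cvs.span_base)
    show "V \<subseteq> cvs.span ((\<lambda>a. cscale (s a) (u a)) ` {..<k})" unfolding V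
    proof (rule cvs.span_minimal)
      show "u ` {..<k} \<subseteq> cvs.span ((\<lambda>a. cscale (s a) (u a)) ` {..<k})"
      proof
        fix x assume "x \<in> u ` {..<k}"
        then obtain a where a: "a < k" "x = u a" by auto
        have "x = cscale (inverse (s a)) (cscale (s a) (u a))" using assms(2)[OF a(1)] a(2) by simp
        also have "\<dots> \<in> cvs.span ((\<lambda>a. cscale (s a) (u a)) ` {..<k})"
          using a(1) by (intro cvs.span_scale cvs.span_base imageI) simp
        finally show "x \<in> cvs.span ((\<lambda>a. cscale (s a) (u a)) ` {..<k})" .
      qed
    qed simp
  qed
  moreover have "(\<lambda>a. cscale (s a) (u a)) \<in> ordered_bases k (cvs.span ((\<lambda>a. cscale (s a) (u a)) ` {..<k}))"
  proof (rule ordered_basesI)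
    fix c assume "(\<Sum>a<k. cscale (c a) (cscale (s a) (u a))) = 0"
    then have "(\<Sum>a<k. cscale (c a * s a) (u a)) = 0" by simp
    then have "c a * s a = 0" if "a < k" for a using ordered_bases_scalars[OF assms(1), of "\<lambda>a. c a * s a" a] that by simp
    then show "\<forall>a<k. c a = 0" using assms(2) by auto
  qed
  ultimately show ?thesis by simp
qed

lemma ordered_bases_coord:
  assumes "inj_on \<sigma> {..<k}" "\<sigma> ` {..<k} = v"
  shows "(\<lambda>a. basis_vec (\<sigma> a)) \<in> ordered_bases k (coord_space v)"
proof -
  have "(\<lambda>a. basis_vec (\<sigma> a)) ` {..<k} = basis_vec ` v" unfolding assms(2)[symmetric] image_image ..
  moreover have "(\<lambda>a. basis_vec (\<sigma> a)) \<in> ordered_bases k (cvs.span ((\<lambda>a. basis_vec (\<sigma> a)) ` {..<k}))"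
  proof (rule ordered_basesI, intro allI impI)
    fix c b assume c: "(\<Sum>a<k. cscale (c a) (basis_vec (\<sigma> a))) = 0" and b: "b < k"
    have "(\<Sum>a<k. cscale (c a) (basis_vec (\<sigma> a))) (\<sigma> b) = (\<Sum>a<k. if a = b then c a else 0)"
      unfolding sum_apply by (rule sum.cong) (use assms(1) b in \<open>auto simp: basis_vec_def inj_on_def\<close>)
    also have "\<dots> = c b" using b by simp
    finally show "c b = 0" unfolding c by simp
  qed
  ultimately show ?thesis by (simp add: coord_space_def)
qed

subsection \<open>Closures of Schubert cells\<close>

lemma polyfun_omega: "polycurve x \<Longrightarrow> polyfun (\<lambda>t. omega n (x t) y)"
  unfolding omega_def polycurve_def by (intro polyfun_sum polyfun_diff polyfun_mult polyfun_const) auto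

lemma polycurve_siegel:
  assumes "polycurve x" "polyfun f"
  shows "polycurve (\<lambda>t. siegel n p (cscale (f t) c) (x t))"
proof -
  have "siegel n p (cscale (f t) c) (x t) i = x t i + f t * omega n (x t) c * basis_vec (idx_bar n p) i
      + omega n (x t) (basis_vec (idx_bar n p)) * (f t * c i)" for t i
    unfolding siegel_def by (simp add: omega_scale_right)
  then show ?thesis using assms polyfun_omega[OF assms(1)] unfolding polycurve_def
    by (auto intro!: polyfun_add polyfun_mult polyfun_const)
qed

lemma unipotent_polycurve:
  assumes "g \<in> unipotent n" "polycurve x"
  shows "polycurve (\<lambda>t. g (x t))"
  using assms(1)
proof (induction rule: unipotent.induct)
  case (unipotent_siegel g p c)
  show ?case using polycurve_siegel[OF unipotent_siegel.IH polyfun_const, of n p 1 c] by (simp only: cvs.scale_one)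
qed (rule assms(2))

text \<open>Multiply the parameter of every Siegel factor by \<open>t\<close>.\<close>

lemma unipotent_path:
  assumes "g \<in> unipotent n"
  obtains c where "\<And>t. c t \<in> unipotent n" "\<And>x. c 0 x = x" "c 1 = g"
    "\<And>x. polycurve x \<Longrightarrow> polycurve (\<lambda>t. c t (x t))"
proof -
  have "\<exists>c. (\<forall>t. c t \<in> unipotent n) \<and> (\<forall>x. c 0 x = x) \<and> c 1 = g \<and> (\<forall>x. polycurve x \<longrightarrow> polycurve (\<lambda>t. c t (x t)))"
    using assms
  proof (induction rule: unipotent.induct)
    case unipotent_id
    show ?case by (intro exI[of _ "\<lambda>t x. x"]) (simp add: unipotent.unipotent_id)
  next
    case (unipotent_siegel g p d)
    obtain c where c: "\<And>t. c t \<in> unipotent n" "\<And>x. c 0 x = x" "c 1 = g"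
      "\<And>x. polycurve x \<Longrightarrow> polycurve (\<lambda>t. c t (x t))"
      using unipotent_siegel.IH by (elim exE conjE) auto
    show ?case
    proof (intro exI[of _ "\<lambda>t x. siegel n p (cscale t d) (c t x)"] conjI allI impI)
      show "(\<lambda>x. siegel n p (cscale t d) (c t x)) \<in> unipotent n" for t
        by (intro unipotent.unipotent_siegel c unipotent_siegel.hyps below_scale)
      show "siegel n p (cscale 0 d) (c 0 x) = x" for x by (simp only: siegel_zero c)
      show "(\<lambda>x. siegel n p (cscale 1 d) (c 1 x)) = (\<lambda>x. siegel n p d (g x))" by (simp only: cvs.scale_one c)
      show "polycurve (\<lambda>t. siegel n p (cscale t d) (c t (x t)))" if "polycurve x" for x
        by (intro polycurve_siegel c that polyfun_id)
    qed
  qed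
  then show thesis using that by (elim exE conjE) auto
qed

lemma polycurve_const: "polycurve (\<lambda>t. x)"
  by (auto simp: polycurve_def)

lemma schubert_cell_irreducible:
  assumes "admissible n k v"
  shows "irreducible_in (zariski n k) (schubert_cell n v)"
proof (rule irreducible_inI)
  show "schubert_cell n v \<subseteq> IG n k" using assms by (rule schubert_cell_subset_IG)
  show "schubert_cell n v \<noteq> {}" using unipotent_id by (auto simp: schubert_cell_def)
  have v: "v \<subseteq> {1..2*n+1}" "card v = k" using assms by (auto simp: admissible_def)
  fix V1 V2 assume "V1 \<in> schubert_cell n v" "V2 \<in> schubert_cell n v"
  then obtain g1 g2 where g: "g1 \<in> unipotent n" "V1 = g1 ` coord_space v" "g2 \<in> unipotent n" "V2 = g2 ` coord_space v"
    by (auto simp: schubert_cell_def)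
  obtain h where h: "h \<in> unipotent n" "\<And>x. g1 (h x) = x" using unipotent_inverse[OF g(1)] by (elim bexE conjE) auto
  \<comment> \<open>A path from the identity to the quotient of \<open>g2\<close> by
    \<open>g1\<close>; translated by \<open>g1\<close>, it joins \<open>V1\<close> to
    \<open>V2\<close> within the orbit.\<close>
  obtain c where c: "\<And>t. c t \<in> unipotent n" "\<And>x. c 0 x = x" "c 1 = (\<lambda>x. h (g2 x))"
    "\<And>x. polycurve x \<Longrightarrow> polycurve (\<lambda>t. c t (x t))"
    using unipotent_path[OF unipotent_comp[OF h(1) g(3)]] by metis
  define \<gamma> where "\<gamma> t = (\<lambda>x. g1 (c t x)) ` coord_space v" for t
  have gc: "(\<lambda>x. g1 (c t x)) \<in> unipotent n" for t by (rule unipotent_comp[OF g(1) c(1)])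
  then have \<gamma>schubert_cell: "\<gamma> t \<in> schubert_cell n v" for t unfolding schubert_cell_def \<gamma>_def by (intro imageI)
  have "algebraic_curve n k \<gamma>" unfolding algebraic_curve_def
  proof (intro exI[of _ "\<lambda>t a. g1 (c t (basis_vec (nth_elem v a)))"] conjI allI)
    show "\<gamma> t \<in> IG n k" for t using \<gamma>schubert_cell schubert_cell_subset_IG[OF assms] by auto
    show "(\<lambda>a. g1 (c t (basis_vec (nth_elem v a)))) \<in> ordered_bases k (\<gamma> t)" for t
      using unipotent_frame[OF gc v(1), of t] unfolding \<gamma>_def v(2) .
    show "polycurve (\<lambda>t. g1 (c t (basis_vec (nth_elem v a))))" for a
      by (intro unipotent_polycurve[OF g(1)] c(4) polycurve_const)
  qed
  moreover have "range \<gamma> \<subseteq> schubert_cell n v" using \<gamma>schubert_cell by auto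
  moreover have "\<gamma> 0 = V1" "\<gamma> 1 = V2" unfolding \<gamma>_def g(2,4) by (simp_all only: c(2,3) h(2))
  ultimately show "\<exists>\<gamma>. algebraic_curve n k \<gamma> \<and> range \<gamma> \<subseteq> schubert_cell n v \<and> \<gamma> 0 = V1 \<and> \<gamma> 1 = V2" by blast
qed

text \<open>Apply the Siegel transformation with parameter \<open>1 / t\<close> to the coordinate subspace of \<open>v'\<close> and
  rescale the two moving basis vectors by \<open>t\<close>: at \<open>t = 0\<close> they become multiples of the reflected ones.\<close>

lemma schubert_cell_reflection_closure:
  assumes v': "admissible n k v'" and v: "admissible n k v" and ab: "1 \<le> a" "a < b" "b \<in> v'" "a \<notin> v'"
    and refl: "v = reflect n a b ` v'" and V: "V \<in> schubert_cell n v"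
  shows "V \<in> zariski n k closure_of (schubert_cell n v')"
proof -
  have vN: "v' \<subseteq> {1..2*n+1}" "card v' = k" "card v = k" using v' v by (auto simp: admissible_def)
  have fin: "finite v'" using v' by (rule admissible_finite)
  have bN: "1 \<le> b" "b \<le> 2*n+1" using ab(3) vN(1) by auto
  obtain g where g: "g \<in> unipotent n" "V = g ` coord_space v" using V by (auto simp: schubert_cell_def)
  define N where "N x = cscale (omega n x (basis_vec a)) (basis_vec (idx_bar n b))
      + cscale (omega n x (basis_vec (idx_bar n b))) (basis_vec a)" for x
  have bel: "below b (cscale s (basis_vec a))" for s using ab by (auto simp: below_def basis_vec_def)
  have sieg: "siegel n b (cscale s (basis_vec a)) x = x + cscale s (N x)" for s x
    unfolding siegel_def N_def omega_scale_right by (simp add: fun_eq_iff algebra_simps)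
  define M where "M = {b, idx_bar n a}"
  \<comment> \<open>The coefficient of the image of e_m under \<open>N\<close> for \<open>m\<close>
    in \<open>M\<close>. The 2 occurs if \<open>b\<close> is bar \<open>a\<close>: then both terms
    of \<open>N\<close> are the same multiple of e_a.\<close>
  define \<kappa> where "\<kappa> m = (if m \<in> M then (if m = b then if b = idx_bar n a then 2 * bar_sign n b else bar_sign n b
      else bar_sign n m) else 1)" for m
  have \<kappa>: "\<kappa> m \<noteq> 0" for m by (simp add: \<kappa>_def)
  have aN: "a \<le> 2*n+2" using ab bN by simp
  have om_a: "omega n (basis_vec r) (basis_vec a) = (if r = idx_bar n a then bar_sign n r else 0)"
    if "1 \<le> r" "r \<le> 2*n+1" for r
    using that aN ab(1) by (subst omega_basis_left) (auto simp: basis_vec_def idx_bar_def)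
  have om_b: "omega n (basis_vec r) (basis_vec (idx_bar n b)) = (if r = b then bar_sign n b else 0)" for r
    using bN by (subst omega_basis_bar) (auto simp: basis_vec_def)
  have N0: "N (basis_vec r) = 0" if "r \<in> v'" "r \<notin> M" for r
  proof -
    have "1 \<le> r" "r \<le> 2*n+1" using that vN by auto
    then show ?thesis using that unfolding N_def om_b by (subst om_a) (auto simp: M_def)
  qed
  have NM: "N (basis_vec m) = cscale (\<kappa> m) (basis_vec (reflect n a b m))" if mv: "m \<in> v'" "m \<in> M" for m
  proof -
    have m: "1 \<le> m" "m \<le> 2*n+1" using mv vN by auto
    have bb: "idx_bar n (idx_bar n a) = a" using aN by (intro idx_bar_bar) simp
    consider "m = b" "b = idx_bar n a" | "m = b" "b \<noteq> idx_bar n a" | "m \<noteq> b" "m = idx_bar n a"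
      using mv(2) unfolding M_def by blast
    then show ?thesis
    proof cases
      case 1
      then have "idx_bar n b = a" using bb by simp
      then show ?thesis using 1 unfolding N_def om_b om_a[OF m]
        by (auto simp: \<kappa>_def M_def reflect_def fun_eq_iff)
    qed (use m in \<open>auto simp: N_def om_b om_a \<kappa>_def M_def reflect_def\<close>)
  qed
  define u where "u t j = (let m = nth_elem v' j in
      if m \<in> M then cscale t (basis_vec m) + N (basis_vec m) else basis_vec m)" for t j
  define \<gamma> where "\<gamma> t = g ` cvs.span (u t ` {..<k})" for t
  have L: "nth_elem v' j \<in> v'" if "j < k" for j using nth_elem_in[OF fin] that vN by simp
  have inj: "inj_on (nth_elem v') {..<k}" using nth_elem_inj[of v'] vN by simp
  have im: "nth_elem v' ` {..<k} = v'" using nth_elem_image[OF fin] vN by simp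
  have u0: "u 0 j = cscale (\<kappa> (nth_elem v' j)) (basis_vec (reflect n a b (nth_elem v' j)))" if "j < k" for j
  proof (cases "nth_elem v' j \<in> M")
    case True
    then show ?thesis by (simp add: u_def Let_def NM[OF L[OF that]])
  next
    case False
    then show ?thesis by (auto simp: u_def Let_def \<kappa>_def M_def reflect_def fun_eq_iff)
  qed
  have ob0: "u 0 \<in> ordered_bases k (coord_space v)"
  proof -
    have "card (reflect n a b ` v') = card v'" using refl vN by simp
    then have "inj_on (reflect n a b) v'" using fin by (rule eq_card_imp_inj_on[rotated])
    then have "inj_on (\<lambda>j. reflect n a b (nth_elem v' j)) {..<k}"
      using comp_inj_on[OF inj, of "reflect n a b"] im by (simp add: o_def)
    moreover have "(\<lambda>j. reflect n a b (nth_elem v' j)) ` {..<k} = v" using im refl by (metis image_image)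
    ultimately have "(\<lambda>j. basis_vec (reflect n a b (nth_elem v' j))) \<in> ordered_bases k (coord_space v)"
      by (rule ordered_bases_coord)
    from ordered_bases_scale[OF this, of "\<lambda>j. \<kappa> (nth_elem v' j)"] \<kappa>
    have "(\<lambda>j. cscale (\<kappa> (nth_elem v' j)) (basis_vec (reflect n a b (nth_elem v' j)))) \<in> ordered_bases k (coord_space v)"
      by simp
    then show ?thesis using u0 by (rule ordered_bases_cong)
  qed
  have ob1: "u t \<in> ordered_bases k (siegel n b (cscale (inverse t) (basis_vec a)) ` coord_space v')" if "t \<noteq> 0" for t
  proof -
    let ?T = "siegel n b (cscale (inverse t) (basis_vec a))"
    have T: "?T \<in> unipotent n" using bN bel by (intro siegel_unipotent)
    have "(\<lambda>j. cscale (if nth_elem v' j \<in> M then t else 1) (?T (basis_vec (nth_elem v' j)))) \<in> ordered_bases k (?T ` coord_space v')"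
      using unipotent_frame[OF T vN(1)] that unfolding vN(2) by (intro ordered_bases_scale) auto
    moreover have "u t j = cscale (if nth_elem v' j \<in> M then t else 1) (?T (basis_vec (nth_elem v' j)))" if "j < k" for j
      using N0[OF L[OF that]] \<open>t \<noteq> 0\<close> unfolding sieg u_def Let_def by (auto simp: fun_eq_iff algebra_simps)
    ultimately show ?thesis by (rule ordered_bases_cong)
  qed
  have sp: "cvs.span (u t ` {..<k}) = X" if "u t \<in> ordered_bases k X" for t X
    using that by (auto simp: ordered_bases_def)
  have \<gamma>0: "\<gamma> 0 = V" unfolding \<gamma>_def sp[OF ob0] g(2) ..
  have \<gamma>1: "\<gamma> t \<in> schubert_cell n v'" if "t \<noteq> 0" for t
  proof -
    have "siegel n b (cscale (inverse t) (basis_vec a)) \<in> unipotent n" using bN bel by (intro siegel_unipotent)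
    from imageI[OF unipotent_comp[OF g(1) this], of "\<lambda>h. h ` coord_space v'"]
    show ?thesis unfolding \<gamma>_def sp[OF ob1[OF that]] schubert_cell_def image_image .
  qed
  have "algebraic_curve n k \<gamma>" unfolding algebraic_curve_def
  proof (intro exI[of _ "\<lambda>t j. g (u t j)"] conjI allI)
    fix t
    show "\<gamma> t \<in> IG n k"
    proof (cases "t = 0")
      case True
      then show ?thesis using \<gamma>0 V schubert_cell_subset_IG[OF v] by auto
    next
      case False
      then show ?thesis using \<gamma>1 schubert_cell_subset_IG[OF v'] by auto
    qed
    have "u t \<in> ordered_bases k (cvs.span (u t ` {..<k}))"
      using ob0 ob1[of t] sp by (cases "t = 0") auto
    then show "(\<lambda>j. g (u t j)) \<in> ordered_bases k (\<gamma> t)" unfolding \<gamma>_def using g(1) by (rule ordered_bases_unipotent)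
  next
    fix j
    have "polycurve (\<lambda>t. u t j)"
      unfolding polycurve_def u_def Let_def 
      by (cases "nth_elem v' j \<in> M") (auto intro!: polyfun_add polyfun_mult polyfun_id polyfun_const)
    then show "polycurve (\<lambda>t. g (u t j))" by (rule unipotent_polycurve[OF g(1)])
  qed
  from algebraic_curve_closure[OF this \<gamma>1] show ?thesis unfolding \<gamma>0 .
qed

text \<open>Each \<open>bruhat_step\<close> realizes one closure relation and strictly raises the
  sum of the index set, which is bounded.\<close>

theorem bruhat_le_closure:
  assumes "admissible n k v" "admissible n k w" "bruhat_le v w"
  shows "schubert_cell n v \<subseteq> zariski n k closure_of (schubert_cell n w)"
  using assms
proof (induction "\<Sum>{1..2*n+1} - \<Sum>v" arbitrary: v rule: less_induct)
  case less
  show ?case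
  proof (cases "v = w")
    case True
    then show ?thesis using closure_of_subset[of "schubert_cell n w" "zariski n k"] schubert_cell_subset_IG[OF assms(2)]
      by (simp add: topspace_zariski)
  next
    case False
    obtain a b v' where s: "admissible n k v'" "1 \<le> a" "a < b" "b \<in> v'" "a \<notin> v'"
      "v = reflect n a b ` v'" "bruhat_le v' w" "\<Sum>v < \<Sum>v'"
      using bruhat_step[OF less.prems(1,2,3) False] .
    have "\<Sum>v' \<le> \<Sum>{1..2*n+1}" using s(1) by (intro sum_mono2) (auto simp: admissible_def)
    then have "schubert_cell n v' \<subseteq> zariski n k closure_of (schubert_cell n w)" using s by (intro less.hyps assms(2)) auto
    then have "zariski n k closure_of (schubert_cell n v') \<subseteq> zariski n k closure_of (schubert_cell n w)"
      by (metis closure_of_closure_of closure_of_mono)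
    moreover have "schubert_cell n v \<subseteq> zariski n k closure_of (schubert_cell n v')"
      using schubert_cell_reflection_closure[OF s(1) less.prems(1) s(2-6)] by blast
    ultimately show ?thesis by (rule order_trans[rotated])
  qed
qed

subsection \<open>Incidence along rational curves\<close>

text \<open>A minor whose columns may be unsorted or repeated, as happens when one column of a
  sorted list is replaced.\<close>

definition cols_det :: "nat \<Rightarrow> (nat \<Rightarrow> nat \<Rightarrow> complex) \<Rightarrow> (nat \<Rightarrow> nat) \<Rightarrow> complex" where
  "cols_det k u \<sigma> = det (mat k k (\<lambda>(a, b). u a (\<sigma> b)))"

lemma pluecker_cols_det:
  "I \<subseteq> {1..2*n+1} \<Longrightarrow> card I = k \<Longrightarrow> pluecker n k u I = cols_det k u (nth_elem I)"
  by (simp add: pluecker_def cols_det_def)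

text \<open>The factor is the sign of the sorting permutation, or 0 for a repeated column. It is
  chosen before \<open>u\<close>, so that it can serve as a constant for all points of a
  curve.\<close>

lemma cols_det_pluecker:
  assumes "\<sigma> ` {..<k} \<subseteq> {1..2*n+1}"
  shows "\<exists>\<epsilon>. \<forall>u. cols_det k u \<sigma> = \<epsilon> * pluecker n k u (\<sigma> ` {..<k})"
proof (cases "inj_on \<sigma> {..<k}")
  case False
  then obtain a b where ab: "a < k" "b < k" "a \<noteq> b" "\<sigma> a = \<sigma> b" by (auto simp: inj_on_def)
  have "cols_det k u \<sigma> = 0" for u
    unfolding cols_det_def
    by (rule det_identical_columns[OF _ ab(3,1,2)]) (use ab in \<open>auto intro!: eq_vecI\<close>)
  then show ?thesis by (intro exI[of _ 0]) simp
next
  case True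
  define S where "S = \<sigma> ` {..<k}"
  have S: "finite S" "card S = k" using card_image[OF True] by (auto simp: S_def)
  define \<pi> where "\<pi> b = (if b < k then inv_into {..<k} (nth_elem S) (\<sigma> b) else b)" for b
  have inj: "inj_on (nth_elem S) {..<k}" using nth_elem_inj[of S] S by simp
  have im: "nth_elem S ` {..<k} = S" using nth_elem_image[OF S(1)] S by simp
  have L: "nth_elem S (\<pi> b) = \<sigma> b" "\<pi> b < k" if "b < k" for b
  proof -
    have "\<sigma> b \<in> nth_elem S ` {..<k}" using that im by (auto simp: S_def)
    from f_inv_into_f[OF this] inv_into_into[OF this] that
    show "nth_elem S (\<pi> b) = \<sigma> b" "\<pi> b < k" by (auto simp: \<pi>_def)
  qed
  have "\<pi> permutes {0..<k}"
  proof (rule bij_imp_permutes)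
    have "inj_on \<pi> {0..<k}"
      using True L by (auto simp: inj_on_def) (metis lessThan_iff)
    moreover have "\<pi> ` {0..<k} \<subseteq> {0..<k}" using L by auto
    ultimately show "bij_betw \<pi> {0..<k} {0..<k}"
      by (simp add: bij_betw_def endo_inj_surj)
  qed (auto simp: \<pi>_def)
  have "cols_det k u \<sigma> = signof \<pi> * pluecker n k u S" for u
  proof -
    let ?A = "mat k k (\<lambda>(b, a). u a (nth_elem S b))"
    have A: "?A \<in> carrier_mat k k" by simp
    have "det (mat k k (\<lambda>(i, j). ?A $$ (\<pi> i, j))) = signof \<pi> * det ?A"
      by (rule det_permute_rows[OF A \<open>\<pi> permutes {0..<k}\<close>])
    moreover have "mat k k (\<lambda>(i, j). ?A $$ (\<pi> i, j)) = transpose_mat (mat k k (\<lambda>(a, b). u a (\<sigma> b)))"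
      by (rule eq_matI) (auto simp: L)
    moreover have "?A = transpose_mat (mat k k (\<lambda>(a, b). u a (nth_elem S b)))"
      by (rule eq_matI) auto
    ultimately show ?thesis
      using assms S unfolding S_def[symmetric]
      by (simp add: pluecker_cols_det cols_det_def det_transpose[of _ k])
  qed
  then show ?thesis unfolding S_def by blast
qed

text \<open>The entries of the second matrix are those of the product of the adjugate of the columns
  \<open>J\<close> with the columns \<open>I\<close>, by Cramer's rule.\<close>

lemma cols_det_exchange:
  assumes "cols_det k u J \<noteq> 0"
  shows "cols_det k u J * det (mat k k (\<lambda>(a, b). cols_det k u (J(a := I b)))) = cols_det k u J ^ k * cols_det k u I"
proof -
  define P where "P = mat k k (\<lambda>(a, b). u a (J b))"
  define L where "L = mat k k (\<lambda>(a, b). u a (I b))"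
  have P: "P \<in> carrier_mat k k" and L: "L \<in> carrier_mat k k" by (auto simp: P_def L_def)
  define X where "X = adj_mat P * L"
  have adj: "adj_mat P \<in> carrier_mat k k" by (rule adj_mat[OF P])
  have X: "X \<in> carrier_mat k k" using adj L by (auto simp: X_def)
  have dP: "det P = cols_det k u J" by (simp add: P_def cols_det_def)
  have PX: "P * X = det P \<cdot>\<^sub>m L"
  proof -
    have "P * X = (det P \<cdot>\<^sub>m 1\<^sub>m k) * L"
      unfolding X_def adj_mat(2)[OF P, symmetric] by (rule assoc_mult_mat[OF P adj L, symmetric])
    also have "\<dots> = det P \<cdot>\<^sub>m (1\<^sub>m k * L)" using L by (intro mult_smult_assoc_mat) auto
    finally show ?thesis using L by simp
  qed
  have "cols_det k u (J(a := I b)) = X $$ (a, b)" if ab: "a < k" "b < k" for a b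
  proof -
    have d: "det P \<noteq> 0" using assms dP by simp
    define x where "x = inverse (det P) \<cdot>\<^sub>v col X b"
    have x: "x \<in> carrier_vec k" using X ab by (simp add: x_def)
    have "P *\<^sub>v x = inverse (det P) \<cdot>\<^sub>v (P *\<^sub>v col X b)"
      unfolding x_def using P X ab by (intro mult_mat_vec) auto
    also have "P *\<^sub>v col X b = col (P * X) b" using P X ab by simp
    also have "col (P * X) b = det P \<cdot>\<^sub>v col L b" unfolding PX using L ab by (intro eq_vecI) auto
    also have "inverse (det P) \<cdot>\<^sub>v (det P \<cdot>\<^sub>v col L b) = col L b"
      using d by (simp add: smult_smult_assoc)
    finally have "det (replace_col P (col L b) a) = x $ a * det P"
      using cramer_lemma_mat[OF P x ab(1)] by simp
    also have "\<dots> = X $$ (a, b)" using X ab d by (simp add: x_def)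
    finally have "det (replace_col P (col L b) a) = X $$ (a, b)" .
    moreover have "replace_col P (col L b) a = mat k k (\<lambda>(c, d). u c ((J(a := I b)) d))"
      using ab by (intro eq_matI) (auto simp: replace_col_def P_def L_def)
    ultimately show ?thesis by (simp add: cols_det_def)
  qed
  then have "mat k k (\<lambda>(a, b). cols_det k u (J(a := I b))) = X"
    using X by (intro eq_matI) auto
  moreover have "det P * det X = det P ^ k * det L"
    using arg_cong[OF PX, of det] det_mult[OF P X] L by simp
  ultimately show ?thesis by (simp add: dP) (simp add: L_def cols_det_def)
qed

text \<open>
  Among the coordinates not vanishing at 0 choose \<open>J\<close> with as many elements above \<open>i\<close> as possible.
  Replacing an element of \<open>J\<close> up to \<open>i\<close> by an element of \<open>I\<close> above \<open>i\<close> gives a coordinate that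
  vanishes at 0.  By the exchange identity, \<open>H I\<close> has a zero of order exceeding its degree.
\<close>

theorem vanishing_along_line:
  fixes H :: "nat set \<Rightarrow> complex poly"
  assumes k: "1 \<le> k" and deg: "\<And>I. degree (H I) \<le> e"
    and H: "\<And>t. \<exists>u c. \<forall>I. poly (H I) t = c * pluecker n k u I"
    and van0: "\<And>I. m < count_above I i \<Longrightarrow> poly (H I) 0 = 0" and nz: "\<exists>I. poly (H I) 0 \<noteq> 0"
    and I: "m + e < count_above I i"
  shows "H I = 0"
proof (cases "I \<subseteq> {1..2*n+1} \<and> card I = k")
  case False
  have "poly (H I) t = 0" for t
  proof -
    obtain u c where "\<forall>I. poly (H I) t = c * pluecker n k u I" using H by blast
    then show ?thesis using False by (auto simp: pluecker_def)
  qed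
  then show ?thesis using poly_all_0_iff_0 by blast
next
  case True
  have valid: "J \<subseteq> {1..2*n+1} \<and> card J = k" if "poly (H J) t \<noteq> 0" for J t
  proof -
    obtain u c where "\<forall>I. poly (H I) t = c * pluecker n k u I" using H by blast
    then show ?thesis using that by (auto simp: pluecker_def split: if_splits)
  qed
  define A where "A = {J. poly (H J) 0 \<noteq> 0}"
  have "A \<subseteq> Pow {1..2*n+1}" using valid unfolding A_def by blast
  then have finA: "finite A" by (rule finite_subset) simp
  have "A \<noteq> {}" using nz by (auto simp: A_def)
  define a0 where "a0 = Max ((\<lambda>J. count_above J i) ` A)"
  have "a0 \<in> (\<lambda>J. count_above J i) ` A" unfolding a0_def using finA \<open>A \<noteq> {}\<close> by (intro Max_in) auto
  then obtain J where J: "J \<in> A" "count_above J i = a0" by auto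
  have maxA: "count_above S i \<le> a0" if "S \<in> A" for S unfolding a0_def using finA that by (intro Max_ge) auto
  have JN: "J \<subseteq> {1..2*n+1}" "card J = k" "poly (H J) 0 \<noteq> 0" using J valid by (auto simp: A_def)
  have finJ: "finite J" "finite I" using JN True by (auto intro: finite_subset)
  have a0m: "a0 \<le> m" using van0[of J] JN J(2) by (auto simp: not_le[symmetric])
  have imJ: "nth_elem J ` {..<k} = J" and imI: "nth_elem I ` {..<k} = I"
    using nth_elem_image[OF finJ(1)] nth_elem_image[OF finJ(2)] JN True by auto
  have "\<exists>\<epsilon>. \<forall>u. \<sigma> ` {..<k} \<subseteq> {1..2*n+1} \<longrightarrow> cols_det k u \<sigma> = \<epsilon> * pluecker n k u (\<sigma> ` {..<k})" for \<sigma>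
    using cols_det_pluecker[of \<sigma> k n] by (cases "\<sigma> ` {..<k} \<subseteq> {1..2*n+1}") auto
  then obtain \<epsilon> where \<epsilon>: "\<And>\<sigma> u. \<sigma> ` {..<k} \<subseteq> {1..2*n+1} \<Longrightarrow> cols_det k u \<sigma> = \<epsilon> \<sigma> * pluecker n k u (\<sigma> ` {..<k})"
    by metis
  define \<sigma> where "\<sigma> a b = (nth_elem J)(a := nth_elem I b)" for a b
  have \<sigma>im: "\<sigma> a b ` {..<k} \<subseteq> {1..2*n+1}" if "a < k" "b < k" for a b
  proof -
    have "nth_elem I b \<in> {1..2*n+1}" using nth_elem_in[OF finJ(2), of b] True that by blast
    moreover have "nth_elem J c \<in> {1..2*n+1}" if "c < k" for c
      using nth_elem_in[OF finJ(1), of c] JN that by blast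
    ultimately show ?thesis by (auto simp: \<sigma>_def)
  qed
  define G where "G a b = smult (\<epsilon> (\<sigma> a b)) (H (\<sigma> a b ` {..<k}))" for a b
  define D where "D = det (mat k k (\<lambda>(a, b). G a b))"
  have "poly (H J * D) t = poly (H J ^ k * H I) t" for t
  proof -
    obtain u c where uc: "\<And>I. poly (H I) t = c * pluecker n k u I" using H by blast
    have HJ: "poly (H J) t = c * cols_det k u (nth_elem J)" and HI: "poly (H I) t = c * cols_det k u (nth_elem I)"
      using uc pluecker_cols_det JN True by auto
    show ?thesis
    proof (cases "cols_det k u (nth_elem J) = 0")
      case True
      \<comment> \<open>Both sides vanish, the right one because the exponent \<open>k\<close> is
        positive.\<close>
      then show ?thesis using HJ k by simp
    next
      case False
      have "poly D t = det (mat k k (\<lambda>(a, b). poly (G a b) t))" unfolding D_def by (rule poly_det_eval)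
      also have "mat k k (\<lambda>(a, b). poly (G a b) t) = c \<cdot>\<^sub>m mat k k (\<lambda>(a, b). cols_det k u (\<sigma> a b))"
        by (rule eq_matI) (auto simp: G_def uc \<epsilon>[OF \<sigma>im])
      also have "det \<dots> = c ^ k * det (mat k k (\<lambda>(a, b). cols_det k u (\<sigma> a b)))" by simp
      finally have "poly (H J * D) t = c ^ Suc k *
          (cols_det k u (nth_elem J) * det (mat k k (\<lambda>(a, b). cols_det k u (\<sigma> a b))))"
        by (simp add: HJ)
      also have "\<dots> = c ^ Suc k * (cols_det k u (nth_elem J) ^ k * cols_det k u (nth_elem I))"
        unfolding \<sigma>_def cols_det_exchange[OF False] ..
      finally show ?thesis by (simp add: HJ HI power_mult_distrib)
    qed
  qed
  then have eq: "H J * D = H J ^ k * H I" using poly_eq_poly_eq_iff by blast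
  define R where "R = {a \<in> {0..<k}. nth_elem J a \<le> i}"
  define S where "S = {b. b < k \<and> i < nth_elem I b}"
  have cR: "card R = k - a0" unfolding R_def using card_nth_elem_le[OF finJ(1) JN(2)] J(2) by simp
  have cS: "card S = count_above I i" using count_above_nth_elem[OF finJ(2), of i] True by (simp add: S_def)
  have "[:0, 1:] dvd G a b" if "a \<in> R" "b \<in> S" for a b
  proof -
    let ?T = "\<sigma> a b ` {..<k}"
    have ab: "a < k" "b < k" "nth_elem J a \<le> i" "i < nth_elem I b" using that by (auto simp: R_def S_def)
    have "poly (H ?T) 0 = 0"
    proof (rule ccontr)
      assume "poly (H ?T) 0 \<noteq> 0"
      then have T: "?T \<in> A" "card ?T = k" using valid by (auto simp: A_def)
      then have inj: "inj_on (\<sigma> a b) {..<k}" by (intro eq_card_imp_inj_on) auto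
      have "nth_elem I b \<notin> J \<inter> {i<..}"
      proof
        assume "nth_elem I b \<in> J \<inter> {i<..}"
        then obtain c where c: "c < k" "nth_elem J c = nth_elem I b" using imJ by (metis IntD1 imageE lessThan_iff)
        then have "c \<noteq> a" using ab by auto
        then have "\<sigma> a b c = \<sigma> a b a" using c by (simp add: \<sigma>_def)
        then show False using inj c ab \<open>c \<noteq> a\<close> by (auto simp: inj_on_def)
      qed
      moreover have "insert (nth_elem I b) (J \<inter> {i<..}) \<subseteq> ?T \<inter> {i<..}"
      proof
        fix x assume x: "x \<in> insert (nth_elem I b) (J \<inter> {i<..})"
        show "x \<in> ?T \<inter> {i<..}"
        proof (cases "x = nth_elem I b")
          case True
          then have "x = \<sigma> a b a" by (simp add: \<sigma>_def)
          then show ?thesis using ab True by auto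
        next
          case False
          then have xJ: "x \<in> J" "i < x" using x by auto
          then obtain c where c: "c < k" "x = nth_elem J c" using imJ by (metis imageE lessThan_iff)
          then have "c \<noteq> a" using xJ ab by auto
          then have "x = \<sigma> a b c" using c by (simp add: \<sigma>_def)
          then show ?thesis using c xJ by auto
        qed
      qed
      ultimately have "Suc (count_above J i) \<le> count_above ?T i"
        unfolding count_above_def using finJ card_mono[of "?T \<inter> {i<..}" "insert (nth_elem I b) (J \<inter> {i<..})"] by simp
      then show False using maxA[OF T(1)] J(2) by simp
    qed
    then have "poly (G a b) 0 = 0" by (simp add: G_def)
    then show ?thesis by (simp add: poly_eq_0_iff_dvd)
  qed
  then have "[:0, 1:] ^ (card R + card S - k) dvd D" unfolding D_def
    by (intro det_dvd_block) (auto simp: R_def S_def)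
  moreover have "a0 \<le> k" using count_above_le_card[OF finJ(1), of i] J(2) JN by simp
  \<comment> \<open>The exponent is \<open>count_above I i - a0\<close>, which exceeds
    \<open>e\<close> because \<open>a0 \<le> m\<close>.\<close>
  then have "Suc e \<le> card R + card S - k" using cR cS I a0m by linarith
  ultimately have "[:0, 1:] ^ Suc e dvd D" by (meson le_imp_power_dvd dvd_trans)
  then have dvd: "[:0, 1:] ^ Suc e dvd H J ^ k * H I" unfolding eq[symmetric] by (rule dvd_mult)
  show ?thesis
  proof (rule ccontr)
    assume nz: "H I \<noteq> 0"
    have HJ0: "H J ^ k \<noteq> 0" "poly (H J ^ k) 0 \<noteq> 0" using JN(3) by auto
    have nz2: "H J ^ k * H I \<noteq> 0" using HJ0(1) nz by (rule no_zero_divisors)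
    have "Suc e \<le> order 0 (H J ^ k * H I)"
      using dvd order_divides[of 0 "Suc e" "H J ^ k * H I", unfolded minus_zero] nz2 by blast
    also have "\<dots> = order 0 (H J ^ k) + order 0 (H I)" using nz2 by (rule order_mult)
    also have "order 0 (H J ^ k) = 0" using HJ0 order_root by blast
    also have "0 + order 0 (H I) \<le> e" using order_degree[OF nz, of 0] deg[of I] by simp
    finally show False by simp
  qed
qed

section \<open>From one rational curve to a tree of them\<close>

lemma binary_form_scale: "binary_form e p (c * s, c * t) = c ^ e * binary_form e p (s, t)"
proof -
  have "coeff p i * (c * s) ^ i * (c * t) ^ (e - i) = c ^ e * (coeff p i * s ^ i * t ^ (e - i))" if "i \<le> e" for i
  proof -
    have "c ^ e = c ^ i * c ^ (e - i)" using that by (simp add: power_add[symmetric])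
    then show ?thesis by (simp add: power_mult_distrib)
  qed
  then show ?thesis unfolding binary_form_def prod.case sum_distrib_left by (intro sum.cong) auto
qed

lemma P1_coords:
  assumes "(s, t) \<noteq> (0, 0)"
  obtains c x where "(s, t) = (c * fst (hom_coords x), c * snd (hom_coords x))"
proof (cases "t = 0")
  case True
  then show thesis using that[of s None] by simp
next
  case False
  then show thesis using that[of t "Some (s / t)"] by simp
qed

text \<open>The working form of the estimate dim (V \<inter> V') \<ge> k - e. Along an affine line
  joining the homogeneous coordinates of \<open>x\<close> and \<open>y\<close>, the Pluecker
  coordinates become polynomials of degree at most \<open>e\<close>.\<close>

theorem minors_vanish_P1_morphism:
  assumes f: "P1_morphism n k e f" and k: "1 \<le> k" and van: "minors_vanish n k (f x) i m"
  shows "minors_vanish n k (f y) i (m + e)"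
proof (cases "x = y")
  case True
  then show ?thesis using van by (auto intro: minors_vanish_mono)
next
  case False
  obtain p where p: "\<And>x. f x \<in> IG n k"
    "\<And>x. \<exists>u\<in>ordered_bases k (f x). \<forall>I. pluecker n k u I = binary_form e (p I) (hom_coords x)"
    using f by (auto simp: P1_morphism_def)
  obtain x1 x2 where X: "hom_coords x = (x1, x2)" by fastforce
  obtain y1 y2 where Y: "hom_coords y = (y1, y2)" by fastforce
  \<comment> \<open>the restriction to the affine line with \<open>x\<close> at 0 and \<open>y\<close> at 1, which misses the origin\<close>
  define H where "H I = (\<Sum>j\<le>e. smult (coeff (p I) j) ([:x1, y1 - x1:] ^ j * [:x2, y2 - x2:] ^ (e - j)))" for I
  have Ht: "poly (H I) t = binary_form e (p I) (x1 + t * (y1 - x1), x2 + t * (y2 - x2))" for I t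
    by (simp add: H_def binary_form_def poly_sum poly_power mult.assoc)
  have deg: "degree (H I) \<le> e" for I
    unfolding H_def
  proof (rule degree_sum_le)
    fix j assume j: "j \<in> {..e}"
    have "degree ([:x1, y1 - x1:] ^ j * [:x2, y2 - x2:] ^ (e - j)) \<le> 1 * j + 1 * (e - j)"
      by (intro order_trans[OF degree_mult_le] add_mono order_trans[OF degree_power_le] mult_right_mono) auto
    with j show "degree (smult (coeff (p I) j) ([:x1, y1 - x1:] ^ j * [:x2, y2 - x2:] ^ (e - j))) \<le> e"
      using degree_smult_le order_trans by fastforce
  qed simp
  have pl: "\<exists>u c. \<forall>I. poly (H I) t = c * pluecker n k u I" for t
  proof -
    have "(x1 + t * (y1 - x1), x2 + t * (y2 - x2)) \<noteq> (0, 0)"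
      using False X Y by (cases x; cases y) (auto simp: algebra_simps)
    then obtain c z where z: "(x1 + t * (y1 - x1), x2 + t * (y2 - x2)) = (c * fst (hom_coords z), c * snd (hom_coords z))"
      by (rule P1_coords)
    obtain u where u: "\<And>I. pluecker n k u I = binary_form e (p I) (hom_coords z)" using p(2)[of z] by auto
    have "poly (H I) t = c ^ e * pluecker n k u I" for I
      unfolding Ht z u binary_form_scale by simp
    then show ?thesis by blast
  qed
  obtain ux where ux: "ux \<in> ordered_bases k (f x)" "\<And>I. pluecker n k ux I = binary_form e (p I) (hom_coords x)"
    using p(2)[of x] by auto
  obtain uy where uy: "uy \<in> ordered_bases k (f y)" "\<And>I. pluecker n k uy I = binary_form e (p I) (hom_coords y)"
    using p(2)[of y] by auto
  have H0: "poly (H I) 0 = pluecker n k ux I" and H1: "poly (H I) 1 = pluecker n k uy I" for I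
    using ux(2) uy(2) by (simp_all add: Ht X Y)
  obtain v I0 where "v \<in> ordered_bases k (f x)" "pluecker n k v I0 \<noteq> 0" using IG_ordered_basis[OF p(1)] .
  then have nz: "\<exists>I. poly (H I) 0 \<noteq> 0" using pluecker_nonzero_iff[OF _ ux(1)] H0 by metis
  have "H I = 0" if "m + e < count_above I i" for I
    using van ux(1) by (intro vanishing_along_line[OF k deg pl _ nz that]) (simp add: H0 minors_vanish_def)
  then have "pluecker n k uy I = 0" if "m + e < count_above I i" for I using H1[of I] that by simp
  then show ?thesis unfolding minors_vanish_def using pluecker_nonzero_iff[OF uy(1)] by metis
qed

text \<open>The condition spreads from the component of the first mark. Take a largest set of
  components on which it holds with the total degree of the set as loss. If a component is missing,
  connectedness gives an edge leaving the set, and the node hands the condition over at the cost of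
  one more degree term.\<close>

theorem minors_vanish_stable_map:
  assumes m: "m \<in> stable_maps n k d" and k: "1 \<le> k" and van: "minors_vanish n k (ev1 m) i a"
  shows "minors_vanish n k (ev2 m) i (a + d)"
proof -
  define comps where "comps = sm_comps m"
  define v0 where "v0 = fst (sm_mark1 m)"
  have fin: "finite comps" and adj: "sm_adj m \<subseteq> comps \<times> comps"
    and con: "\<And>v v'. v \<in> comps \<Longrightarrow> v' \<in> comps \<Longrightarrow> (v, v') \<in> (sm_adj m)\<^sup>*"
    and marks: "v0 \<in> comps" "fst (sm_mark2 m) \<in> comps"
    and mor: "\<And>v. v \<in> comps \<Longrightarrow> P1_morphism n k (sm_deg m v) (sm_map m v)"
    and glue: "\<And>v v'. (v, v') \<in> sm_adj m \<Longrightarrow> sm_map m v (sm_node m v v') = sm_map m v' (sm_node m v' v)"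
    and deg: "(\<Sum>v\<in>comps. sm_deg m v) = d"
    using m by (auto simp: stable_maps_def prestable_curve_def comps_def v0_def)
  define good where "good S \<longleftrightarrow> v0 \<in> S \<and> S \<subseteq> comps \<and>
    (\<forall>v\<in>S. \<forall>y. minors_vanish n k (sm_map m v y) i (a + (\<Sum>v\<in>S. sm_deg m v)))" for S
  have good0: "good {v0}"
    using marks(1) minors_vanish_P1_morphism[OF mor[OF marks(1)] k, of "snd (sm_mark1 m)"] van
    by (auto simp: good_def ev1_def v0_def)
  have "{S. good S} \<subseteq> Pow comps" by (auto simp: good_def)
  then have fing: "finite (card ` {S. good S})" using fin by (meson finite_Pow_iff finite_imageI finite_subset)
  have "Max (card ` {S. good S}) \<in> card ` {S. good S}" using good0 by (intro Max_in[OF fing]) auto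
  then obtain S where S: "good S" "card S = Max (card ` {S. good S})" by auto
  have maxS: "card S' \<le> card S" if "good S'" for S' unfolding S(2) using that by (intro Max_ge[OF fing]) auto
  have finS: "finite S" using S(1) fin by (auto simp: good_def intro: finite_subset)
  have "S = comps"
  proof (rule ccontr)
    assume "S \<noteq> comps"
    then obtain w where w: "w \<in> comps" "w \<notin> S" using S(1) by (auto simp: good_def)
    have "\<exists>v v'. (v, v') \<in> sm_adj m \<and> v \<in> S \<and> v' \<notin> S"
    proof (rule ccontr)
      assume no: "\<not> ?thesis"
      have "(v0, w) \<in> (sm_adj m)\<^sup>*" using con marks(1) w(1) by blast
      then have "w \<in> S" by (induction rule: rtrancl_induct) (use no S(1) in \<open>auto simp: good_def\<close>)
      with w(2) show False by simp
    qed
    then obtain v v' where e: "(v, v') \<in> sm_adj m" "v \<in> S" "v' \<notin> S" by auto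
    have v': "v' \<in> comps" using e(1) adj by auto
    let ?s = "\<Sum>v\<in>S. sm_deg m v"
    have s: "(\<Sum>v\<in>insert v' S. sm_deg m v) = ?s + sm_deg m v'" using finS e(3) by simp
    have "minors_vanish n k (sm_map m v' (sm_node m v' v)) i (a + ?s)"
      using S(1) e(2) unfolding good_def glue[OF e(1), symmetric] by blast
    then have "minors_vanish n k (sm_map m v' y) i (a + ?s + sm_deg m v')" for y
      by (rule minors_vanish_P1_morphism[OF mor[OF v'] k])
    moreover have "minors_vanish n k (sm_map m v y) i (a + ?s + sm_deg m v')" if "v \<in> S" for v y
      by (rule minors_vanish_mono[of n k _ i "a + ?s"]) (use S(1) that in \<open>auto simp: good_def\<close>)
    ultimately have "good (insert v' S)" unfolding good_def s
      using S(1) v' by (auto simp: good_def add.assoc)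
    then show False using maxS[of "insert v' S"] finS e(3) by simp
  qed
  then show ?thesis using S(1) marks(2) deg unfolding good_def ev2_def by auto
qed

subsection \<open>Borel orbits\<close>

lemma mat_act_linear: "Vector_Spaces.linear cscale cscale (mat_act n A)"
  unfolding Vector_Spaces.linear_iff
  by (intro conjI cvs.vector_space_axioms)
    (auto simp: mat_act_def fun_eq_iff sum.distrib[symmetric] sum_distrib_left algebra_simps)

lemma mat_act_E: "mat_act n A x \<in> E n"
  by (auto simp: mat_act_def E_iff)

lemma mat_act_basis:
  assumes "1 \<le> j" "j \<le> 2*n+1"
  shows "mat_act n A (basis_vec j) = (\<lambda>i. if i \<in> {1..2*n+1} then A $$ (i - 1, j - 1) else 0)"
proof
  fix i
  have "(\<Sum>l=1..2*n+1. A $$ (i - 1, l - 1) * basis_vec j l) = (\<Sum>l=1..2*n+1. if l = j then A $$ (i - 1, l - 1) else 0)"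
    by (rule sum.cong) (auto simp: basis_vec_def)
  then show "mat_act n A (basis_vec j) i = (if i \<in> {1..2*n+1} then A $$ (i - 1, j - 1) else 0)"
    using assms by (simp add: mat_act_def)
qed

text \<open>By \<open>unipotent_lead\<close> the matrix is upper unitriangular, so it has
  determinant 1 and its adjugate is its inverse.\<close>

lemma unipotent_borel:
  assumes g: "g \<in> unipotent n"
  shows "\<exists>A\<in>borel_Sp n. \<forall>x\<in>E n. mat_act n A x = g x"
proof -
  define N where "N = 2*n+1"
  define A where "A = mat N N (\<lambda>(i, j). g (basis_vec (j + 1)) (i + 1))"
  have A: "A \<in> carrier_mat N N" by (simp add: A_def)
  have act: "mat_act n A x = g x" if x: "x \<in> E n" for x
  proof
    fix i
    have gx: "g x = (\<Sum>j=1..N. cscale (x j) (g (basis_vec j)))"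
    proof -
      have "x = (\<Sum>j\<in>{1..N}. cscale (x j) (basis_vec j))"
        using x by (intro expand_basis) (auto simp: E_iff N_def)
      then have "g x = g (\<Sum>j\<in>{1..N}. cscale (x j) (basis_vec j))" by (rule arg_cong)
      then show ?thesis
        by (simp only: cvp.linear_sum[OF unipotent_linear[OF g]] cvp.linear_scale[OF unipotent_linear[OF g]])
    qed
    show "mat_act n A x i = g x i"
    proof (cases "i \<in> {1..N}")
      case True
      have "mat_act n A x i = (\<Sum>j=1..N. A $$ (i - 1, j - 1) * x j)" using True by (simp add: mat_act_def N_def)
      also have "\<dots> = (\<Sum>j=1..N. x j * g (basis_vec j) i)" using True by (intro sum.cong) (auto simp: A_def)
      also have "\<dots> = g x i" unfolding gx by (simp add: sum_apply)
      finally show ?thesis .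
    next
      case False
      then show ?thesis using unipotent_E[OF g x] by (auto simp: mat_act_def E_iff N_def)
    qed
  qed
  have entry: "A $$ (i, j) = basis_vec (j + 1) (i + 1)" if "j \<le> i" "i < N" for i j
  proof -
    have "basis_vec (j + 1) \<in> E n" using that by (intro basis_vec_E) (auto simp: N_def)
    then have "g (basis_vec (j + 1)) (i + 1) = basis_vec (j + 1) (i + 1)"
      by (rule unipotent_lead[OF g, of _ "j + 1"]) (use that in \<open>auto simp: basis_vec_def\<close>)
    then show ?thesis using that by (simp add: A_def)
  qed
  have ut: "upper_triangular A" using entry A by (auto simp: basis_vec_def)
  have "det A = (\<Prod>i = 0..<N. A $$ (i, i))"
    using det_upper_triangular[OF ut A] A by (simp add: prod_list_diag_prod)
  also have "\<dots> = 1" using entry by (intro prod.neutral) auto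
  finally have "det A = 1" .
  then have "inverts_mat A (adj_mat A)" "inverts_mat (adj_mat A) A"
    using adj_mat[OF A] A by (auto simp: inverts_mat_def)
  then have "invertible_mat A" using A unfolding invertible_mat_def by auto
  moreover have "omega n (mat_act n A x) (mat_act n A y) = omega n x y" if "x \<in> E n" "y \<in> E n" for x y
    unfolding act[OF that(1)] act[OF that(2)] by (rule unipotent_omega[OF g])
  ultimately have "A \<in> borel_Sp n" using A ut by (auto simp: borel_Sp_def odd_Sp_def N_def)
  then show ?thesis using act by (intro bexI[of _ A]) auto
qed

lemma borel_triangular:
  assumes A: "A \<in> borel_Sp n" and v: "v \<subseteq> {1..2*n+1}"
  shows "triangular_frame v (\<lambda>a. mat_act n A (basis_vec (nth_elem v a)))"
proof -
  have fin: "finite v" using v by (rule finite_subset) simp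
  have Ac: "A \<in> carrier_mat (2*n+1) (2*n+1)" and inv: "invertible_mat A" and ut: "upper_triangular A"
    using A by (auto simp: borel_Sp_def odd_Sp_def)
  obtain B where B: "A * B = 1\<^sub>m (2*n+1)" "B * A = 1\<^sub>m (dim_row B)"
    using inv Ac by (auto simp: invertible_mat_def inverts_mat_def)
  have "dim_row B = 2*n+1" using arg_cong[OF B(2), of dim_col] Ac by simp
  moreover have "dim_col B = 2*n+1" using arg_cong[OF B(1), of dim_col] by simp
  ultimately have Bc: "B \<in> carrier_mat (2*n+1) (2*n+1)" by auto
  have "det A * det B = 1" using arg_cong[OF B(1), of det] det_mult[OF Ac Bc] by simp
  moreover have "det A = (\<Prod>i = 0..<2*n+1. A $$ (i, i))"
    using det_upper_triangular[OF ut Ac] Ac by (simp add: prod_list_diag_prod)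
  ultimately have "(\<Prod>i = 0..<2*n+1. A $$ (i, i)) \<noteq> 0" by (metis mult_zero_left zero_neq_one)
  then have diag: "A $$ (i, i) \<noteq> 0" if "i < 2*n+1" for i
    using that prod_zero[of "{0..<2*n+1}" "\<lambda>i. A $$ (i, i)"] by (metis atLeastLessThan_iff finite_atLeastLessThan zero_le)
  have "mat_act n A (basis_vec j) j \<noteq> 0 \<and> (\<forall>i>j. mat_act n A (basis_vec j) i = 0)" if "j \<in> v" for j
  proof -
    have j: "1 \<le> j" "j \<le> 2*n+1" using that v by auto
    have "A $$ (i - 1, j - 1) = 0" if "j < i" "i \<le> 2*n+1" for i
      using that j ut Ac by (intro upper_triangularD[OF ut]) auto
    then show ?thesis unfolding mat_act_basis[OF j] using j diag[of "j - 1"] by auto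
  qed
  then show ?thesis using nth_elem_in[OF fin] by (auto simp: triangular_frame_def)
qed

text \<open>A Borel translate has a triangular frame with pivots \<open>v\<close> and lies in the
  cell of some \<open>v'\<close>. Both the coordinates \<open>v\<close> and \<open>v'\<close> are
  nonzero on it, and each then bounds the other in the Bruhat order.\<close>

theorem borel_orbit:
  assumes v: "admissible n k v"
  shows "(\<lambda>A. mat_act n A ` coord_space v) ` borel_Sp n = schubert_cell n v"
proof (intro subset_antisym subsetI)
  have vN: "v \<subseteq> {1..2*n+1}" "card v = k" using v by (auto simp: admissible_def)
  have fin: "finite v" using v by (rule admissible_finite)
  fix V assume "V \<in> schubert_cell n v"
  then obtain g where g: "g \<in> unipotent n" "V = g ` coord_space v" by (auto simp: schubert_cell_def)
  obtain A where A: "A \<in> borel_Sp n" "\<forall>x\<in>E n. mat_act n A x = g x"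
    using unipotent_borel[OF g(1)] by auto
  have "mat_act n A ` coord_space v = V" unfolding g(2)
    using coord_space_E[OF vN(1)] A(2) by (intro image_cong) auto
  then show "V \<in> (\<lambda>A. mat_act n A ` coord_space v) ` borel_Sp n" using A(1) by blast
next
  have vN: "v \<subseteq> {1..2*n+1}" "card v = k" using v by (auto simp: admissible_def)
  have fin: "finite v" using v by (rule admissible_finite)
  fix V assume "V \<in> (\<lambda>A. mat_act n A ` coord_space v) ` borel_Sp n"
  then obtain A where A: "A \<in> borel_Sp n" "V = mat_act n A ` coord_space v" by auto
  define u where "u a = mat_act n A (basis_vec (nth_elem v a))" for a
  have tu: "triangular_frame v u" unfolding u_def by (rule borel_triangular[OF A(1) vN(1)])
  have ob: "u \<in> ordered_bases k V"
    using triangular_frame_ordered_bases[OF vN(1) tu] linear_coord_space[OF mat_act_linear fin, of n A]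
    unfolding u_def A(2) vN(2) by simp
  have om: "omega n (mat_act n A x) (mat_act n A y) = omega n x y" if "x \<in> E n" "y \<in> E n" for x y
    using A(1) that by (auto simp: borel_Sp_def odd_Sp_def)
  have "V \<in> IG n k" unfolding IG_def mem_Collect_eq
  proof (intro conjI ballI)
    show "cvs.subspace V" unfolding A(2) coord_space_def
      using mat_act_linear by (rule cvp.linear_subspace_image) simp
    show "V \<subseteq> E n" unfolding A(2) using mat_act_E by auto
    show "cvs.dim V = k" by (rule ordered_bases_dim[OF ob])
    fix x y assume "x \<in> V" "y \<in> V"
    then obtain x' y' where xy: "x' \<in> coord_space v" "y' \<in> coord_space v" "x = mat_act n A x'" "y = mat_act n A y'"
      unfolding A(2) by auto
    have "omega n x y = omega n x' y'"
      unfolding xy(3,4) by (intro om subsetD[OF coord_space_E[OF vN(1)]] xy)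
    then show "omega n x y = 0" using coord_space_isotropic[OF v xy(1,2)] by simp
  qed
  then obtain v' where v': "admissible n k v'" "V \<in> schubert_cell n v'" using IG_schubert_cell by metis
  obtain u' where u': "u' \<in> ordered_bases k V" "triangular_frame v' u'" using schubert_cell_frame[OF v'] .
  have v'N: "v' \<subseteq> {1..2*n+1}" "card v' = k" "finite v'"
    using v'(1) by (auto simp: admissible_def intro: finite_subset)
  have "pluecker n k u v \<noteq> 0" "pluecker n k u' v' \<noteq> 0"
    using pluecker_triangular_nonzero vN v'N tu u'(2) by auto
  then have "pluecker n k u' v \<noteq> 0" "pluecker n k u v' \<noteq> 0"
    using pluecker_nonzero_iff[OF ob u'(1)] by auto
  then have "bruhat_le v v'" "bruhat_le v' v"
    using pluecker_triangular_le[OF v'N(3,2) u'(2)] pluecker_triangular_le[OF fin vN(2) tu] by auto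
  then have "v = v'" using count_above_inject[OF fin v'N(3) vN(1) v'N(1)] by (auto simp: bruhat_le_def intro: le_antisym)
  then show "V \<in> schubert_cell n v" using v'(2) by simp
qed


subsection \<open>The connecting curve\<close>

lemma IG_memI:
  assumes "u \<in> ordered_bases k V" "\<And>a. a < k \<Longrightarrow> u a \<in> E n"
    "\<And>a b. a < k \<Longrightarrow> b < k \<Longrightarrow> omega n (u a) (u b) = 0"
  shows "V \<in> IG n k"
proof -
  have V: "V = cvs.span (u ` {..<k})" using assms(1) by (auto simp: ordered_bases_def)
  have "V \<subseteq> E n" unfolding V by (rule cvs.span_minimal) (use assms(2) subspace_E in auto)
  moreover have "omega n x y = 0" if "x \<in> V" "y \<in> V" for x y
    by (rule isotropic_span[of "u ` {..<k}"]) (use assms(3) that V in auto)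
  moreover have "cvs.subspace V" unfolding V by simp
  ultimately show ?thesis using ordered_bases_dim[OF assms(1)] by (auto simp: IG_def)
qed

lemma coeff_prod_top:
  fixes q :: "'a \<Rightarrow> 'b :: comm_semiring_1 poly"
  assumes "finite S" "\<And>a. a \<in> S \<Longrightarrow> degree (q a) \<le> \<mu> a"
  shows "degree (\<Prod>a\<in>S. q a) \<le> (\<Sum>a\<in>S. \<mu> a) \<and> coeff (\<Prod>a\<in>S. q a) (\<Sum>a\<in>S. \<mu> a) = (\<Prod>a\<in>S. coeff (q a) (\<mu> a))"
  using assms
proof (induction S rule: finite_induct)
  case (insert x S)
  let ?P = "\<Prod>a\<in>S. q a" and ?s = "\<Sum>a\<in>S. \<mu> a"
  have IH: "degree ?P \<le> ?s" "coeff ?P ?s = (\<Prod>a\<in>S. coeff (q a) (\<mu> a))" and qx: "degree (q x) \<le> \<mu> x"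
    using insert by auto
  have "degree (q x * ?P) \<le> \<mu> x + ?s"
    using degree_mult_le[of "q x" ?P] IH(1) qx by linarith
  moreover have "coeff (q x * ?P) (\<mu> x + ?s) = coeff (q x) (\<mu> x) * coeff ?P ?s"
  proof -
    have "coeff (q x * ?P) (\<mu> x + ?s) = (\<Sum>i\<le>\<mu> x + ?s. coeff (q x) i * coeff ?P (\<mu> x + ?s - i))"
      by (rule coeff_mult)
    also have "\<dots> = (\<Sum>i\<in>{\<mu> x}. coeff (q x) i * coeff ?P (\<mu> x + ?s - i))"
    proof (rule sum.mono_neutral_right)
      show "\<forall>i\<in>{..\<mu> x + ?s} - {\<mu> x}. coeff (q x) i * coeff ?P (\<mu> x + ?s - i) = 0"
      proof
        fix i assume "i \<in> {..\<mu> x + ?s} - {\<mu> x}"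
        then consider "i > \<mu> x" | "\<mu> x + ?s - i > ?s" by fastforce
        then show "coeff (q x) i * coeff ?P (\<mu> x + ?s - i) = 0"
        proof cases
          case 1
          then have "coeff (q x) i = 0" using qx by (intro coeff_eq_0) simp
          then show ?thesis by simp
        next
          case 2
          then have "coeff ?P (\<mu> x + ?s - i) = 0" using IH(1) by (intro coeff_eq_0) simp
          then show ?thesis by simp
        qed
      qed
    qed auto
    finally show ?thesis by simp
  qed
  ultimately show ?case using insert IH by simp
qed simp

lemma coeff_of_int_mult: "coeff (of_int c * p) i = of_int c * coeff (p :: complex poly) i"
  by (simp add: of_int_poly)

text \<open>At [1 : 0] a binary form takes the value of its formal leading coefficient. It is taken
  at the sum of the row bounds, even where the actual degree is smaller.\<close>

lemma det_poly_top:
  fixes q :: "nat \<Rightarrow> nat \<Rightarrow> complex poly"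
  assumes "\<And>a b. a < k \<Longrightarrow> degree (q a b) \<le> \<mu> a"
  shows "degree (det (mat k k (\<lambda>(a, b). q a b))) \<le> (\<Sum>a<k. \<mu> a)"
    and "coeff (det (mat k k (\<lambda>(a, b). q a b))) (\<Sum>a<k. \<mu> a) = det (mat k k (\<lambda>(a, b). coeff (q a b) (\<mu> a)))"
proof -
  have top: "degree (\<Prod>i = 0..<k. q i (p i)) \<le> (\<Sum>a<k. \<mu> a)"
    "coeff (\<Prod>i = 0..<k. q i (p i)) (\<Sum>a<k. \<mu> a) = (\<Prod>i = 0..<k. coeff (q i (p i)) (\<mu> i))" for p
    using coeff_prod_top[of "{0..<k}" "\<lambda>i. q i (p i)" \<mu>] assms by (auto simp: lessThan_atLeast0)
  show "degree (det (mat k k (\<lambda>(a, b). q a b))) \<le> (\<Sum>a<k. \<mu> a)" unfolding det_leibniz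
  proof (rule degree_sum_le)
    show "finite {p. p permutes {0..<k}}" by (rule finite_permutations) simp
    fix p
    have "degree (signof p * (\<Prod>i = 0..<k. q i (p i))) \<le> degree (\<Prod>i = 0..<k. q i (p i))"
      by (simp add: of_int_poly degree_smult_le)
    then show "degree (signof p * (\<Prod>i = 0..<k. q i (p i))) \<le> (\<Sum>a<k. \<mu> a)" using top(1) by (rule order_trans)
  qed
  show "coeff (det (mat k k (\<lambda>(a, b). q a b))) (\<Sum>a<k. \<mu> a) = det (mat k k (\<lambda>(a, b). coeff (q a b) (\<mu> a)))"
    unfolding det_leibniz by (simp add: coeff_sum coeff_of_int_mult top(2))
qed

lemma binary_form_Some:
  assumes "degree p \<le> d"
  shows "binary_form d p (z, 1) = poly p z"
proof -
  have "(\<Sum>i\<le>degree p. coeff p i * z ^ i) = (\<Sum>i\<le>d. coeff p i * z ^ i)"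
    using assms by (intro sum.mono_neutral_left) (auto simp: coeff_eq_0)
  then show ?thesis by (simp add: binary_form_def poly_altdef)
qed

lemma binary_form_None: "binary_form d p (1, 0) = coeff p d"
proof -
  have "(\<Sum>i\<le>d. coeff p i * 1 ^ i * 0 ^ (d - i)) = (\<Sum>i\<in>{d}. coeff p i * 1 ^ i * 0 ^ (d - i))"
    by (rule sum.mono_neutral_right) auto
  then show ?thesis by (simp add: binary_form_def)
qed

text \<open>The dual indices u and bar u meet only inside one vector, where the form vanishes by
  skewness. Between different vectors the admissibility of the two end sets excludes dual indices,
  and the mixed cases reduce to these by injectivity of the bar.\<close>

theorem connecting_curve:
  assumes WD: "admissible n k (W \<union> D)" "W \<inter> D = {}"
    and WL: "admissible n k (W \<union> idx_bar n ` D)" "W \<inter> idx_bar n ` D = {}"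
    and D: "D \<noteq> {}" "card D \<le> d" and g: "g \<in> unipotent n"
  obtains f where "P1_morphism n k d f" "f None = g ` coord_space (W \<union> idx_bar n ` D)"
    "f (Some 0) = g ` coord_space (W \<union> D)"
proof -
  define v where "v = W \<union> D"
  have vN: "v \<subseteq> {1..2*n+1}" "card v = k" "finite v" and vb: "\<And>i. i \<in> v \<Longrightarrow> idx_bar n i \<notin> v"
    using WD(1) admissible_finite[OF WD(1)] by (auto simp: v_def admissible_def)
  have LN: "i \<in> {1..2*n+1}" "idx_bar n i \<notin> W \<union> idx_bar n ` D" if "i \<in> W \<union> idx_bar n ` D" for i
    using WL(1) that unfolding admissible_def by blast+
  have finD: "finite D" using vN(3) by (simp add: v_def)
  obtain u0 where u0: "u0 \<in> D" using D(1) by auto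
  \<comment> \<open>The degrees of the moving vectors have to add up to exactly \<open>d\<close>, so
    \<open>u0\<close> absorbs the surplus over \<open>card D\<close>.\<close>
  define \<mu> where "\<mu> r = (if r \<in> D then if r = u0 then d - card D + 1 else 1 else 0)" for r
  define l where "l r = (if r \<in> D then idx_bar n r else r)" for r
  define L where "L = nth_elem v"
  have Lv: "L a \<in> v" if "a < k" for a unfolding L_def using nth_elem_in[OF vN(3)] that vN(2) by simp
  have Linj: "inj_on L {..<k}" using nth_elem_inj[of v] vN(2) by (simp add: L_def)
  have Lim: "L ` {..<k} = v" using nth_elem_image[OF vN(3)] vN(2) by (simp add: L_def)
  have Lne: "L a \<noteq> L b" if "a < k" "b < k" "a \<noteq> b" for a b using Linj that by (auto simp: inj_on_def)
  have sum\<mu>: "(\<Sum>a<k. \<mu> (L a)) = d"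
  proof -
    have "(\<Sum>a<k. \<mu> (L a)) = (\<Sum>r\<in>v. \<mu> r)" unfolding Lim[symmetric] by (simp add: sum.reindex[OF Linj])
    also have "\<dots> = (\<Sum>r\<in>D. \<mu> r)" by (rule sum.mono_neutral_right[OF vN(3)]) (auto simp: v_def \<mu>_def)
    also have "\<dots> = (\<Sum>r\<in>D - {u0}. \<mu> r) + \<mu> u0" using finD u0 by (simp add: sum.remove)
    also have "(\<Sum>r\<in>D - {u0}. \<mu> r) = card D - 1" using finD u0 by (simp add: \<mu>_def)
    also have "card D - 1 + \<mu> u0 = d"
      using D u0 finD card_gt_0_iff[of D] by (auto simp: \<mu>_def)
    finally show ?thesis .
  qed
  have bb: "idx_bar n (idx_bar n r) = r" if "r \<in> v" for r using that vN(1) by (intro idx_bar_bar) auto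
  have lv: "l r \<notin> v" if "r \<in> D" for r using that vb by (auto simp: l_def v_def)
  have lL: "l r \<in> W \<union> idx_bar n ` D" if "r \<in> v" for r using that by (auto simp: l_def v_def)
  have lN: "1 \<le> l r" "l r \<le> 2*n+1" if "r \<in> v" for r using LN(1)[OF lL[OF that]] by auto
  have rN: "1 \<le> r" "r \<le> 2*n+1" if "r \<in> v" for r using that vN(1) by auto
  have linj: "l r \<noteq> l r'" if r: "r \<in> v" "r' \<in> v" "r \<noteq> r'" for r r'
  proof
    assume eq: "l r = l r'"
    consider "r \<in> D" "r' \<in> D" | "r \<in> D" "r' \<notin> D" | "r \<notin> D" "r' \<in> D" | "r \<notin> D" "r' \<notin> D" by blast
    then show False
    proof cases
      case 1
      then have "idx_bar n r = idx_bar n r'" using eq by (simp add: l_def)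
      then show False using bb[OF r(1)] bb[OF r(2)] r(3) by simp
    qed (use eq r lv[of r] lv[of r'] in \<open>auto simp: l_def\<close>)
  qed
  \<comment> \<open>For \<open>L a\<close> in \<open>W\<close> the exponent is 0 and the vector is \<open>2 e\<^bsub>L a\<^esub>\<close>, also at \<open>s = 0\<close> or \<open>t = 0\<close>.\<close>
  define U where "U = (\<lambda>(s, t) a. cscale (s ^ \<mu> (L a)) (basis_vec (l (L a))) + cscale (t ^ \<mu> (L a)) (basis_vec (L a)))"
  define V where "V st = cvs.span (U st ` {..<k})" for st
  have Uob: "U (s, t) \<in> ordered_bases k (V (s, t))" if st: "(s, t) \<noteq> (0, 0)" for s t
    unfolding V_def
  proof (rule ordered_basesI, intro allI impI)
    fix c b assume c: "(\<Sum>a<k. cscale (c a) (U (s, t) a)) = 0" and b: "b < k"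
    have at: "c b * U (s, t) b j = 0" if "\<And>a. a < k \<Longrightarrow> a \<noteq> b \<Longrightarrow> U (s, t) a j = 0" for j
    proof -
      have "(\<Sum>a<k. cscale (c a) (U (s, t) a)) j = (\<Sum>a<k. if a = b then c b * U (s, t) b j else 0)"
        unfolding sum_apply by (rule sum.cong) (use that in auto)
      then show ?thesis using b unfolding c by simp
    qed
    \<comment> \<open>Among the spanning vectors only that of \<open>b\<close> can have entries at
      \<open>L b\<close> and \<open>l (L b)\<close>, so evaluation there isolates the coefficient
      \<open>c b\<close>.\<close>
    have 1: "U (s, t) a (L b) = 0" if "a < k" "a \<noteq> b" for a
      using Lne[OF that(1) b that(2)] lv[of "L a"] Lv[OF b] Lv[OF that(1)]
      by (auto simp: U_def basis_vec_def l_def)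
    have 2: "U (s, t) a (l (L b)) = 0" if "a < k" "a \<noteq> b" for a
      using Lne[OF that(1) b that(2)] linj[OF Lv[OF that(1)] Lv[OF b]] lv[of "L b"] Lv[OF b] Lv[OF that(1)]
      by (auto simp: U_def basis_vec_def l_def)
    consider "L b \<notin> D" | "L b \<in> D" "t \<noteq> 0" | "L b \<in> D" "s \<noteq> 0" using st by auto
    then show "c b = 0"
    proof cases
      case 1
      then have "U (s, t) b (L b) = 2" by (simp add: U_def l_def \<mu>_def)
      then show ?thesis using at[of "L b", OF \<open>\<And>a. a < k \<Longrightarrow> a \<noteq> b \<Longrightarrow> U (s, t) a (L b) = 0\<close>] by simp
    next
      case 2
      have "l (L b) \<noteq> L b" using lv[OF 2(1)] Lv[OF b] by auto
      then have "U (s, t) b (L b) = t ^ \<mu> (L b)" by (simp add: U_def basis_vec_def)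
      then show ?thesis using at[of "L b", OF \<open>\<And>a. a < k \<Longrightarrow> a \<noteq> b \<Longrightarrow> U (s, t) a (L b) = 0\<close>] 2(2) by simp
    next
      case 3
      have "l (L b) \<noteq> L b" using lv[OF 3(1)] Lv[OF b] by auto
      then have "U (s, t) b (l (L b)) = s ^ \<mu> (L b)" by (simp add: U_def basis_vec_def)
      then show ?thesis using at[of "l (L b)", OF \<open>\<And>a. a < k \<Longrightarrow> a \<noteq> b \<Longrightarrow> U (s, t) a (l (L b)) = 0\<close>] 3(2) by simp
    qed
  qed
  have UE: "U (s, t) a \<in> E n" if "a < k" for s t a
    unfolding U_def prod.case using lN[OF Lv[OF that]] rN[OF Lv[OF that]] subspace_E[of n]
    by (intro cvs.subspace_add cvs.subspace_scale basis_vec_E) auto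
  have om: "omega n (basis_vec i) (basis_vec j) = 0" if "1 \<le> i" "i \<le> 2*n+1" "j \<noteq> idx_bar n i" for i j
    using that omega_basis_left[of i n "basis_vec j"] by (auto simp: basis_vec_def[of j])
  have Uiso: "omega n (U (s, t) a) (U (s, t) b) = 0" if ab: "a < k" "b < k" for s t a b
  proof (cases "a = b")
    case True
    then show ?thesis by (simp only: omega_self)
  next
    case False
    define r where "r = L a"
    define r' where "r' = L b"
    have r: "r \<in> v" "r' \<in> v" "r \<noteq> r'" using Lv ab Lne[OF ab False] by (auto simp: r_def r'_def)
    have ne1: "r' \<noteq> idx_bar n r" using vb r by auto
    have ne2: "l r' \<noteq> idx_bar n (l r)" using LN(2)[OF lL[OF r(1)]] lL[OF r(2)] by metis
    have ne3: "l r' \<noteq> idx_bar n r"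
      using ne1 bb[OF r(1)] bb[OF r(2)] r(3) by (auto simp: l_def)
    have ne4: "r' \<noteq> idx_bar n (l r)"
      using ne1 bb[OF r(1)] r(3) by (auto simp: l_def)
    show ?thesis
      unfolding U_def prod.case omega_bilinear r_def[symmetric] r'_def[symmetric]
      using om[OF rN[OF r(1)] ne1] om[OF lN[OF r(1)] ne2] om[OF rN[OF r(1)] ne3] om[OF lN[OF r(1)] ne4]
      by simp
  qed
  define f where "f x = g ` V (hom_coords x)" for x
  have hc: "hom_coords x \<noteq> (0, 0)" for x by (cases x) auto
  have fob: "(\<lambda>a. g (U (hom_coords x) a)) \<in> ordered_bases k (f x)" for x
  proof -
    obtain s t where st: "hom_coords x = (s, t)" by fastforce
    show ?thesis unfolding f_def st using Uob[of s t] hc[of x] st by (intro ordered_bases_unipotent[OF _ g]) simp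
  qed
  have fIG: "f x \<in> IG n k" for x
  proof -
    obtain s t where st: "hom_coords x = (s, t)" by fastforce
    show ?thesis by (rule IG_memI[OF fob]) (use UE Uiso in \<open>auto simp: st unipotent_omega[OF g] unipotent_E[OF g]\<close>)
  qed
  \<comment> \<open>The coordinates of the moving frame at [z : 1] as polynomials in z; the
    coefficient at \<open>\<mu> (L a)\<close> is the coordinate at [1 : 0].\<close>
  define q where "q a i = monom (g (basis_vec (l (L a))) i) (\<mu> (L a)) + [:g (basis_vec (L a)) i:]" for a i
  define P where "P I = (if I \<subseteq> {1..2*n+1} \<and> card I = k then det (mat k k (\<lambda>(a, b). q a (nth_elem I b))) else 0)" for I
  have qdeg: "degree (q a i) \<le> \<mu> (L a)" for a i
    unfolding q_def by (intro degree_add_le) (auto simp: degree_monom_le)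
  have gU: "g (U (s, t) a) i = s ^ \<mu> (L a) * g (basis_vec (l (L a))) i + t ^ \<mu> (L a) * g (basis_vec (L a)) i" for s t a i
    unfolding U_def prod.case cvp.linear_add[OF unipotent_linear[OF g]] cvp.linear_scale[OF unipotent_linear[OF g]] by simp
  have pl: "pluecker n k (\<lambda>a. g (U (hom_coords x) a)) I = binary_form d (P I) (hom_coords x)" for x I
  proof (cases "I \<subseteq> {1..2*n+1} \<and> card I = k")
    case False
    then show ?thesis unfolding pluecker_def if_not_P[OF False] P_def by (auto simp: binary_form_def split: prod.split)
  next
    case True
    have PI: "P I = det (mat k k (\<lambda>(a, b). q a (nth_elem I b)))" unfolding P_def if_P[OF True] ..
    have PL: "pluecker n k (\<lambda>a. g (U st a)) I = det (mat k k (\<lambda>(a, b). g (U st a) (nth_elem I b)))" for st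
      unfolding pluecker_def if_P[OF True] ..
    have top: "degree (P I) \<le> d" "coeff (P I) d = det (mat k k (\<lambda>(a, b). coeff (q a (nth_elem I b)) (\<mu> (L a))))"
      using det_poly_top[of k "\<lambda>a b. q a (nth_elem I b)" "\<lambda>a. \<mu> (L a)"] qdeg unfolding PI sum\<mu> by auto
    show ?thesis
    proof (cases x)
      case None
      have "g (U (1, 0) a) i = coeff (q a i) (\<mu> (L a))" for a i
        unfolding gU q_def by (auto simp: power_0_left coeff_pCons split: nat.split)
      then show ?thesis unfolding None hom_coords.simps binary_form_None top(2) PL by simp
    next
      case (Some z)
      have "g (U (z, 1) a) i = poly (q a i) z" for a i
        unfolding gU q_def by (simp add: poly_monom)
      then show ?thesis unfolding Some hom_coords.simps binary_form_Some[OF top(1)] PL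
        by (simp add: PI poly_det_eval)
    qed
  qed
  have "P1_morphism n k d f" unfolding P1_morphism_def
    by (intro exI[of _ P] allI conjI fIG bexI[OF _ fob] pl)
  moreover have Vs: "V st = coord_space S"
    if "\<And>a. a < k \<Longrightarrow> \<kappa> a \<noteq> 0" "\<And>a. a < k \<Longrightarrow> U st a = cscale (\<kappa> a) (basis_vec (\<sigma> a))"
      "inj_on \<sigma> {..<k}" "\<sigma> ` {..<k} = S" for st S \<kappa> \<sigma>
  proof -
    have "(\<lambda>a. cscale (\<kappa> a) (basis_vec (\<sigma> a))) \<in> ordered_bases k (coord_space S)"
      by (intro ordered_bases_scale ordered_bases_coord that)
    then have "U st \<in> ordered_bases k (coord_space S)" by (rule ordered_bases_cong) (rule that(2))
    then show ?thesis by (auto simp: V_def ordered_bases_def)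
  qed
  have \<mu>0: "\<mu> r = 0 \<longleftrightarrow> r \<notin> D" for r by (auto simp: \<mu>_def)
  have "f None = g ` coord_space (W \<union> idx_bar n ` D)"
  proof -
    have "V (1, 0) = coord_space (W \<union> idx_bar n ` D)"
    proof (rule Vs[of "\<lambda>a. if L a \<in> D then 1 else 2" _ "\<lambda>a. l (L a)"])
      show "U (1, 0) a = cscale (if L a \<in> D then 1 else 2) (basis_vec (l (L a)))" for a
        by (auto simp: U_def power_0_left \<mu>0 l_def fun_eq_iff)
      show "inj_on (\<lambda>a. l (L a)) {..<k}"
        by (rule inj_onI) (use linj Lv Lne in blast)
      have "(\<lambda>a. l (L a)) ` {..<k} = l ` v" unfolding Lim[symmetric] image_image ..
      also have "\<dots> = W \<union> idx_bar n ` D" using WD(2) by (auto simp: v_def l_def)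
      finally show "(\<lambda>a. l (L a)) ` {..<k} = W \<union> idx_bar n ` D" .
    qed auto
    then show ?thesis by (simp add: f_def)
  qed
  moreover have "f (Some 0) = g ` coord_space (W \<union> D)"
  proof -
    have "V (0, 1) = coord_space v"
    proof (rule Vs[of "\<lambda>a. if L a \<in> D then 1 else 2" _ L])
      show "U (0, 1) a = cscale (if L a \<in> D then 1 else 2) (basis_vec (L a))" for a
        by (auto simp: U_def power_0_left \<mu>0 l_def fun_eq_iff)
    qed (use Linj Lim in auto)
    then show ?thesis by (simp add: f_def v_def)
  qed
  ultimately show thesis using that by blast
qed

section \<open>The curve neighborhood between a cell and its closure\<close>

text \<open>Positive degree exempts the only component from the demand for three special points.
  With no edges, the node function is a placeholder.\<close>

lemma single_component_stable_map:
  assumes "P1_morphism n k d f" "1 \<le> d"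
  shows "\<lparr>sm_comps = {0}, sm_adj = {}, sm_node = (\<lambda>_ _. None), sm_map = (\<lambda>_. f), sm_deg = (\<lambda>_. d),
    sm_mark1 = (0, None), sm_mark2 = (0, Some 0)\<rparr> \<in> stable_maps n k d"
  using assms by (auto simp: stable_maps_def prestable_curve_def sm_nodes_def sym_def irrefl_def)

lemma schubert_variety_cell:
  assumes "schubert_index n k w"
  shows "admissible n k (w ` {1..k})" "schubert_variety n k w = zariski n k closure_of (schubert_cell n (w ` {1..k}))"
proof -
  have "inj_on w {1..k}" using assms by (auto simp: schubert_index_def intro: strict_mono_on_imp_inj_on)
  then have "card (w ` {1..k}) = k" by (simp add: card_image)
  then show adm: "admissible n k (w ` {1..k})"
    using assms unfolding admissible_def schubert_index_def by (metis (no_types, lifting) imageE)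
  show "schubert_variety n k w = zariski n k closure_of (schubert_cell n (w ` {1..k}))"
    unfolding schubert_variety_def borel_orbit[OF adm, symmetric] coord_space_def ..
qed

text \<open>If \<open>1 \<in> w\<close>, at most k - 1 indices of \<open>w\<close> exceed 1. This
  rank condition is closed, so every point of the closure lies in a cell whose index contains 1, and
  the group fixes e_1.\<close>

lemma one_notin_index:
  assumes w: "admissible n k w" and V: "V \<in> zariski n k closure_of (schubert_cell n w)" "basis_vec 1 \<notin> V"
  shows "1 \<notin> w"
proof
  assume "1 \<in> w"
  have "V \<in> IG n k" using V(1) closure_of_subset_topspace topspace_zariski by fastforce
  then obtain v where v: "admissible n k v" "V \<in> schubert_cell n v" using IG_schubert_cell by metis
  obtain g where g: "g \<in> unipotent n" "V = g ` coord_space v" using v(2) by (auto simp: schubert_cell_def)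
  have card: "count_above u 1 = card (u - {1})" if "admissible n k u" for u
  proof -
    have "u \<inter> {1<..} = u - {1}" using that by (auto simp: admissible_def)
    then show ?thesis by (simp add: count_above_def)
  qed
  have "card (v - {1}) \<le> card (w - {1})"
    using minors_vanish_cellD[OF v minors_vanish_closure[OF w V(1)], of 1] card[OF v(1)] card[OF w] by simp
  also have "\<dots> < card w" using \<open>1 \<in> w\<close> admissible_finite[OF w] by (intro card_Diff1_less)
  finally have "card (v - {1}) < card v" using v(1) w by (auto simp: admissible_def)
  then have "1 \<in> v" by (metis Diff_empty Diff_insert0 less_irrefl)
  then have "basis_vec 1 \<in> coord_space v" by (rule basis_vec_coord_space)
  moreover have "g (basis_vec 1) = basis_vec 1"
  proof
    fix i
    have E1: "basis_vec 1 \<in> E n" by (rule basis_vec_E) auto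
    show "g (basis_vec 1) i = basis_vec 1 i"
    proof (cases "i = 0")
      case True
      then show ?thesis using unipotent_E[OF g(1) E1] E1 by (auto simp: E_iff)
    next
      case False
      then show ?thesis by (intro unipotent_lead[OF g(1) E1, of 1]) (auto simp: basis_vec_def)
    qed
  qed
  ultimately have "basis_vec 1 \<in> V" unfolding g(2) by (metis imageI)
  with V(2) show False by simp
qed

theorem proposition4p5:
  fixes n k d :: nat and w :: "nat \<Rightarrow> nat"
  assumes "1 \<le> k" and "k \<le> n + 1"
    and "schubert_index n k w"
    and "schubert_variety n k w \<inter> IG_open n k \<noteq> {}"
  shows "irreducible_in (zariski n k) (curve_nbhd n k d (schubert_variety n k w))"
proof -
  define v where "v = w ` {1..k}"
  have v: "admissible n k v" and X: "schubert_variety n k w = zariski n k closure_of (schubert_cell n v)"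
    unfolding v_def using schubert_variety_cell[OF assms(3)] by auto
  obtain V where "V \<in> zariski n k closure_of (schubert_cell n v)" "basis_vec 1 \<notin> V"
    using assms(4) unfolding X by (auto simp: IG_open_def)
  then have one: "1 \<notin> v" by (rule one_notin_index[OF v])
  have schubert_cell_sub: "schubert_cell n u \<subseteq> zariski n k closure_of (schubert_cell n u)" if "admissible n k u" for u
    using schubert_cell_subset_IG[OF that] by (intro closure_of_subset) (simp add: topspace_zariski)
  show ?thesis
  proof (cases "d = 0")
    case True
    then show ?thesis unfolding X
      using irreducible_in_between[OF schubert_cell_irreducible[OF v] schubert_cell_sub[OF v]] by (simp add: curve_nbhd_def)
  next
    case False
    \<comment> \<open>The number of vectors that can be replaced; beyond \<open>k\<close> a higher
      degree imposes no weaker rank conditions.\<close>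
    define c where "c = min d k"
    obtain W D where WD: "W \<inter> D = {}" "card D = c" "D \<subseteq> {n+2..2*n+1}"
      "admissible n k (W \<union> D)" "admissible n k (W \<union> idx_bar n ` D)" "W \<inter> idx_bar n ` D = {}"
      "bruhat_le (W \<union> idx_bar n ` D) v"
      and upper: "\<And>u. finite u \<Longrightarrow> u \<subseteq> {1..2*n+1} \<Longrightarrow> card u = k \<Longrightarrow> (\<And>i. count_above u i \<le> count_above v i + c) \<Longrightarrow> bruhat_le u (W \<union> D)"
      by (rule neighbourhood_index[OF v one, of c]) (auto simp: c_def)
    have D: "D \<noteq> {}" "card D \<le> d" using False assms(1) WD(2) by (auto simp: c_def)
    define N where "N = curve_nbhd n k d (schubert_variety n k w)"
    \<comment> \<open>One \<open>g\<close> moves both ends of the curve. The starting end stays in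
      the cell of \<open>W\<close> and bar \<open>D\<close>, all of which lies in the Schubert
      variety.\<close>
    have "schubert_cell n (W \<union> D) \<subseteq> N"
    proof
      fix V assume "V \<in> schubert_cell n (W \<union> D)"
      then obtain g where g: "g \<in> unipotent n" "V = g ` coord_space (W \<union> D)" by (auto simp: schubert_cell_def)
      obtain f where f: "P1_morphism n k d f" "f None = g ` coord_space (W \<union> idx_bar n ` D)"
        "f (Some 0) = g ` coord_space (W \<union> D)"
        using connecting_curve[OF WD(4,1,5,6) D g(1)] .
      define m where "m = \<lparr>sm_comps = {0}, sm_adj = {}, sm_node = (\<lambda>_ _. None), sm_map = (\<lambda>_. f),
        sm_deg = (\<lambda>_. d), sm_mark1 = (0, None), sm_mark2 = (0, Some 0)\<rparr>"
      have "m \<in> stable_maps n k d"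
        unfolding m_def using False by (intro single_component_stable_map f(1)) simp
      moreover have "ev1 m \<in> schubert_variety n k w"
      proof -
        have "ev1 m \<in> schubert_cell n (W \<union> idx_bar n ` D)" using g(1) f(2) by (auto simp: ev1_def m_def schubert_cell_def)
        then show ?thesis using bruhat_le_closure[OF WD(5) v WD(7)] X by auto
      qed
      moreover have "ev2 m = V" using g(2) f(3) by (simp add: ev2_def m_def)
      ultimately show "V \<in> N" using False by (auto simp: N_def curve_nbhd_def)
    qed
    moreover have "N \<subseteq> zariski n k closure_of (schubert_cell n (W \<union> D))"
    proof
      fix V assume "V \<in> N"
      then obtain m where m: "m \<in> stable_maps n k d" "ev1 m \<in> schubert_variety n k w" "V = ev2 m"
        using False by (auto simp: N_def curve_nbhd_def)
      have van: "minors_vanish n k V i (count_above v i + d)" for i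
        unfolding m(3) using m(1) assms(1) minors_vanish_closure[OF v m(2)[unfolded X]] by (rule minors_vanish_stable_map)
      have "V \<in> IG n k"
        using m(1,3) by (auto simp: stable_maps_def prestable_curve_def ev2_def P1_morphism_def)
      then obtain u where u: "admissible n k u" "V \<in> schubert_cell n u" using IG_schubert_cell by metis
      have uN: "finite u" "u \<subseteq> {1..2*n+1}" "card u = k"
        using u(1) admissible_finite by (auto simp: admissible_def)
      \<comment> \<open>The curve gives the loss \<open>d\<close>, and the size of \<open>u\<close>
        bounds the count by \<open>k\<close>; together they give the loss \<open>c\<close>.\<close>
      have "count_above u i \<le> count_above v i + c" for i
        using minors_vanish_cellD[OF u van, of i] count_above_le_card[OF uN(1), of i] uN(3) by (auto simp: c_def)
      then have "bruhat_le u (W \<union> D)" by (rule upper[OF uN])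
      then show "V \<in> zariski n k closure_of (schubert_cell n (W \<union> D))"
        using bruhat_le_closure[OF u(1) WD(4)] u(2) by auto
    qed
    ultimately show ?thesis
      unfolding N_def[symmetric] using irreducible_in_between[OF schubert_cell_irreducible[OF WD(4)]] by blast
  qed
qed

end
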